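(* Let $Y$ be a subspace of $L_1[0,1]$ with its usual norm. Then the following are equivalent: (i) $Y$ is reflexive; (ii) $Y$ has the fixed point property.
   Context: $L_1[0,1]$ is the Banach space of (equivalence classes modulo a.e. equality of) Lebesgue integrable scalar functions on $[0,1]$ with norm $\|f\|_1=\int_0^1|f|$. "Subspace" means closed linear subspace. A Banach space $(X,\|\cdot\|_X)$ has the fixed point property if for every non-empty, closed, bounded and convex subset $C$ of $X$, every nonexpansive mapping $T:C\to C$ (i.e. $\|Tx-Ty\|_X\le\|x-y\|_X$ for all $x,y\in C$) has a fixed point. *)

theory Defs
  imports "HOL-Analysis.Analysis" "HOL-Library.Function_Algebras"
begin

text \<open>
  \<open>'a L1\<close> is $L_1[0,1]$ with scalars \<open>'a\<close> (real or complex). Representatives are total functions on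
  the reals, but only their values on $[0,1]$ matter: the measure \<^term>\<open>lebesgue_on {0..1::real}\<close> has
  space $[0,1]$.
\<close>

quotient_type (overloaded) 'a L1 = "real \<Rightarrow> 'a :: {banach, second_countable_topology}" / partial:
  "\<lambda>f g. integrable (lebesgue_on {0..1}) f \<and> integrable (lebesgue_on {0..1}) g \<and>
         (AE x in lebesgue_on {0..1}. f x = g x)"
proof (rule part_equivpI)
  show "\<exists>f :: real \<Rightarrow> 'a. integrable (lebesgue_on {0..1}) f \<and> integrable (lebesgue_on {0..1}) f \<and>
      (AE x in lebesgue_on {0..1}. f x = f x)"
    by (rule exI[of _ "\<lambda>_. 0"]) simp
qed (auto intro!: sympI transpI elim: AE_mp)

instantiation L1 :: ("{banach, second_countable_topology}") real_normed_vector
begin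

lift_definition zero_L1 :: "'a L1" is "\<lambda>_. 0" by simp

lift_definition plus_L1 :: "'a L1 \<Rightarrow> 'a L1 \<Rightarrow> 'a L1" is "\<lambda>f g x. f x + g x"
  by (auto elim: AE_mp)

lift_definition minus_L1 :: "'a L1 \<Rightarrow> 'a L1 \<Rightarrow> 'a L1" is "\<lambda>f g x. f x - g x"
  by (auto elim: AE_mp)

lift_definition uminus_L1 :: "'a L1 \<Rightarrow> 'a L1" is "\<lambda>f x. - f x"
  by (auto elim: AE_mp)

lift_definition scaleR_L1 :: "real \<Rightarrow> 'a L1 \<Rightarrow> 'a L1" is "\<lambda>c f x. c *\<^sub>R f x"
  by (auto elim: AE_mp)

lift_definition norm_L1 :: "'a L1 \<Rightarrow> real" is "\<lambda>f. \<integral>x. norm (f x) \<partial>lebesgue_on {0..1}"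
  by (intro integral_cong_AE) (auto elim: AE_mp)

definition "dist f g = norm (f - g)" for f g :: "'a L1"
definition "sgn f = scaleR (inverse (norm f)) f" for f :: "'a L1"
definition "uniformity = (INF e\<in>{0<..}. principal {(f, g :: 'a L1). dist f g < e})"
definition "open U = (\<forall>f\<in>U. eventually (\<lambda>(f', g). f' = f \<longrightarrow> g \<in> U) uniformity)" for U :: "'a L1 set"

instance
proof
  fix f g h :: "'a L1" and a b :: real and U :: "'a L1 set"
  show "f + g + h = f + (g + h)" by transfer (auto simp: algebra_simps)
  show "f + g = g + f" by transfer (auto simp: algebra_simps)
  show "0 + f = f" by transfer auto
  show "- f + f = 0" by transfer auto
  show "f - g = f + - g" by transfer auto
  show "a *\<^sub>R (f + g) = a *\<^sub>R f + a *\<^sub>R g" by transfer (auto simp: algebra_simps)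
  show "(a + b) *\<^sub>R f = a *\<^sub>R f + b *\<^sub>R f" by transfer (auto simp: algebra_simps)
  show "a *\<^sub>R b *\<^sub>R f = (a * b) *\<^sub>R f" by transfer auto
  show "1 *\<^sub>R f = f" by transfer auto
  show "dist f g = norm (f - g)" by (rule dist_L1_def)
  show "sgn f = scaleR (inverse (norm f)) f" by (rule sgn_L1_def)
  show "uniformity = (INF e\<in>{0<..}. principal {(f, g :: 'a L1). dist f g < e})"
    by (rule uniformity_L1_def)
  show "open U = (\<forall>f\<in>U. eventually (\<lambda>(f', g). f' = f \<longrightarrow> g \<in> U) uniformity)"
    by (rule open_L1_def)
  show "norm f = 0 \<longleftrightarrow> f = 0"
    by transfer (simp add: integral_nonneg_eq_0_iff_AE)
  show "norm (f + g) \<le> norm f + norm g"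
  proof transfer
    fix f g :: "real \<Rightarrow> 'a"
    assume "integrable (lebesgue_on {0..1}) f \<and> integrable (lebesgue_on {0..1}) f \<and>
        (AE x in lebesgue_on {0..1}. f x = f x)"
      and "integrable (lebesgue_on {0..1}) g \<and> integrable (lebesgue_on {0..1}) g \<and>
        (AE x in lebesgue_on {0..1}. g x = g x)"
    then have fg: "integrable (lebesgue_on {0..1}) f" "integrable (lebesgue_on {0..1}) g" by auto
    have "(\<integral>x. norm (f x + g x) \<partial>lebesgue_on {0..1}) \<le>
        (\<integral>x. norm (f x) + norm (g x) \<partial>lebesgue_on {0..1})"
      using fg by (intro integral_mono) (auto intro: norm_triangle_ineq)
    also have "\<dots> = (\<integral>x. norm (f x) \<partial>lebesgue_on {0..1}) + (\<integral>x. norm (g x) \<partial>lebesgue_on {0..1})"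
      using fg by simp
    finally show "(\<integral>x. norm (f x + g x) \<partial>lebesgue_on {0..1}) \<le>
        (\<integral>x. norm (f x) \<partial>lebesgue_on {0..1}) + (\<integral>x. norm (g x) \<partial>lebesgue_on {0..1})" .
  qed
  show "norm (a *\<^sub>R f) = \<bar>a\<bar> * norm f" by transfer simp
qed

end

lift_definition scale_L1 ::
  "'a :: {real_normed_field, banach, second_countable_topology} \<Rightarrow> 'a L1 \<Rightarrow> 'a L1"
  is "\<lambda>c f x. c * f x"
  by (auto elim: AE_mp)

global_interpretation L1: vector_space
  "scale_L1 :: 'a :: {real_normed_field, banach, second_countable_topology} \<Rightarrow> 'a L1 \<Rightarrow> 'a L1"
proof
  fix a b :: 'a and f g :: "'a L1"
  show "scale_L1 a (f + g) = scale_L1 a f + scale_L1 a g" by transfer (auto simp: algebra_simps)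
  show "scale_L1 (a + b) f = scale_L1 a f + scale_L1 b f" by transfer (auto simp: algebra_simps)
  show "scale_L1 a (scale_L1 b f) = scale_L1 (a * b) f" by transfer (auto simp: algebra_simps)
  show "scale_L1 1 f = f" by transfer auto
qed

lemma scaleR_L1_eq_scale_L1:
  "r *\<^sub>R f = scale_L1 (of_real r) f"
  for f :: "'a :: {real_normed_field, banach, second_countable_topology} L1"
  by transfer (auto simp: scaleR_conv_of_real)

text \<open>
  A normed space over \<open>'k\<close> is given by a carrier \<open>V\<close>, a scalar multiplication \<open>s\<close> and a norm \<open>N\<close>.
  Its dual is carried by the bounded linear functionals on \<open>V\<close>, extended by 0 outside \<open>V\<close> so that
  functionals agreeing on \<open>V\<close> are equal; it is closed under the pointwise operations on functions.
\<close>

definition dual_space ::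
  "('k \<Rightarrow> 'v \<Rightarrow> 'v) \<Rightarrow> ('v \<Rightarrow> real) \<Rightarrow> 'v::plus set \<Rightarrow> ('v \<Rightarrow> 'k::real_normed_field) set" where
  "dual_space s N V = {\<phi>.
     (\<forall>x\<in>V. \<forall>y\<in>V. \<phi> (x + y) = \<phi> x + \<phi> y) \<and>
     (\<forall>c. \<forall>x\<in>V. \<phi> (s c x) = c * \<phi> x) \<and>
     (\<exists>K. \<forall>x\<in>V. norm (\<phi> x) \<le> K * N x) \<and>
     (\<forall>x. x \<notin> V \<longrightarrow> \<phi> x = 0)}"

definition dual_norm :: "('v \<Rightarrow> real) \<Rightarrow> 'v set \<Rightarrow> ('v \<Rightarrow> 'k::real_normed_field) \<Rightarrow> real" where
  "dual_norm N V \<phi> = (SUP x\<in>{x\<in>V. N x \<le> 1}. norm (\<phi> x))"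

definition bidual_space ::
  "('k \<Rightarrow> 'v \<Rightarrow> 'v) \<Rightarrow> ('v \<Rightarrow> real) \<Rightarrow> 'v::plus set \<Rightarrow> (('v \<Rightarrow> 'k::real_normed_field) \<Rightarrow> 'k) set" where
  "bidual_space s N V =
     dual_space (\<lambda>c \<phi> x. c * \<phi> x) (dual_norm N V) (dual_space s N V)"

definition canonical_embedding ::
  "('k \<Rightarrow> 'v \<Rightarrow> 'v) \<Rightarrow> ('v \<Rightarrow> real) \<Rightarrow> 'v::plus set \<Rightarrow> 'v \<Rightarrow> ('v \<Rightarrow> 'k::real_normed_field) \<Rightarrow> 'k" where
  "canonical_embedding s N V x = (\<lambda>\<phi>. if \<phi> \<in> dual_space s N V then \<phi> x else 0)"

definition reflexive_space ::
  "('k::real_normed_field \<Rightarrow> 'v \<Rightarrow> 'v) \<Rightarrow> ('v \<Rightarrow> real) \<Rightarrow> 'v::plus set \<Rightarrow> bool" where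
  "reflexive_space s N V \<longleftrightarrow> canonical_embedding s N V ` V = bidual_space s N V"

definition fixed_point_property :: "'v::real_normed_vector set \<Rightarrow> bool" where
  "fixed_point_property X \<longleftrightarrow>
     (\<forall>C T. C \<subseteq> X \<and> C \<noteq> {} \<and> closedin (top_of_set X) C \<and> bounded C \<and> convex C \<and>
        T \<in> C \<rightarrow> C \<and> (\<forall>x\<in>C. \<forall>y\<in>C. norm (T x - T y) \<le> norm (x - y)) \<longrightarrow>
        (\<exists>x\<in>C. T x = x))"

end

theory Submission
  imports Defs
begin

text \<open>
  Both properties of \<open>Y\<close> are equivalent to uniform integrability of its unit ball.

  If the unit ball is not uniformly integrable, then \<open>Y\<close> contains normalised functions that are
  disjointly supported up to arbitrarily small errors. They span an asymptotically isometric copy of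
  $l_1$, on which a weighted right shift acts without fixed points (Dowling and Lennard), and a limit of
  the evaluations at these functions along an ultrafilter is an element of the bidual that is not
  represented in \<open>Y\<close>.

  If it is uniformly integrable, near-minimisers of the strictly convex functional
  $\int \sqrt{1 + |f|^2}$ converge in norm, hence directed families of closed convex subsets of balls
  have common points; with Helly's lemma this yields reflexivity. For the fixed point property (Maurey)
  take a minimal invariant convex set of diameter \<open>d > 0\<close>. By the Goebel-Karlovitz lemma, triples of
  asymptotically independent approximate fixed points have mutual distances \<open>d\<close>, and so do each of
  them and the midpoint of the other two. Strict convexity of the absolute value then forces two of
  the three values to coincide almost everywhere. Therefore approximate fixed points that divide a
  segment \<open>[p, q]\<close> metrically into \<open>N\<close> equal parts take pointwise only the values of \<open>p\<close> and \<open>q\<close>, and their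
  successive differences are \<open>N\<close> functions in \<open>Y\<close> of norm \<open>d / N\<close> with disjoint supports, which
  contradicts uniform integrability for large \<open>N\<close>.
\<close>

section \<open>Uniform integrability\<close>

text \<open>Weak limits are replaced by points common to closed convex hulls. Such a point is no
  farther from any \<open>y\<close> than the hulled points are, which is the one property of weak
  limits that the fixed point argument uses. The truncated tail \<open>excess R f\<close> is convex
  and 1-Lipschitz in \<open>f\<close>, so its bounds survive closed convex hulls. It also controls
  pointwise maxima: the maximum of finitely many moduli is at most \<open>c\<close> plus the sum of
  their excesses over \<open>c\<close>. Such maxima appear where sums would be too large. The chain
  points of one copy are known to be independent only of the end points of other copies. They take
  the values of another pair, and these must first be recognised as the values of their own pair,
  which works where both pairs are spread out. Hence \<open>M\<close> copies are compared: at each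
  place at most one spread-out copy can lack a partner, and averaging over the copies makes this
  loss small. All of this is quantitative, at a fixed \<epsilon>, instead of in an ultraproduct.
  Real and complex scalars are treated together through the real inner product of the field.\<close>

abbreviation I01 :: "real measure" where "I01 \<equiv> lebesgue_on {0..1}"

lemma finite_measure_I01: "finite_measure I01"
  by (rule finite_measureI) (simp add: emeasure_restrict_space)

interpretation I01: finite_measure I01
  by (rule finite_measure_I01)

lemma measure_I01 [simp]: "measure I01 (space I01) = 1" "measure I01 {0..1} = 1"
  by (simp_all add: measure_restrict_space)

section \<open>Representatives modulo null sets, and completeness of the space\<close>

lemma integrable_rep_L1 [simp, intro]: "integrable I01 (rep_L1 f)"
  using Quotient_rep_reflp[OF Quotient_L1] by auto

lemma borel_measurable_rep_L1 [measurable]: "rep_L1 f \<in> borel_measurable I01"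
  by (rule borel_measurable_integrable) simp

lemma AE_rep_abs_L1: "integrable I01 f \<Longrightarrow> AE x in I01. rep_L1 (abs_L1 f) x = f x"
  using Quotient_rep_abs[OF Quotient_L1, of f] by auto

lemma abs_rep_L1 [simp]: "abs_L1 (rep_L1 f) = f"
  by (rule Quotient_abs_rep[OF Quotient_L1])

lemma AE_rep_add: "AE x in I01. rep_L1 (f + g) x = rep_L1 f x + rep_L1 g x"
  using AE_rep_abs_L1[of "\<lambda>x. rep_L1 f x + rep_L1 g x"] plus_L1.abs_eq[of "rep_L1 f" "rep_L1 g"]
  by simp

lemma AE_rep_diff: "AE x in I01. rep_L1 (f - g) x = rep_L1 f x - rep_L1 g x"
  using AE_rep_abs_L1[of "\<lambda>x. rep_L1 f x - rep_L1 g x"] minus_L1.abs_eq[of "rep_L1 f" "rep_L1 g"]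
  by simp

lemma AE_rep_scaleR: "AE x in I01. rep_L1 (c *\<^sub>R f) x = c *\<^sub>R rep_L1 f x"
  using AE_rep_abs_L1[of "\<lambda>x. c *\<^sub>R rep_L1 f x"] scaleR_L1.abs_eq[of "rep_L1 f" c]
  by simp

lemma AE_rep_zero: "AE x in I01. rep_L1 0 x = 0"
  using AE_rep_abs_L1[of "\<lambda>x. 0"] by (simp add: zero_L1_def)

lemma AE_rep_sum: 
  assumes "finite S"
  shows "AE x in I01. rep_L1 (\<Sum>i\<in>S. f i) x = (\<Sum>i\<in>S. rep_L1 (f i) x)"
  using assms
proof (induction S)
  case empty
  show ?case using AE_rep_zero by simp
next
  case (insert i S)
  show ?case using insert.IH AE_rep_add[of "f i" "\<Sum>i\<in>S. f i"] insert.hyps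
    by (auto elim: AE_mp)
qed

lemma norm_L1_eq: "norm f = (\<integral>x. norm (rep_L1 f x) \<partial>I01)"
  by (rule norm_L1.rep_eq)

lemma norm_abs_L1: "integrable I01 f \<Longrightarrow> norm (abs_L1 f) = (\<integral>x. norm (f x) \<partial>I01)"
  by (rule norm_L1.abs_eq) simp

text \<open>The Riesz-Fischer argument: along a subsequence with increments of norm below
  \<open>(1/2)^k\<close> the increments sum absolutely almost everywhere, and a Cauchy sequence
  converges with any of its subsequences. Completeness later supplies the limits of Cauchy filters,
  of vector series and of contractions.\<close>

instance L1 :: ("{banach, second_countable_topology}") banach
proof
  fix X :: "nat \<Rightarrow> 'a L1"
  assume X: "Cauchy X"
  have "\<exists>N. \<forall>m\<ge>N. \<forall>n\<ge>N. dist (X m) (X n) < (1/2)^k" for k :: nat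
    using X by (simp add: Cauchy_def)
  then obtain N where N: "\<And>k m n. m \<ge> N k \<Longrightarrow> n \<ge> N k \<Longrightarrow> dist (X m) (X n) < (1/2)^k"
    by metis
  \<comment> \<open>Summing the \<open>N j\<close> and adding \<open>k\<close> makes
    \<open>s\<close> strictly increasing as well as at least \<open>N k\<close>.\<close>
  define s where "s k = (\<Sum>j\<le>k. N j) + k" for k
  have sN: "s k \<ge> N k" for k
    unfolding s_def by (meson finite_atMost le_add1 member_le_sum order_trans atMost_iff order_refl zero_le)
  have s_mono: "s k < s (Suc k)" for k
    unfolding s_def by simp
  have sm: "strict_mono s" using s_mono by (simp add: strict_mono_Suc_iff)
  define d where "d k = rep_L1 (X (s (Suc k)) - X (s k))" for k
  have nd: "(\<integral>x. norm (d k x) \<partial>I01) \<le> (1/2)^k" for k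
  proof -
    have "(\<integral>x. norm (d k x) \<partial>I01) = dist (X (s (Suc k))) (X (s k))"
      by (simp add: d_def norm_L1_eq[symmetric] dist_norm)
    also have "\<dots> < (1/2)^k" 
      using N[of k "s (Suc k)" "s k"] sN[of k] s_mono[of k] by simp
    finally show ?thesis by simp
  qed
  have sum_d: "summable (\<lambda>k. \<integral>x. norm (d k x) \<partial>I01)"
    by (rule summable_comparison_test'[where g = "\<lambda>k. (1/2)^k"]) (use nd in auto)
  have intd: "integrable I01 (d k)" for k by (simp add: d_def)
  have AEs: "AE x in I01. summable (\<lambda>k. norm (d k x))"
  proof -
    have "(\<integral>\<^sup>+ x. (\<Sum>k. ennreal (norm (d k x))) \<partial>I01) = (\<Sum>k. \<integral>\<^sup>+ x. ennreal (norm (d k x)) \<partial>I01)"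
      using intd by (intro nn_integral_suminf) auto
    also have "\<dots> = (\<Sum>k. ennreal (\<integral>x. norm (d k x) \<partial>I01))"
      using intd by (intro suminf_cong nn_integral_eq_integral) auto
    also have "\<dots> = ennreal (\<Sum>k. (\<integral>x. norm (d k x) \<partial>I01))"
      using sum_d by (intro suminf_ennreal2) auto
    finally have "(\<integral>\<^sup>+ x. (\<Sum>k. ennreal (norm (d k x))) \<partial>I01) \<noteq> \<infinity>" by simp
    then have "AE x in I01. (\<Sum>k. ennreal (norm (d k x))) \<noteq> \<infinity>"
      using intd by (intro nn_integral_PInf_AE) (auto)
    then show ?thesis
      by eventually_elim (metis infinity_ennreal_def norm_ge_zero summable_suminf_not_top)
  qed
  define F where "F = (\<lambda>x. \<Sum>k. d k x)"
  have intF: "integrable I01 F"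
    unfolding F_def using intd AEs sum_d by (rule integrable_suminf)
  have tend: "(\<lambda>k. X (s k)) \<longlonglongrightarrow> X (s 0) + abs_L1 F"
  proof (rule LIMSEQ_I)
    fix e :: real assume "e > 0"
    let ?a = "\<lambda>k. \<integral>x. norm (d k x) \<partial>I01"
    obtain k0 where k0: "\<And>k. k \<ge> k0 \<Longrightarrow> (\<Sum>j. ?a (j + k)) < e"
    proof -
      have "(\<lambda>k. \<Sum>j. ?a (j + k)) \<longlonglongrightarrow> 0" by (rule suminf_exist_split2[OF sum_d])
      then have "eventually (\<lambda>k. (\<Sum>j. ?a (j + k)) < e) sequentially"
        using \<open>e > 0\<close> by (rule order_tendstoD)
      then show ?thesis using that by (auto simp: eventually_sequentially)
    qed
    show "\<exists>no. \<forall>n\<ge>no. norm (X (s n) - (X (s 0) + abs_L1 F)) < e"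
    proof (intro exI[of _ k0] allI impI)
      fix n assume "n \<ge> k0"
      have tel: "X (s n) = X (s 0) + (\<Sum>k<n. abs_L1 (d k))"
        by (induction n) (auto simp: d_def)
      let ?T = "\<lambda>x. \<Sum>k. d (k + n) x"
      have "norm (X (s n) - (X (s 0) + abs_L1 F)) = norm ((\<Sum>k<n. abs_L1 (d k)) - abs_L1 F)"
        by (simp add: tel)
      also have "\<dots> = (\<integral>x. norm (rep_L1 ((\<Sum>k<n. abs_L1 (d k)) - abs_L1 F) x) \<partial>I01)"
        by (rule norm_L1_eq)
      also have "\<dots> = (\<integral>x. norm (?T x) \<partial>I01)"
      proof (rule integral_cong_AE)
        have "AE x in I01. rep_L1 (\<Sum>k<n. abs_L1 (d k)) x = (\<Sum>k<n. d k x)"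
          using AE_rep_sum[of "{..<n}" "\<lambda>k. abs_L1 (d k)"] by (simp add: d_def)
        with AE_rep_diff[of "\<Sum>k<n. abs_L1 (d k)" "abs_L1 F"] AE_rep_abs_L1[OF intF] AEs
        show "AE x in I01. norm (rep_L1 ((\<Sum>k<n. abs_L1 (d k)) - abs_L1 F) x) = norm (?T x)"
        proof eventually_elim
          case (elim x)
          have "summable (\<lambda>k. d k x)" using elim(3) by (rule summable_norm_cancel)
          then have "F x = ?T x + (\<Sum>k<n. d k x)"
            unfolding F_def by (rule suminf_split_initial_segment)
          then show ?case using elim by (simp add: norm_minus_commute)
        qed
      qed (use intd in auto)
      also have "\<dots> \<le> (\<integral>x. (\<Sum>k. norm (d (k + n) x)) \<partial>I01)"
      proof (rule integral_mono_AE)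
        show "integrable I01 (\<lambda>x. norm (?T x))"
          by (intro integrable_norm integrable_suminf intd)
            (use AEs sum_d in \<open>auto simp: summable_iff_shift[of "\<lambda>k. norm (d k _)"] summable_iff_shift[of ?a]\<close>)
        show "integrable I01 (\<lambda>x. \<Sum>k. norm (d (k + n) x))"
          by (intro integrable_suminf integrable_norm intd)
            (use AEs sum_d in \<open>auto simp: summable_iff_shift[of "\<lambda>k. norm (d k _)"] summable_iff_shift[of ?a]\<close>)
        show "AE x in I01. norm (?T x) \<le> (\<Sum>k. norm (d (k + n) x))"
          using AEs by eventually_elim
            (auto intro!: summable_norm simp: summable_iff_shift[of "\<lambda>k. norm (d k _)"])
      qed
      also have "\<dots> = (\<Sum>k. ?a (k + n))"
        by (intro integral_suminf integrable_norm intd)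
            (use AEs sum_d in \<open>auto simp: summable_iff_shift[of "\<lambda>k. norm (d k _)"] summable_iff_shift[of ?a]\<close>)
      also have "\<dots> < e" using k0 \<open>n \<ge> k0\<close> by simp
      finally show "norm (X (s n) - (X (s 0) + abs_L1 F)) < e" .
    qed
  qed
  show "convergent X"
  proof -
    have "X \<longlonglongrightarrow> X (s 0) + abs_L1 F"
    proof (rule LIMSEQ_I)
      fix e :: real assume "e > 0"
      then obtain M where M: "\<And>m n. m \<ge> M \<Longrightarrow> n \<ge> M \<Longrightarrow> dist (X m) (X n) < e/2"
        using X unfolding Cauchy_def by (metis half_gt_zero)
      obtain k where k: "\<And>n. n \<ge> k \<Longrightarrow> norm (X (s n) - (X (s 0) + abs_L1 F)) < e/2"
        using LIMSEQ_D[OF tend, of "e/2"] \<open>e > 0\<close> by auto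
      let ?j = "s (max k M)"
      have "?j \<ge> M" using seq_suble[OF sm, of "max k M"] by simp
      show "\<exists>no. \<forall>n\<ge>no. norm (X n - (X (s 0) + abs_L1 F)) < e"
      proof (intro exI[of _ M] allI impI)
        fix n assume "n \<ge> M"
        have "norm (X n - X ?j) < e/2" using M[OF \<open>n \<ge> M\<close> \<open>?j \<ge> M\<close>] by (simp add: dist_norm)
        moreover have "norm (X ?j - (X (s 0) + abs_L1 F)) < e/2" by (rule k) simp
        ultimately show "norm (X n - (X (s 0) + abs_L1 F)) < e"
          using norm_diff_triangle_less[of "X n" "X ?j" "e/2" "X (s 0) + abs_L1 F" "e/2"] by simp
      qed
    qed
    then show ?thesis by (auto simp: convergent_def)
  qed
qed


section \<open>Truncated tails\<close>

definition excess :: "real \<Rightarrow> 'a::{banach, second_countable_topology} L1 \<Rightarrow> real" where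
  "excess R f = (\<integral>x. max (norm (rep_L1 f x) - R) 0 \<partial>I01)"

definition equi_int :: "'a::{banach, second_countable_topology} L1 set \<Rightarrow> bool" where
  "equi_int W \<longleftrightarrow> (\<forall>\<eta>>0. \<exists>R\<ge>0. \<forall>f\<in>W. excess R f \<le> \<eta>)"

lemma integrable_excess [simp, intro]: "integrable I01 (\<lambda>x. max (norm (rep_L1 f x) - R) 0)"
  by (intro integrable_max Bochner_Integration.integrable_diff integrable_norm) auto

lemma excess_antimono: "R \<le> S \<Longrightarrow> excess S f \<le> excess R f"
  unfolding excess_def by (rule integral_mono) auto

lemma excess_0 [simp]: "excess 0 f = norm f"
  unfolding excess_def norm_L1_eq by (intro Bochner_Integration.integral_cong) auto

lemma excess_le_norm: "0 \<le> R \<Longrightarrow> excess R f \<le> norm f"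
  using excess_antimono[of 0 R f] by simp

text \<open>The threshold may be split between the summands. With one threshold 0 this becomes the
  Lipschitz bound, and with thresholds in proportion to the weights it becomes convexity.\<close>

lemma excess_add: "excess (R + S) (f + g) \<le> excess R f + excess S g"
proof -
  have "excess (R + S) (f + g) 
      \<le> (\<integral>x. max (norm (rep_L1 f x) - R) 0 + max (norm (rep_L1 g x) - S) 0 \<partial>I01)"
    unfolding excess_def
  proof (rule integral_mono_AE)
    show "AE x in I01. max (norm (rep_L1 (f + g) x) - (R + S)) 0
        \<le> max (norm (rep_L1 f x) - R) 0 + max (norm (rep_L1 g x) - S) 0"
      using AE_rep_add[of f g]
    proof eventually_elim
      case (elim x)
      then show ?case using norm_triangle_ineq[of "rep_L1 f x" "rep_L1 g x"] by (simp add: max_def)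
    qed
  qed auto
  then show ?thesis by (simp add: excess_def)
qed

lemma excess_scaleR: "excess (\<bar>c\<bar> * R) (c *\<^sub>R f) = \<bar>c\<bar> * excess R f"
proof -
  have "excess (\<bar>c\<bar> * R) (c *\<^sub>R f) = (\<integral>x. \<bar>c\<bar> * max (norm (rep_L1 f x) - R) 0 \<partial>I01)"
    unfolding excess_def
  proof (rule integral_cong_AE)
    show "AE x in I01. max (norm (rep_L1 (c *\<^sub>R f) x) - \<bar>c\<bar> * R) 0
        = \<bar>c\<bar> * max (norm (rep_L1 f x) - R) 0"
      using AE_rep_scaleR[of c f]
      by eventually_elim (simp add: max_mult_distrib_left right_diff_distrib)
  qed auto
  then show ?thesis by (simp add: excess_def)
qed

lemma excess_add_norm: "excess R (f + g) \<le> excess R f + norm g"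
  using excess_add[of R 0 f g] by simp

lemma excess_lipschitz: "\<bar>excess R f - excess R g\<bar> \<le> norm (f - g)"
  using excess_add_norm[of R g "f - g"] excess_add_norm[of R f "g - f"]
  by (simp add: norm_minus_commute)

lemma continuous_on_excess: "continuous_on S (excess R)"
proof (rule continuous_onI)
  fix f :: "'a L1" and e :: real assume "f \<in> S" "e > 0"
  then show "\<exists>d>0. \<forall>f'\<in>S. dist f' f < d \<longrightarrow> dist (excess R f') (excess R f) \<le> e"
    by (intro exI[of _ e]) (auto simp: dist_norm intro: order_trans[OF excess_lipschitz])
qed

lemma closed_excess_le: "closed {f. excess R f \<le> c}"
  by (intro closed_Collect_le continuous_on_excess continuous_on_const)

lemma convex_excess_le: "convex {f. excess R f \<le> c}"
proof (rule convexI, clarsimp)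
  fix f g :: "'a L1" and u v :: real
  assume *: "excess R f \<le> c" "excess R g \<le> c" "0 \<le> u" "0 \<le> v" "u + v = 1"
  have "excess R (u *\<^sub>R f + v *\<^sub>R g) = excess (\<bar>u\<bar> * R + \<bar>v\<bar> * R) (u *\<^sub>R f + v *\<^sub>R g)"
    using * by (simp add: distrib_right[symmetric])
  also have "\<dots> \<le> u * excess R f + v * excess R g"
    using excess_add[of "\<bar>u\<bar> * R" "\<bar>v\<bar> * R" "u *\<^sub>R f" "v *\<^sub>R g"] *(3,4)
    unfolding excess_scaleR by simp
  also have "\<dots> \<le> c" using * by (intro convex_bound_le)
  finally show "excess R (u *\<^sub>R f + v *\<^sub>R g) \<le> c" .
qed

text \<open>The interval has measure 1, so the part below height \<open>R\<close> has norm at most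
  \<open>R\<close>. Hence uniform integrability in the form of \<open>equi_int\<close> includes
  boundedness.\<close>

lemma norm_le_excess: "norm f \<le> R + excess R f"
proof -
  have "norm f \<le> (\<integral>x. R + max (norm (rep_L1 f x) - R) 0 \<partial>I01)"
    unfolding norm_L1_eq by (rule integral_mono) auto
  then show ?thesis by (simp add: excess_def)
qed

lemma excess_tendsto_0: "(\<lambda>n. excess (real n) f) \<longlonglongrightarrow> 0"
proof -
  have "(\<lambda>n. \<integral>x. max (norm (rep_L1 f x) - real n) 0 \<partial>I01) \<longlonglongrightarrow> (\<integral>x. 0 \<partial>I01)"
  proof (rule integral_dominated_convergence[where w = "\<lambda>x. norm (rep_L1 f x)"])
    show "AE x in I01. (\<lambda>n. max (norm (rep_L1 f x) - real n) 0) \<longlonglongrightarrow> 0"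
    proof (rule AE_I2)
      fix x
      obtain N where N: "norm (rep_L1 f x) \<le> real N" using real_arch_simple by blast
      show "(\<lambda>n. max (norm (rep_L1 f x) - real n) 0) \<longlonglongrightarrow> 0"
        by (rule tendsto_eventually) 
          (use N in \<open>auto simp: eventually_sequentially intro!: exI[of _ N]\<close>)
    qed
  qed auto
  then show ?thesis by (simp add: excess_def)
qed

lemma equi_int_subset: "equi_int W \<Longrightarrow> V \<subseteq> W \<Longrightarrow> equi_int V"
  unfolding equi_int_def by (meson subsetD)

lemma equi_int_closure_hull:
  assumes "equi_int W" shows "equi_int (closure (convex hull W))"
  unfolding equi_int_def
proof (intro allI impI)
  fix \<eta> :: real assume "\<eta> > 0"
  then obtain R where "R \<ge> 0" and R: "\<forall>f\<in>W. excess R f \<le> \<eta>"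
    using assms by (auto simp: equi_int_def)
  then have "convex hull W \<subseteq> {f. excess R f \<le> \<eta>}"
    by (intro hull_minimal convex_excess_le) auto
  then have "closure (convex hull W) \<subseteq> {f. excess R f \<le> \<eta>}"
    by (intro closure_minimal closed_excess_le)
  then show "\<exists>R\<ge>0. \<forall>f\<in>closure (convex hull W). excess R f \<le> \<eta>"
    using \<open>R \<ge> 0\<close> by auto
qed

lemma equi_int_bounded: 
  assumes "equi_int W" shows "bounded W"
proof -
  obtain R where "\<forall>f\<in>W. excess R f \<le> 1" using assms by (auto simp: equi_int_def dest: spec[of _ 1])
  then have "norm f \<le> R + 1" if "f \<in> W" for f using norm_le_excess[of f R] that by force
  then show ?thesis by (auto simp: bounded_iff)
qed

lemma equi_int_scaleR:
  assumes "equi_int W" shows "equi_int ((*\<^sub>R) c ` W)"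
proof (cases "c = 0")
  case True
  then show ?thesis by (auto simp: equi_int_def intro!: exI[of _ 0])
next
  case False
  show ?thesis
    unfolding equi_int_def
  proof (intro allI impI)
    fix \<eta> :: real assume "\<eta> > 0"
    then have "\<eta> / \<bar>c\<bar> > 0" using False by simp
    then obtain R where "R \<ge> 0" and R: "\<forall>f\<in>W. excess R f \<le> \<eta> / \<bar>c\<bar>"
      using assms by (auto simp: equi_int_def)
    then show "\<exists>R\<ge>0. \<forall>f\<in>(*\<^sub>R) c ` W. excess R f \<le> \<eta>"
      using False by (intro exI[of _ "\<bar>c\<bar> * R"]) (auto simp: excess_scaleR pos_le_divide_eq mult.commute[of _ "\<bar>c\<bar>"])
  qed
qed

section \<open>A strictly convex functional in place of weak compactness\<close>

lemma sqrt_gap: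
  fixes a b :: "'a::real_inner"
  assumes "norm a \<le> R" "norm b \<le> R"
  shows "(norm (a - b))\<^sup>2 \<le> 4 * (1 + R)^3 *
    (sqrt (1 + (norm a)\<^sup>2) + sqrt (1 + (norm b)\<^sup>2) - 2 * sqrt (1 + (norm ((1/2) *\<^sub>R (a + b)))\<^sup>2))"
proof -
  \<comment> \<open>\<open>p\<close>, \<open>q\<close> and \<open>s\<close> are the lengths of the
    vectors \<open>(1, a)\<close>, \<open>(1, b)\<close> and of their sum, and \<open>k\<close> is
    the inner product of the two. So \<open>p + q - s\<close> is the deficit in a triangle
    inequality.\<close>
  define p q s k where "p = sqrt (1 + (norm a)\<^sup>2)" and "q = sqrt (1 + (norm b)\<^sup>2)"
    and "s = 2 * sqrt (1 + (norm ((1/2) *\<^sub>R (a + b)))\<^sup>2)" and "k = 1 + a \<bullet> b"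
  have R0: "R \<ge> 0" using assms norm_ge_zero order_trans by blast
  have pq0: "p \<ge> 0" "q \<ge> 0" "s \<ge> 0" by (auto simp: p_def q_def s_def)
  have p2: "p\<^sup>2 = 1 + a \<bullet> a" and q2: "q\<^sup>2 = 1 + b \<bullet> b" 
    by (simp_all add: p_def q_def power2_norm_eq_inner)
  have s2: "s\<^sup>2 = 4 + a \<bullet> a + 2 * (a \<bullet> b) + b \<bullet> b"
  proof -
    have "s\<^sup>2 = 4 * (1 + (norm ((1/2) *\<^sub>R (a + b)))\<^sup>2)"
      by (simp add: s_def power_mult_distrib)
    then show ?thesis
      by (simp add: power2_norm_eq_inner inner_simps inner_commute field_simps)
  qed
  have le: "sqrt (1 + (norm c)\<^sup>2) \<le> 1 + norm c" for c :: 'a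
    by (rule real_le_lsqrt) (auto simp: power2_eq_square algebra_simps)
  have pR: "p \<le> 1 + R" and qR: "q \<le> 1 + R"
    using le[of a] le[of b] assms by (auto simp: p_def q_def)
  have cs: "(a \<bullet> b)\<^sup>2 \<le> (a \<bullet> a) * (b \<bullet> b)" by (rule Cauchy_Schwarz_ineq)
  have ab: "(norm (a - b))\<^sup>2 = a \<bullet> a - 2 * (a \<bullet> b) + b \<bullet> b"
    by (simp add: power2_norm_eq_inner inner_simps inner_commute)
  \<comment> \<open>The Gram determinant of \<open>(1, a)\<close> and \<open>(1, b)\<close>; it
    exceeds \<open>(norm (a - b))\<^sup>2\<close> by the Gram determinant of \<open>a\<close> and
    \<open>b\<close>.\<close>
  have "(p * q)\<^sup>2 - k\<^sup>2 = (1 + a \<bullet> a) * (1 + b \<bullet> b) - (1 + a \<bullet> b)\<^sup>2"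
    by (simp add: power_mult_distrib p2 q2 k_def)
  also have "\<dots> = (norm (a - b))\<^sup>2 + ((a \<bullet> a) * (b \<bullet> b) - (a \<bullet> b)\<^sup>2)"
    unfolding ab by (simp add: power2_eq_square algebra_simps)
  finally have 1: "(p * q)\<^sup>2 - k\<^sup>2 \<ge> (norm (a - b))\<^sup>2" using cs by simp
  have kpq: "\<bar>k\<bar> \<le> p * q"
  proof -
    have "k\<^sup>2 \<le> (p * q)\<^sup>2" using 1 zero_le_power2[of "norm (a - b)"] by linarith
    then show ?thesis using abs_le_square_iff[of k "p * q"] pq0 by simp
  qed
  have pqR: "p * q \<le> (1 + R)\<^sup>2"
    unfolding power2_eq_square using pR qR pq0 R0 by (intro mult_mono) auto
  \<comment> \<open>A second difference of squares. Its factor \<open>p + q + s\<close> is at most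
    \<open>4 * (1 + R)\<close>, and \<open>p * q + k\<close> is at most
    \<open>2 * (1 + R)\<^sup>2\<close>; together they give the constant
    \<open>4 * (1 + R)^3\<close>.\<close>
  have eq: "(p + q - s) * (p + q + s) = 2 * (p * q - k)"
    using p2 q2 s2 by (simp add: k_def power2_eq_square algebra_simps)
  have spq: "s \<le> p + q"
  proof (rule ccontr)
    assume "\<not> s \<le> p + q"
    then have "(p + q - s) * (p + q + s) < 0" using pq0 by (intro mult_neg_pos) auto
    with eq kpq show False by simp
  qed
  have "p * q - k \<le> 2 * (1 + R) * (p + q - s)"
  proof -
    have "2 * (p * q - k) \<le> (p + q - s) * (4 * (1 + R))"
      unfolding eq[symmetric] using spq pR qR by (intro mult_left_mono) auto
    then show ?thesis by (simp add: algebra_simps)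
  qed
  moreover have "(norm (a - b))\<^sup>2 \<le> 2 * (1 + R)\<^sup>2 * (p * q - k)"
  proof -
    have "(norm (a - b))\<^sup>2 \<le> (p * q + k) * (p * q - k)"
      using 1 by (simp add: power2_eq_square algebra_simps)
    also have "\<dots> \<le> (2 * (1 + R)\<^sup>2) * (p * q - k)"
      using pqR kpq by (intro mult_right_mono) auto
    finally show ?thesis .
  qed
  ultimately have "(norm (a - b))\<^sup>2 \<le> 2 * (1 + R)\<^sup>2 * (2 * (1 + R) * (p + q - s))"
    by (meson mult_left_mono order_trans zero_le_mult_iff zero_le_numeral zero_le_power2)
  then show ?thesis
    by (simp add: p_def q_def s_def power2_eq_square power3_eq_cube algebra_simps)
qed

definition strict_fn :: "'a::euclidean_space L1 \<Rightarrow> real" where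
  "strict_fn f = (\<integral>x. sqrt (1 + (norm (rep_L1 f x))\<^sup>2) \<partial>I01)"

lemma sqrt_one_plus_le: "sqrt (1 + t\<^sup>2) \<le> 1 + t" if "0 \<le> t" for t :: real
  by (rule real_le_lsqrt) (use that in \<open>auto simp: power2_eq_square algebra_simps\<close>)

lemma integrable_strict_fn [simp, intro]:
  "integrable I01 (\<lambda>x. sqrt (1 + (norm (rep_L1 (f::'a::euclidean_space L1) x))\<^sup>2))"
  by (rule Bochner_Integration.integrable_bound[where f = "\<lambda>x. 1 + norm (rep_L1 f x)"])
    (auto intro!: sqrt_one_plus_le)

lemma strict_fn_nonneg: "0 \<le> strict_fn f"
  unfolding strict_fn_def by (rule Bochner_Integration.integral_nonneg) auto

lemma strict_fn_le: "strict_fn f \<le> 1 + norm f"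
proof -
  have "strict_fn f \<le> (\<integral>x. 1 + norm (rep_L1 f x) \<partial>I01)"
    unfolding strict_fn_def by (rule integral_mono) (auto intro!: sqrt_one_plus_le)
  then show ?thesis by (simp add: norm_L1_eq)
qed

text \<open>Where both functions stay below \<open>2 * R\<close>, \<open>sqrt_gap\<close> bounds the
  square of the distance, and \<open>x \<le> t + x\<^sup>2 / (4 * t)\<close> makes the bound linear.
  Elsewhere the distance is at most four times the two tails above \<open>R\<close>. After
  integration \<open>t\<close>, the gap and the two tails use a quarter of \<open>e\<close>
  each.\<close>

lemma strict_fn_uniformly_convex:
  fixes W :: "'a::euclidean_space L1 set"
  assumes W: "equi_int W" and e: "e > 0"
  shows "\<exists>\<eta>>0. \<forall>f\<in>W. \<forall>g\<in>W.
    strict_fn f + strict_fn g - 2 * strict_fn ((1/2) *\<^sub>R (f + g)) \<le> \<eta> \<longrightarrow> norm (f - g) \<le> e"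
proof -
  obtain R where R: "R \<ge> 0" "\<And>f. f \<in> W \<Longrightarrow> excess R f \<le> e / 16"
    using W e unfolding equi_int_def by (meson divide_pos_pos zero_less_numeral)
  define t where "t = e / 4"
  define C where "C = (1 + 2 * R)^3"
  have t: "t > 0" and C: "C > 0" using e R by (auto simp: t_def C_def)
  have pw: "norm (a - b) \<le> t + C / t * (sqrt (1 + (norm a)\<^sup>2) + sqrt (1 + (norm b)\<^sup>2)
      - 2 * sqrt (1 + (norm ((1/2) *\<^sub>R (a + b)))\<^sup>2)) + 4 * max (norm a - R) 0 + 4 * max (norm b - R) 0"
    (is "_ \<le> t + C / t * ?D a b + _ + _") for a b :: 'a
  proof (cases "norm a \<le> 2 * R \<and> norm b \<le> 2 * R")
    case True
    let ?x = "norm (a - b)"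
    have "?x \<le> t + ?x\<^sup>2 / (4 * t)"
    proof -
      have "0 \<le> (?x - 2 * t)\<^sup>2" by simp
      then have "4 * t * ?x \<le> 4 * t * t + ?x\<^sup>2" by (simp add: power2_eq_square algebra_simps)
      then show ?thesis using t by (simp add: field_simps)
    qed
    also have "?x\<^sup>2 / (4 * t) \<le> 4 * C * ?D a b / (4 * t)"
      using sqrt_gap[of a "2 * R" b] True t by (intro divide_right_mono) (auto simp: C_def)
    also have "4 * C * ?D a b / (4 * t) = C / t * ?D a b" by simp
    finally have "?x \<le> t + C / t * ?D a b" by simp
    moreover have "0 \<le> 4 * max (norm a - R) 0" "0 \<le> 4 * max (norm b - R) 0" by simp_all
    ultimately show ?thesis by linarith
  next
    case False
    have D: "?D a b \<ge> 0"
    proof -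
      define r where "r = max (norm a) (norm b)"
      have r: "norm a \<le> r" "norm b \<le> r" "r \<ge> 0" by (auto simp: r_def le_max_iff_disj)
      have "0 \<le> 4 * (1 + r)^3 * ?D a b"
        using sqrt_gap[OF r(1,2)] zero_le_power2 order_trans by blast
      moreover have "4 * (1 + r)^3 > 0" using r by simp
      ultimately show ?thesis by (simp add: zero_le_mult_iff)
    qed
    have "norm (a - b) \<le> norm a + norm b" by (rule norm_triangle_ineq4)
    also have "\<dots> \<le> 4 * max (norm a - R) 0 + 4 * max (norm b - R) 0"
      using False R(1) by (auto simp: max_def)
    finally show ?thesis using D t C
      by (smt (verit) divide_nonneg_nonneg mult_nonneg_nonneg)
  qed
  have main: "norm (f - g) \<le> t + C / t * (strict_fn f + strict_fn g - 2 * strict_fn ((1/2) *\<^sub>R (f + g)))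
      + 4 * excess R f + 4 * excess R g" for f g :: "'a L1"
  proof -
    let ?h = "(1/2) *\<^sub>R (f + g)"
    have "norm (f - g) \<le> (\<integral>x. t + C / t * (sqrt (1 + (norm (rep_L1 f x))\<^sup>2) + sqrt (1 + (norm (rep_L1 g x))\<^sup>2)
      - 2 * sqrt (1 + (norm (rep_L1 ?h x))\<^sup>2)) + 4 * max (norm (rep_L1 f x) - R) 0 + 4 * max (norm (rep_L1 g x) - R) 0 \<partial>I01)"
      unfolding norm_L1_eq
    proof (rule integral_mono_AE)
      show "AE x in I01. norm (rep_L1 (f - g) x) \<le> t + C / t * (sqrt (1 + (norm (rep_L1 f x))\<^sup>2) + sqrt (1 + (norm (rep_L1 g x))\<^sup>2)
        - 2 * sqrt (1 + (norm (rep_L1 ?h x))\<^sup>2)) + 4 * max (norm (rep_L1 f x) - R) 0 + 4 * max (norm (rep_L1 g x) - R) 0"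
        using AE_rep_diff[of f g] AE_rep_add[of f g] AE_rep_scaleR[of "1/2" "f + g"]
        by eventually_elim (use pw in simp)
    qed (intro Bochner_Integration.integrable_add Bochner_Integration.integrable_diff
        integrable_mult_right integrable_norm; simp)+
    then show ?thesis
      by (simp add: strict_fn_def excess_def)
  qed
  show ?thesis
  proof (intro exI[of _ "t * e / (4 * C)"] conjI ballI impI)
    show "0 < t * e / (4 * C)" using t e C by simp
    fix f g assume fg: "f \<in> W" "g \<in> W"
      and d: "strict_fn f + strict_fn g - 2 * strict_fn ((1/2) *\<^sub>R (f + g)) \<le> t * e / (4 * C)"
    have "C / t * (strict_fn f + strict_fn g - 2 * strict_fn ((1/2) *\<^sub>R (f + g))) \<le> C / t * (t * e / (4 * C))"
      using d t C by (intro mult_left_mono) auto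
    also have "\<dots> = e / 4" using t C by simp
    finally show "norm (f - g) \<le> e"
      using main[of f g] R(2)[OF fg(1)] R(2)[OF fg(2)] by (simp add: t_def)
  qed
qed

text \<open>Stands in for weak compactness. Let \<open>s\<close> be the supremum over the family of
  the infima of \<open>strict_fn\<close>. If the infimum over \<open>D\<close> is nearly
  \<open>s\<close>, two points of \<open>D\<close> with values near \<open>s\<close> have their
  midpoint in \<open>D\<close>, where the value cannot drop much below \<open>s\<close>; uniform
  convexity brings the points together. So the near-minimisers form a Cauchy filter, and closedness
  puts its limit into every member.\<close>

proposition equi_int_directed_Inter:
  fixes \<C> :: "'a::euclidean_space L1 set set"
  assumes W: "equi_int W" and sub: "\<And>C. C \<in> \<C> \<Longrightarrow> C \<subseteq> W" and ne: "\<C> \<noteq> {}"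
    and C: "\<And>C. C \<in> \<C> \<Longrightarrow> convex C \<and> closed C \<and> C \<noteq> {}"
    and dir: "\<And>C D. C \<in> \<C> \<Longrightarrow> D \<in> \<C> \<Longrightarrow> \<exists>E\<in>\<C>. E \<subseteq> C \<inter> D"
  shows "\<Inter>\<C> \<noteq> {}"
proof -
  obtain B where B: "\<And>f. f \<in> W \<Longrightarrow> norm f \<le> B"
    using equi_int_bounded[OF W] by (auto simp: bounded_iff)
  define m where "m C = (INF f\<in>C. strict_fn f)" for C :: "'a L1 set"
  define s where "s = (SUP C\<in>\<C>. m C)"
  have bdd: "bdd_below (strict_fn ` C)" for C :: "'a L1 set"
    using strict_fn_nonneg by (auto intro!: bdd_belowI[of _ 0])
  have m_le: "m C \<le> strict_fn f" if "f \<in> C" for f C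
    unfolding m_def using bdd that by (rule cINF_lower)
  have "m C \<le> 1 + B" if C': "C \<in> \<C>" for C
  proof -
    obtain f where "f \<in> C" using C[OF C'] by auto
    then show ?thesis using m_le[of f C] strict_fn_le[of f] B[of f] sub[OF C'] by force
  qed
  then have bdd2: "bdd_above (m ` \<C>)" by (auto intro!: bdd_aboveI)
  have m_s: "m C \<le> s" if "C \<in> \<C>" for C
    unfolding s_def using bdd2 that by (intro cSUP_upper)
  define A :: "'a L1 set \<times> real \<Rightarrow> 'a L1 set" where "A = (\<lambda>(C, \<eta>). {f\<in>C. strict_fn f \<le> s + \<eta>})"
  define F where "F = (INF p\<in>\<C> \<times> {0<..}. principal (A p))"
  have ev: "eventually P F \<longleftrightarrow> (\<exists>p\<in>\<C> \<times> {0<..}. eventually P (principal (A p)))" for P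
    unfolding F_def
  proof (rule eventually_INF_base)
    show "\<C> \<times> {0<..} \<noteq> ({} :: ('a L1 set \<times> real) set)" using ne by (auto intro: exI[of _ 1])
    fix p q :: "'a L1 set \<times> real" assume "p \<in> \<C> \<times> {0<..}" "q \<in> \<C> \<times> {0<..}"
    then obtain C D a b where pq: "p = (C, a)" "q = (D, b)" "C \<in> \<C>" "D \<in> \<C>" "a > 0" "b > 0" by auto
    then obtain E where E: "E \<in> \<C>" "E \<subseteq> C \<inter> D" using dir by blast
    show "\<exists>r\<in>\<C> \<times> {0<..}. principal (A r) \<le> inf (principal (A p)) (principal (A q))"
      by (rule bexI[of _ "(E, min a b)"]) (use pq E in \<open>auto simp: A_def\<close>)
  qed
  have Ane: "A (C, \<eta>) \<noteq> {}" if C': "C \<in> \<C>" and "\<eta> > 0" for C \<eta>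
  proof -
    have "m C < s + \<eta>" using m_s[OF C'] \<open>\<eta> > 0\<close> by simp
    then obtain f where "f \<in> C" "strict_fn f < s + \<eta>"
      unfolding m_def using cINF_less_iff[OF _ bdd[of C]] C[OF C'] by auto
    then show ?thesis by (force simp: A_def)
  qed
  have Fbot: "F \<noteq> bot"
    unfolding trivial_limit_def ev using Ane by (auto simp: eventually_principal)
  have "cauchy_filter F"
    unfolding cauchy_filter_metric
  proof (intro allI impI)
    fix e :: real assume e: "e > 0"
    then obtain \<eta> where \<eta>: "\<eta> > 0" and *: "\<And>f g. f \<in> W \<Longrightarrow> g \<in> W \<Longrightarrow>
      strict_fn f + strict_fn g - 2 * strict_fn ((1/2) *\<^sub>R (f + g)) \<le> \<eta> \<Longrightarrow> norm (f - g) \<le> e/2"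
      using strict_fn_uniformly_convex[OF W, of "e/2"] by (auto simp: half_gt_zero)
    have "s - \<eta>/4 < s" using \<eta> by simp
    then obtain D where D: "D \<in> \<C>" "s - \<eta>/4 < m D"
      unfolding s_def using less_cSUP_iff[OF ne bdd2] by auto
    show "\<exists>P. eventually P F \<and> (\<forall>x y. P x \<and> P y \<longrightarrow> dist x y < e)"
    \<comment> \<open>The values at \<open>f\<close> and \<open>g\<close> are at most \<eta>/4 above
      \<open>s\<close>, and the value at the midpoint, counted twice, is at most \<eta>/4 below it;
      the gap is therefore at most \<eta>.\<close>
    proof (intro exI[of _ "\<lambda>f. f \<in> A (D, \<eta>/4)"] conjI allI impI)
      show "\<forall>\<^sub>F x in F. x \<in> A (D, \<eta>/4)"
        unfolding ev using D \<eta> by (intro bexI[of _ "(D, \<eta>/4)"]) (auto simp: eventually_principal)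
      fix f g assume "f \<in> A (D, \<eta>/4) \<and> g \<in> A (D, \<eta>/4)"
      then have fg: "f \<in> D" "g \<in> D" "strict_fn f \<le> s + \<eta>/4" "strict_fn g \<le> s + \<eta>/4"
        by (auto simp: A_def)
      have "(1/2) *\<^sub>R f + (1/2) *\<^sub>R g \<in> D"
        using C[OF D(1)] fg by (intro convexD) auto
      then have "(1/2) *\<^sub>R (f + g) \<in> D" by (simp add: scaleR_add_right)
      from m_le[OF this] D(2) fg have "norm (f - g) \<le> e/2"
        using sub[OF D(1)] by (intro *) auto
      then show "dist f g < e" using e by (simp add: dist_norm)
    qed
  qed
  then obtain x where x: "F \<le> nhds x"
    using complete_uniform[of "UNIV :: 'a L1 set"] complete_UNIV Fbot by auto
  have "x \<in> C" if "C \<in> \<C>" for C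
  proof (rule Lim_in_closed_set[of C "\<lambda>f. f" F])
    show "closed C" using C that by simp
    show "\<forall>\<^sub>F f in F. f \<in> C"
      unfolding ev using that by (intro bexI[of _ "(C, 1)"]) (auto simp: eventually_principal A_def)
    show "((\<lambda>f. f) \<longlongrightarrow> x) F" using x by (simp add: filterlim_def)
  qed (fact Fbot)
  then show ?thesis by auto
qed

section \<open>Almost disjoint sequences\<close>

definition restr :: "real set \<Rightarrow> 'a::{banach, second_countable_topology} L1 \<Rightarrow> 'a L1" where
  "restr A f = abs_L1 (\<lambda>x. indicator A x *\<^sub>R rep_L1 f x)"

lemma L1_eqI:
  assumes "AE x in I01. rep_L1 f x = rep_L1 g x" shows "f = g"
proof -
  have "norm (f - g) = (\<integral>x. 0 \<partial>I01)"
    unfolding norm_L1_eq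
  proof (rule integral_cong_AE)
    show "AE x in I01. norm (rep_L1 (f - g) x) = 0"
      using assms AE_rep_diff[of f g] by eventually_elim simp
  qed auto
  then show ?thesis by simp
qed

context
  fixes A :: "real set"
  assumes A: "A \<in> sets I01"
begin

lemma AE_rep_restr: "AE x in I01. rep_L1 (restr A f) x = indicator A x *\<^sub>R rep_L1 f x"
  unfolding restr_def using A by (intro AE_rep_abs_L1 integrable_mult_indicator) auto

lemma norm_restr: "norm (restr A f) = (\<integral>x. indicator A x * norm (rep_L1 f x) \<partial>I01)"
  unfolding restr_def using A by (subst norm_abs_L1) (auto intro!: integrable_mult_indicator)

lemma integrable_restr: "integrable I01 (\<lambda>x. indicator A x * norm (rep_L1 f x))"
  using integrable_mult_indicator[OF A, of "\<lambda>x. norm (rep_L1 f x)"] by simp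

lemma restr_add: "restr A (f + g) = restr A f + restr A g"
  by (rule L1_eqI)
    (use AE_rep_restr[of "f + g"] AE_rep_restr[of f] AE_rep_restr[of g] AE_rep_add[of f g]
      AE_rep_add[of "restr A f" "restr A g"] in \<open>eventually_elim, simp add: scaleR_add_right\<close>)

lemma restr_scaleR: "restr A (c *\<^sub>R f) = c *\<^sub>R restr A f"
  by (rule L1_eqI)
    (use AE_rep_restr[of "c *\<^sub>R f"] AE_rep_restr[of f] AE_rep_scaleR[of c f]
      AE_rep_scaleR[of c "restr A f"] in \<open>eventually_elim, simp\<close>)

lemma linear_restr: "linear (restr A :: 'a::{banach, second_countable_topology} L1 \<Rightarrow> _)"
  by (intro linearI restr_add restr_scaleR)

text \<open>Restriction is an L-projection: the norm is additive over a set and its complement. The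
  lower estimates for almost disjoint sums rest on this.\<close>

lemma norm_restr_split: "norm f = norm (restr A f) + norm (f - restr A f)"
proof -
  have "norm (f - restr A f) = (\<integral>x. norm (rep_L1 f x) - indicator A x * norm (rep_L1 f x) \<partial>I01)"
    unfolding norm_L1_eq
  proof (rule integral_cong_AE)
    show "AE x in I01. norm (rep_L1 (f - restr A f) x) = norm (rep_L1 f x) - indicator A x * norm (rep_L1 f x)"
      using AE_rep_restr[of f] AE_rep_diff[of f "restr A f"]
      by eventually_elim (auto simp: indicator_def)
  qed (use integrable_restr[of f] A in auto)
  also have "\<dots> = norm f - norm (restr A f)"
    unfolding norm_restr norm_L1_eq[of f] using integrable_restr
    by (intro Bochner_Integration.integral_diff) auto
  finally show ?thesis by simp
qed

lemma norm_restr_le: "norm (restr A f) \<le> norm f"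
  using norm_restr_split[of f] norm_ge_zero[of "f - restr A f"] by linarith

lemma norm_off_restr_le: "norm (f - restr A f) \<le> norm f"
  using norm_restr_split[of f] norm_ge_zero[of "restr A f"] by linarith

text \<open>On \<open>A\<close> the modulus is at most \<open>R\<close> plus its excess over
  \<open>R\<close>. This is absolute continuity of the integral with an explicit modulus.\<close>

lemma norm_restr_le_excess:
  assumes "R \<ge> 0" shows "norm (restr A f) \<le> R * measure I01 A + excess R f"
proof -
  have intR: "integrable I01 (\<lambda>x. R * indicator A x)"
    using A by (intro integrable_mult_right integrable_real_indicator) (auto simp: I01.emeasure_eq_measure)
  have "norm (restr A f) \<le> (\<integral>x. R * indicator A x + max (norm (rep_L1 f x) - R) 0 \<partial>I01)"
    unfolding norm_restr
  proof (rule Bochner_Integration.integral_mono)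
    show "integrable I01 (\<lambda>x. R * indicator A x + max (norm (rep_L1 f x) - R) 0)"
      using intR by (rule Bochner_Integration.integrable_add) simp
  qed (use integrable_restr assms in \<open>auto simp: indicator_def\<close>)
  also have "\<dots> = R * measure I01 A + excess R f"
  proof -
    have "A \<inter> {0..1} = A" using sets.sets_into_space[OF A] by auto
    then show ?thesis
      unfolding excess_def using intR A by (subst Bochner_Integration.integral_add) auto
  qed
  finally show ?thesis .
qed

lemma norm_add_disjoint_support:
  assumes "restr A f = f" "restr A g = 0" shows "norm (f + g) = norm f + norm g"
  using norm_restr_split[of "f + g"] assms by (simp add: restr_add)

end

lemma restr_restr:
  assumes "A \<in> sets I01" "B \<in> sets I01" shows "restr A (restr B f) = restr (A \<inter> B) f"
  by (rule L1_eqI)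
    (use AE_rep_restr[OF assms(1), of "restr B f"] AE_rep_restr[OF assms(2), of f]
      AE_rep_restr[OF sets.Int[OF assms], of f] in \<open>eventually_elim, auto simp: indicator_def\<close>)

lemma restr_empty [simp]: "restr {} f = 0"
proof (rule L1_eqI)
  show "AE x in I01. rep_L1 (restr {} f) x = rep_L1 0 x"
    using AE_rep_restr[OF sets.empty_sets, of f] AE_rep_zero by eventually_elim simp
qed

lemma restr_Diff:
  assumes "A \<in> sets I01" "B \<in> sets I01" "B \<subseteq> A" shows "restr A f - restr B f = restr (A - B) f"
proof (rule L1_eqI)
  show "AE x in I01. rep_L1 (restr A f - restr B f) x = rep_L1 (restr (A - B) f) x"
    using AE_rep_restr[OF assms(1), of f] AE_rep_restr[OF assms(2), of f]
      AE_rep_restr[OF sets.Diff[OF assms(1,2)], of f] AE_rep_diff[of "restr A f" "restr B f"]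
    by eventually_elim (use assms(3) in \<open>auto simp: indicator_def\<close>)
qed

lemma norm_restr_mono:
  assumes "A \<in> sets I01" "B \<in> sets I01" "B \<subseteq> A" shows "norm (restr B f) \<le> norm (restr A f)"
  using norm_restr_le[OF assms(2), of "restr A f"] restr_restr[OF assms(2,1), of f] assms(3)
  by (simp add: inf.absorb1)

text \<open>\<open>norm (restr B f)\<close> is the mass of \<open>B\<close> under the measure whose
  density is the modulus of \<open>f\<close>, so countable subadditivity applies.\<close>

lemma norm_restr_Union_le:
  fixes A :: "nat \<Rightarrow> real set"
  assumes A: "\<And>n. A n \<in> sets I01" and le: "\<And>n. norm (restr (A n) f) \<le> b n" and b: "summable b"
  shows "norm (restr (\<Union>n. A n) f) \<le> suminf b"
proof -
  define D where "D = density I01 (\<lambda>x. ennreal (norm (rep_L1 f x)))"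
  have em: "emeasure D B = ennreal (norm (restr B f))" if "B \<in> sets I01" for B
  proof -
    have "emeasure D B = (\<integral>\<^sup>+x. ennreal (norm (rep_L1 f x)) * indicator B x \<partial>I01)"
      unfolding D_def using that by (intro emeasure_density) auto
    also have "\<dots> = (\<integral>\<^sup>+x. ennreal (indicator B x * norm (rep_L1 f x)) \<partial>I01)"
      by (intro nn_integral_cong) (auto simp: indicator_def)
    also have "\<dots> = ennreal (norm (restr B f))"
      unfolding norm_restr[OF that] using integrable_restr[OF that] 
      by (intro nn_integral_eq_integral) auto
    finally show ?thesis .
  qed
  have b0: "0 \<le> b n" for n using le[of n] norm_ge_zero order_trans by blast
  have "ennreal (norm (restr (\<Union>n. A n) f)) = emeasure D (\<Union>n. A n)"
    using A by (intro em[symmetric]) auto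
  also have "\<dots> \<le> (\<Sum>n. emeasure D (A n))"
    using A by (intro emeasure_subadditive_countably) (auto simp: D_def)
  also have "\<dots> \<le> (\<Sum>n. ennreal (b n))"
    using A le b0 by (intro suminf_le) (auto simp: em ennreal_leI)
  also have "\<dots> = ennreal (suminf b)"
    using b b0 by (intro suminf_ennreal2) auto
  finally show ?thesis using b b0 by (simp add: suminf_nonneg)
qed

lemma norm_restr_tendsto_0:
  assumes A: "\<And>n. A n \<in> sets I01" and lim: "(\<lambda>n. measure I01 (A n)) \<longlonglongrightarrow> 0"
  shows "(\<lambda>n. norm (restr (A n) f)) \<longlonglongrightarrow> 0"
proof (rule tendsto_0_le[where K = 1, OF _ always_eventually])
  show "(\<lambda>n. norm (restr (A n) f)) \<longlonglongrightarrow> 0"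
  proof (rule LIMSEQ_I)
    fix e :: real assume e: "e > 0"
    then have "eventually (\<lambda>n. excess (real n) f < e/2) sequentially"
      by (intro order_tendstoD(2)[OF excess_tendsto_0]) auto
    then obtain r where r: "excess (real r) f < e/2" by (auto simp: eventually_sequentially)
    have "(\<lambda>n. real r * measure I01 (A n)) \<longlonglongrightarrow> real r * 0"
      by (intro tendsto_intros lim)
    then have "eventually (\<lambda>n. real r * measure I01 (A n) < e/2) sequentially"
      using e by (intro order_tendstoD(2)) auto
    then obtain N where N: "\<And>n. n \<ge> N \<Longrightarrow> real r * measure I01 (A n) < e/2"
      by (auto simp: eventually_sequentially)
    show "\<exists>N. \<forall>n\<ge>N. norm (norm (restr (A n) f) - 0) < e"
    proof (intro exI[of _ N] allI impI)
      fix n assume "n \<ge> N"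
      then show "norm (norm (restr (A n) f) - 0) < e"
        using N[of n] r norm_restr_le_excess[OF A[of n], of "real r" f] by simp
    qed
  qed
qed simp

lemma norm_sum_disjoint_restr:
  assumes "finite J" "\<And>j. j \<in> J \<Longrightarrow> B j \<in> sets I01" "disjoint_family_on B J"
  shows "norm (\<Sum>j\<in>J. t j *\<^sub>R restr (B j) (g j)) = (\<Sum>j\<in>J. \<bar>t j\<bar> * norm (restr (B j) (g j)))"
  using assms
proof (induction J)
  case (insert i J)
  have Bi: "B i \<in> sets I01" using insert.prems by simp
  have "restr (B i) (restr (B j) (g j)) = 0" if "j \<in> J" for j
  proof -
    have "B i \<inter> B j = {}" using insert.prems(2) insert.hyps that by (auto simp: disjoint_family_on_def)
    then show ?thesis using insert.prems(1)[of j] that Bi by (simp add: restr_restr)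
  qed
  then have "restr (B i) (\<Sum>j\<in>J. t j *\<^sub>R restr (B j) (g j)) = 0"
    using Bi by (simp add: linear_sum[OF linear_restr] restr_scaleR)
  moreover have "restr (B i) (t i *\<^sub>R restr (B i) (g i)) = t i *\<^sub>R restr (B i) (g i)"
    using Bi by (simp add: restr_scaleR restr_restr)
  ultimately have "norm (t i *\<^sub>R restr (B i) (g i) + (\<Sum>j\<in>J. t j *\<^sub>R restr (B j) (g j)))
      = norm (t i *\<^sub>R restr (B i) (g i)) + norm (\<Sum>j\<in>J. t j *\<^sub>R restr (B j) (g j))"
    by (intro norm_add_disjoint_support[OF Bi])
  also have "norm (\<Sum>j\<in>J. t j *\<^sub>R restr (B j) (g j)) = (\<Sum>j\<in>J. \<bar>t j\<bar> * norm (restr (B j) (g j)))"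
    using insert.prems by (intro insert.IH) (auto simp: disjoint_family_on_def)
  finally show ?case using insert.hyps by simp
qed simp

text \<open>On disjoint sets the norms add. The error \<open>norm (g j - restr (B j) (g j))\<close>
  is subtracted twice, once in passing from \<open>g j\<close> to its restriction and once for the
  discarded remainder.\<close>

lemma norm_sum_almost_disjoint_ge:
  assumes J: "finite J" "\<And>j. j \<in> J \<Longrightarrow> B j \<in> sets I01" "disjoint_family_on B J"
  shows "norm (\<Sum>j\<in>J. t j *\<^sub>R g j) \<ge> (\<Sum>j\<in>J. \<bar>t j\<bar> * (norm (g j) - 2 * norm (g j - restr (B j) (g j))))"
proof -
  let ?th = "\<lambda>j. norm (g j - restr (B j) (g j))"
  have "(\<Sum>j\<in>J. t j *\<^sub>R g j) = (\<Sum>j\<in>J. t j *\<^sub>R restr (B j) (g j)) + (\<Sum>j\<in>J. t j *\<^sub>R (g j - restr (B j) (g j)))"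
    by (simp add: scaleR_diff_right sum_subtractf)
  then have "norm (\<Sum>j\<in>J. t j *\<^sub>R g j) \<ge> norm (\<Sum>j\<in>J. t j *\<^sub>R restr (B j) (g j))
      - norm (\<Sum>j\<in>J. t j *\<^sub>R (g j - restr (B j) (g j)))"
    using norm_diff_ineq[of "\<Sum>j\<in>J. t j *\<^sub>R restr (B j) (g j)" "\<Sum>j\<in>J. t j *\<^sub>R (g j - restr (B j) (g j))"]
    by (simp only:)
  moreover have "norm (\<Sum>j\<in>J. t j *\<^sub>R (g j - restr (B j) (g j))) \<le> (\<Sum>j\<in>J. \<bar>t j\<bar> * ?th j)"
    by (rule sum_norm_le) simp
  moreover have "norm (\<Sum>j\<in>J. t j *\<^sub>R restr (B j) (g j)) = (\<Sum>j\<in>J. \<bar>t j\<bar> * (norm (g j) - ?th j))"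
  proof (subst norm_sum_disjoint_restr[OF J(1) _ J(3), of t g], fact J(2), rule sum.cong)
    fix j assume "j \<in> J"
    then have "norm (restr (B j) (g j)) = norm (g j) - ?th j"
      using norm_restr_split[OF J(2), of j "g j"] by simp
    then show "\<bar>t j\<bar> * norm (restr (B j) (g j)) = \<bar>t j\<bar> * (norm (g j) - ?th j)" by simp
  qed simp
  moreover have "(\<Sum>j\<in>J. \<bar>t j\<bar> * (norm (g j) - 2 * ?th j)) 
      = (\<Sum>j\<in>J. \<bar>t j\<bar> * (norm (g j) - ?th j)) - (\<Sum>j\<in>J. \<bar>t j\<bar> * ?th j)"
    by (simp add: sum_subtractf algebra_simps sum.distrib sum_distrib_left)
  ultimately show ?thesis by linarith
qed

section \<open>Almost disjoint subsequences\<close>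

lemma diagonal_subseq:
  fixes P :: "nat \<Rightarrow> nat \<Rightarrow> bool" and Q :: "nat \<Rightarrow> nat \<Rightarrow> nat \<Rightarrow> bool"
  assumes "\<And>n. eventually (P n) sequentially" "\<And>n l. eventually (Q n l) sequentially"
  shows "\<exists>s. strict_mono s \<and> (\<forall>n. P n (s n) \<and> (\<forall>i<n. Q n (s i) (s n)))"
proof -
  have "\<exists>s. \<forall>n. P n (s n) \<and> (\<forall>i<n. s i < s n \<and> Q n (s i) (s n))"
  proof (rule dependent_wellorder_choice)
    fix r :: nat and f g :: "nat \<Rightarrow> nat" and n :: nat assume "\<And>m. m < n \<Longrightarrow> f m = g m"
    then show "(P n r \<and> (\<forall>i<n. f i < r \<and> Q n (f i) r)) = (P n r \<and> (\<forall>i<n. g i < r \<and> Q n (g i) r))"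
      by auto
  next
    fix n :: nat and f :: "nat \<Rightarrow> nat"
    have "eventually (\<lambda>r. P n r \<and> (\<forall>i\<in>{..<n}. f i < r \<and> Q n (f i) r)) sequentially"
      using assms by (intro eventually_conj eventually_ball_finite ballI eventually_gt_at_top) auto
    then show "\<exists>r. P n r \<and> (\<forall>i<n. f i < r \<and> Q n (f i) r)"
      by (auto simp: eventually_sequentially)
  qed
  then show ?thesis by (auto simp: strict_mono_def)
qed

text \<open>Each set is chosen so late that it carries little mass of the functions chosen before
  it. Then all later sets are removed from each set, which costs \<open>g (s n)\<close> at most the
  sum of \<open>c * (1/2)^m\<close> over \<open>m > n\<close>, that is,
  \<open>c * (1/2)^n\<close>.\<close>

lemma almost_disjoint_subseq:
  fixes g :: "nat \<Rightarrow> 'a::{banach, second_countable_topology} L1"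
  assumes A: "\<And>n. A n \<in> sets I01" and lim: "(\<lambda>n. measure I01 (A n)) \<longlonglongrightarrow> 0" and c: "c > 0"
    and P: "\<And>n. eventually (P n) sequentially"
  obtains s B where "strict_mono s" "\<And>n. P n (s n)" "\<And>n. B n \<in> sets I01" "disjoint_family B"
    "\<And>n. norm (g (s n) - restr (B n) (g (s n))) \<le> norm (g (s n) - restr (A (s n)) (g (s n))) + c * (1/2)^n"
proof -
  have Q: "eventually (\<lambda>m. norm (restr (A m) (g l)) < c * (1/2)^n) sequentially" for n l
    using c by (intro order_tendstoD(2)[OF norm_restr_tendsto_0[OF A lim]]) auto
  obtain s where "strict_mono s \<and> (\<forall>n. P n (s n) \<and> (\<forall>i<n. norm (restr (A (s n)) (g (s i))) < c * (1/2)^n))"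
    using diagonal_subseq[of P "\<lambda>n l m. norm (restr (A m) (g l)) < c * (1/2)^n", OF P Q] ..
  then have s: "strict_mono s" "\<And>n. P n (s n)"
    and small: "\<And>n i. i < n \<Longrightarrow> norm (restr (A (s n)) (g (s i))) < c * (1/2)^n"
    by auto
  define L where "L n = (\<Union>k. A (s (Suc n + k)))" for n
  define B where "B n = A (s n) - L n" for n
  have L: "L n \<in> sets I01" for n using A by (auto simp: L_def)
  have B: "B n \<in> sets I01" for n using A L by (auto simp: B_def)
  have disj: "B i \<inter> B j = {}" if "i < j" for i j
  proof -
    have "A (s j) \<subseteq> L i" unfolding L_def using that UN_upper[of "j - Suc i" UNIV "\<lambda>k. A (s (Suc i + k))"] by simp
    then show ?thesis by (auto simp: B_def)
  qed
  have "disjoint_family B"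
    unfolding disjoint_family_on_def using disj by (metis inf_commute linorder_neqE_nat)
  moreover have "norm (g (s n) - restr (B n) (g (s n))) \<le> norm (g (s n) - restr (A (s n)) (g (s n))) + c * (1/2)^n" for n
  proof -
    let ?b = "\<lambda>k. c * (1/2)^(Suc n + k)"
    have sums: "?b sums (c * (1/2)^n)"
      using sums_mult[OF geometric_sums[of "1/2::real"], of "c * (1/2)^Suc n"]
      by (simp add: power_add mult.assoc)
    have "g (s n) - restr (B n) (g (s n)) = (g (s n) - restr (A (s n)) (g (s n))) + restr (A (s n) - B n) (g (s n))"
      using restr_Diff[OF A[of "s n"] B[of n], of "g (s n)"] by (simp add: B_def algebra_simps)
    then have "norm (g (s n) - restr (B n) (g (s n))) \<le> norm (g (s n) - restr (A (s n)) (g (s n))) + norm (restr (A (s n) - B n) (g (s n)))"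
      by (metis norm_triangle_ineq)
    also have "norm (restr (A (s n) - B n) (g (s n))) \<le> norm (restr (L n) (g (s n)))"
      using A B L by (intro norm_restr_mono) (auto simp: B_def)
    also have "\<dots> \<le> suminf ?b"
      unfolding L_def using A small[of n "Suc n + _"] sums
      by (intro norm_restr_Union_le) (auto simp: sums_iff less_imp_le simp del: power_Suc)
    also have "\<dots> = c * (1/2)^n" using sums by (simp add: sums_iff)
    finally show ?thesis by simp
  qed
  ultimately show ?thesis using that s B by blast
qed


section \<open>Functions of the subspace that are concentrated on small sets\<close>

lemma convex_hull_image_explicit:
  assumes "x \<in> convex hull (g ` I)"
  obtains S u where "finite S" "S \<subseteq> I" "\<And>n. n \<in> S \<Longrightarrow> 0 \<le> u n" "sum u S = 1"
    "x = (\<Sum>n\<in>S. u n *\<^sub>R g n)"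
proof -
  obtain S u where S: "finite S" "S \<subseteq> g ` I" "\<forall>x\<in>S. 0 \<le> u x" "sum u S = 1"
    "(\<Sum>v\<in>S. u v *\<^sub>R v) = x"
    using assms unfolding convex_hull_explicit by blast
  then obtain U where U: "U \<subseteq> I" "inj_on g U" "S = g ` U" by (auto simp: subset_image_inj)
  show ?thesis
  proof (rule that[of U "u \<circ> g"])
    show "finite U" using U S finite_imageD by blast
    show "sum (u \<circ> g) U = 1" "x = (\<Sum>n\<in>U. (u \<circ> g) n *\<^sub>R g n)"
      using S U by (auto simp: sum.reindex)
  qed (use U S in auto)
qed

text \<open>A form of the subsequence splitting lemma. Functions \<open>f n\<close> in the ball of
  \<open>Y\<close> with nearly maximal excess over \<open>n\<close> are split into
  \<open>u n\<close>, the part of modulus at most \<open>n\<close>, and the peak \<open>v n\<close>.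
  The \<open>u n\<close> are uniformly integrable, but the peaks may lie outside \<open>Y\<close>.
  Two convex combinations of the \<open>u (s n)\<close> over disjoint index sets nearly agree; so
  the corresponding difference of combinations of the \<open>f (s n)\<close> lies in
  \<open>Y\<close> and is almost a combination of peaks, which are almost disjoint and cannot
  cancel.\<close>

lemma not_equi_int_concentrated:
  fixes Y :: "'a::euclidean_space L1 set"
  assumes Y: "subspace Y" and ne: "\<not> equi_int {f\<in>Y. norm f \<le> 1}" and e: "e > 0" and d: "d > 0"
  obtains G A where "G \<in> Y" "norm G = 1" "A \<in> sets I01" "measure I01 A \<le> d" "norm (G - restr A G) \<le> e"
proof -
  define \<B> where "\<B> = {f\<in>Y. norm f \<le> 1}"
  define m where "m R = (SUP f\<in>\<B>. excess R f)" for R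
  \<comment> \<open>The excess that no truncation height removes; it is positive because uniform
    integrability fails.\<close>
  define \<kappa> where "\<kappa> = (INF n. m (real n))"
  have B0: "0 \<in> \<B>" using Y by (simp add: \<B>_def subspace_0)
  have bdd: "bdd_above (excess R ` \<B>)" if "R \<ge> 0" for R
    using excess_le_norm[OF that] by (force simp: \<B>_def intro!: bdd_aboveI[of _ 1] intro: order_trans)
  have le_m: "excess R f \<le> m R" if "R \<ge> 0" "f \<in> \<B>" for R f
    unfolding m_def using bdd[OF that(1)] that(2) by (intro cSUP_upper)
  obtain \<eta>0 where \<eta>0: "\<eta>0 > 0" "\<And>R. R \<ge> 0 \<Longrightarrow> \<exists>f\<in>\<B>. excess R f > \<eta>0"
  proof -
    obtain \<eta> where "\<eta> > 0" "\<forall>R\<ge>0. \<not> (\<forall>f\<in>\<B>. excess R f \<le> \<eta>)"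
      using ne unfolding equi_int_def \<B>_def by blast
    then show ?thesis using that[of \<eta>] by (auto simp: not_le)
  qed
  have m_ge: "m (real n) \<ge> \<eta>0" for n
    using \<eta>0(2)[of "real n"] le_m[of "real n"] by force
  have bddm: "bdd_below (range (\<lambda>n. m (real n)))" using m_ge by (auto intro!: bdd_belowI)
  have k: "\<kappa> > 0" unfolding \<kappa>_def using m_ge \<eta>0(1) by (intro less_le_trans[OF _ cINF_greatest]) auto
  have k_le: "\<kappa> \<le> m (real n)" for n unfolding \<kappa>_def using bddm by (intro cINF_lower) auto
  have m_anti: "m S \<le> m R" if "0 \<le> R" "R \<le> S" for R S
    unfolding m_def[of S]
  proof (rule cSUP_least)
    fix f assume "f \<in> \<B>"
    then show "excess S f \<le> m R" using excess_antimono[OF that(2), of f] le_m[OF that(1), of f] by linarith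
  qed (use B0 in auto)
  have "\<exists>f\<in>\<B>. \<kappa> - 1 / real (Suc n) < excess (real n) f" for n
  proof -
    have "\<kappa> - 1 / real (Suc n) < m (real n)" using k_le[of n] by (smt (verit) divide_pos_pos of_nat_0_less_iff zero_less_Suc)
    then show ?thesis
      unfolding m_def using less_cSUP_iff[OF _ bdd[of "real n"]] B0 by auto
  qed
  then obtain f where f: "\<And>n. f n \<in> \<B>" "\<And>n. \<kappa> - 1 / real (Suc n) < excess (real n) (f n)"
    by metis
  define A where "A n = {x\<in>space I01. norm (rep_L1 (f n) x) > real n}" for n
  have A: "A n \<in> sets I01" for n unfolding A_def by measurable
  have measA: "real n * measure I01 (A n) \<le> 1" for n
  proof -
    have int: "integrable I01 (\<lambda>x. real n * indicator (A n) x)"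
      using A by (intro integrable_mult_right integrable_real_indicator) (auto simp: I01.emeasure_eq_measure)
    have "A n \<inter> {0..1} = A n" by (auto simp: A_def)
    then have "real n * measure I01 (A n) = (\<integral>x. real n * indicator (A n) x \<partial>I01)"
      using A by simp
    also have "\<dots> \<le> (\<integral>x. norm (rep_L1 (f n) x) \<partial>I01)"
      using int by (rule Bochner_Integration.integral_mono) (auto simp: A_def indicator_def)
    also have "\<dots> \<le> 1" using f(1)[of n] by (simp add: norm_L1_eq[symmetric] \<B>_def)
    finally show ?thesis .
  qed
  have limA: "(\<lambda>n. measure I01 (A n)) \<longlonglongrightarrow> 0"
  proof (rule tendsto_sandwich[OF _ _ tendsto_const])
    show "\<forall>\<^sub>F n in sequentially. measure I01 (A n) \<le> 1 / real n"
      using eventually_gt_at_top[of "0::nat"]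
      by eventually_elim (use measA in \<open>simp add: field_simps\<close>)
    show "(\<lambda>n. 1 / real n) \<longlonglongrightarrow> 0" by (rule lim_1_over_n)
  qed simp
  define v where "v n = restr (A n) (f n)" for n
  define u where "u n = f n - v n" for n
  have v_ge: "norm (v n) \<ge> excess (real n) (f n)" for n
    unfolding v_def norm_restr[OF A] excess_def
    using integrable_restr[OF A] by (intro Bochner_Integration.integral_mono) (auto simp: A_def indicator_def)
  \<comment> \<open>The two tails on the left are never positive at the same place: where
    \<open>u n\<close> survives, \<open>f n\<close> does not exceed \<open>real n\<close>.\<close>
  have u_ex: "excess R (u n) \<le> excess R (f n) - excess (real n) (f n)" if R: "0 \<le> R" "R \<le> real n" for R n
  proof -
    have "excess R (u n) + excess (real n) (f n) =
        (\<integral>x. max (norm (rep_L1 (u n) x) - R) 0 + max (norm (rep_L1 (f n) x) - real n) 0 \<partial>I01)"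
      by (simp add: excess_def)
    also have "\<dots> \<le> excess R (f n)"
      unfolding excess_def
    proof (rule integral_mono_AE)
      show "AE x in I01. max (norm (rep_L1 (u n) x) - R) 0 + max (norm (rep_L1 (f n) x) - real n) 0
          \<le> max (norm (rep_L1 (f n) x) - R) 0"
        using AE_rep_diff[of "f n" "v n"] AE_rep_restr[OF A, of n "f n"] AE_space
        by eventually_elim (use R in \<open>auto simp: u_def v_def A_def indicator_def max_def\<close>)
    qed auto
    finally show ?thesis by simp
  qed
  \<comment> \<open>By \<open>u_ex\<close> the excess of \<open>u n\<close> over
    \<open>N \<le> n\<close> is at most \<open>m N - \<kappa> + 1 / Suc n\<close>. For
    \<open>n < N\<close> it vanishes, since \<open>u n\<close> was cut off at height
    \<open>n\<close>.\<close>
  have u_eq: "equi_int (range u)"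
    unfolding equi_int_def
  proof (intro allI impI)
    fix \<eta> :: real assume \<eta>: "\<eta> > 0"
    then have "\<kappa> < \<kappa> + \<eta>/2" by simp
    then obtain n0 where n0: "m (real n0) < \<kappa> + \<eta>/2"
      using cINF_less_iff[OF UNIV_not_empty bddm, of "\<kappa> + \<eta>/2"] unfolding \<kappa>_def by blast
    obtain n1 where n1: "1 / real (Suc n1) < \<eta>/2" using nat_approx_posE[of "\<eta>/2"] \<eta> by auto
    define N where "N = max n0 n1"
    have "excess (real N) (u n) \<le> \<eta>" for n
    proof (cases "n \<ge> N")
      case True
      have "1 / real (Suc n) \<le> 1 / real (Suc n1)" using True by (auto simp: N_def divide_simps)
      then show ?thesis
        using u_ex[of "real N" n] True le_m[of "real N" "f n"] f[of n] m_anti[of "real n0" "real N"] n0 n1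
        by (auto simp: N_def)
    next
      case False
      then show ?thesis using u_ex[of "real n" n] excess_antimono[of "real n" "real N" "u n"] \<eta> by auto
    qed
    then show "\<exists>R\<ge>0. \<forall>f\<in>range u. excess R f \<le> \<eta>" by (intro exI[of _ "real N"]) auto
  qed
  \<comment> \<open>The first bounds add up to \<open>d\<close>; the second leaves each peak a norm
    above \<open>3/4 * \<kappa>\<close>.\<close>
  have P: "\<forall>\<^sub>F r in sequentially. measure I01 (A r) < d * (1/2) ^ Suc n \<and> 1 / real (Suc r) < \<kappa> / 4" for n
    using k d by (intro eventually_conj order_tendstoD(2)[OF limA] order_tendstoD(2)[OF LIMSEQ_Suc[OF lim_1_over_n]]) auto
  have k8: "\<kappa> / 8 > 0" using k by simp
  obtain s B where s: "strict_mono s" "\<And>n. measure I01 (A (s n)) < d * (1/2) ^ Suc n \<and> 1 / real (Suc (s n)) < \<kappa> / 4"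
    and B: "\<And>n. B n \<in> sets I01" "disjoint_family B"
    and th': "\<And>n. norm (v (s n) - restr (B n) (v (s n))) \<le> norm (v (s n) - restr (A (s n)) (v (s n))) + \<kappa>/8 * (1/2)^n"
    using almost_disjoint_subseq[of A "\<kappa>/8" "\<lambda>n r. measure I01 (A r) < d * (1/2) ^ Suc n \<and> 1 / real (Suc r) < \<kappa> / 4" v, OF A limA k8 P]
    by blast
  have th: "norm (v (s n) - restr (B n) (v (s n))) \<le> \<kappa>/8" for n
  proof -
    have "v (s n) - restr (A (s n)) (v (s n)) = 0" by (simp add: v_def restr_restr A)
    then have "norm (v (s n) - restr (B n) (v (s n))) \<le> \<kappa>/8 * (1/2)^n" using th'[of n] by simp
    also have "\<dots> \<le> \<kappa>/8 * 1" using k by (intro mult_left_mono power_le_one) auto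
    finally show ?thesis by simp
  qed
  \<comment> \<open>The bound \<open>\<kappa>/4\<close> keeps the norm of \<open>G0\<close> at least
    \<open>\<kappa>/2\<close>, and \<open>e * \<kappa> / 8\<close> makes the remainder small
    relative to that norm.\<close>
  define \<epsilon> where "\<epsilon> = min (\<kappa>/4) (e * \<kappa> / 8)"
  have \<epsilon>: "\<epsilon> > 0" using k e by (simp add: \<epsilon>_def)
  define Cm where "Cm m = closure (convex hull ((u \<circ> s) ` {m..}))" for m
  have "\<Inter>(range Cm) \<noteq> {}"
  proof (rule equi_int_directed_Inter[OF equi_int_closure_hull[OF u_eq]])
    fix C D assume "C \<in> range Cm" "D \<in> range Cm"
    then obtain i j where "C = Cm i" "D = Cm j" by auto
    moreover have "Cm (max i j) \<subseteq> Cm i \<inter> Cm j"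
      unfolding Cm_def by (auto intro!: closure_mono hull_mono image_mono dest: subsetD[rotated])
    ultimately show "\<exists>E\<in>range Cm. E \<subseteq> C \<inter> D" by blast
  next
    fix C assume "C \<in> range Cm"
    then obtain i where C: "C = Cm i" by auto
    show "C \<subseteq> closure (convex hull range u)" unfolding C Cm_def by (intro closure_mono hull_mono) auto
    have "(u \<circ> s) ` {i..} \<noteq> {}" by auto
    then have "convex hull ((u \<circ> s) ` {i..}) \<noteq> {}" by (simp only: convex_hull_eq_empty not_False_eq_True)
    then show "convex C \<and> closed C \<and> C \<noteq> {}" unfolding C Cm_def by (simp add: convex_closure)
  qed auto
  then obtain u0 where u0: "\<And>m. u0 \<in> closure (convex hull ((u \<circ> s) ` {m..}))" by (auto simp: Cm_def)
  obtain x where x: "x \<in> convex hull ((u \<circ> s) ` {0..})" "dist x u0 < \<epsilon>"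
    using u0[of 0] \<epsilon> unfolding closure_approachable by blast
  obtain S w where S: "finite S" "S \<subseteq> {0..}" "\<And>n. n \<in> S \<Longrightarrow> 0 \<le> w n" "sum w S = 1" "x = (\<Sum>n\<in>S. w n *\<^sub>R (u \<circ> s) n)"
    using convex_hull_image_explicit[OF x(1)] by blast
  obtain M where M: "S \<subseteq> {..<M}" using S(1) finite_nat_iff_bounded by blast
  obtain x' where x': "x' \<in> convex hull ((u \<circ> s) ` {M..})" "dist x' u0 < \<epsilon>"
    using u0[of M] \<epsilon> unfolding closure_approachable by blast
  obtain S' w' where S': "finite S'" "S' \<subseteq> {M..}" "\<And>n. n \<in> S' \<Longrightarrow> 0 \<le> w' n" "sum w' S' = 1" "x' = (\<Sum>n\<in>S'. w' n *\<^sub>R (u \<circ> s) n)"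
    using convex_hull_image_explicit[OF x'(1)] by blast
  have disj: "S \<inter> S' = {}" using M S'(2) by force
  define t where "t n = (if n \<in> S then w n else - w' n)" for n
  define J where "J = S \<union> S'"
  have J: "finite J" using S S' by (simp add: J_def)
  have sumJ: "(\<Sum>n\<in>J. h n) = (\<Sum>n\<in>S. h n) + (\<Sum>n\<in>S'. h n)" for h :: "nat \<Rightarrow> 'b::comm_monoid_add"
    unfolding J_def using S(1) S'(1) disj by (rule sum.union_disjoint)
  have tS': "n \<in> S' \<Longrightarrow> t n = - w' n" for n using disj by (auto simp: t_def)
  define X V where "X = (\<Sum>n\<in>J. t n *\<^sub>R u (s n))" and "V = (\<Sum>n\<in>J. t n *\<^sub>R v (s n))"
  have "X = x - x'"
    unfolding X_def sumJ S(5) S'(5) using tS' by (simp add: t_def sum_negf)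
  then have nX: "norm X \<le> 2 * \<epsilon>"
    using x(2) x'(2) norm_triangle_ineq4[of "x - u0" "x' - u0"] by (simp add: dist_norm)
  define G0 where "G0 = (\<Sum>n\<in>J. t n *\<^sub>R f (s n))"
  have G0: "G0 = X + V"
    by (simp add: G0_def X_def V_def u_def scaleR_diff_right sum_subtractf)
  \<comment> \<open>The weights have total modulus 2, and each peak contributes at least
    \<open>3/4 * \<kappa> - 2 * \<kappa>/8 = \<kappa>/2\<close>.\<close>
  have "\<kappa> \<le> norm V"
  proof -
    have "\<kappa> = (\<Sum>n\<in>J. \<bar>t n\<bar> * (\<kappa>/2))"
      unfolding sum_distrib_right[symmetric] sumJ using S S' tS' by (simp add: t_def)
    also have "\<dots> \<le> (\<Sum>n\<in>J. \<bar>t n\<bar> * (norm (v (s n)) - 2 * norm (v (s n) - restr (B n) (v (s n)))))"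
    proof (intro sum_mono mult_left_mono)
      fix n
      show "\<kappa>/2 \<le> norm (v (s n)) - 2 * norm (v (s n) - restr (B n) (v (s n)))"
        using th[of n] v_ge[of "s n"] f(2)[of "s n"] s(2)[of n] by linarith
    qed simp
    also have "\<dots> \<le> norm V"
      unfolding V_def using B by (intro norm_sum_almost_disjoint_ge J) (auto simp: disjoint_family_on_def)
    finally show ?thesis .
  qed
  then have nG0: "norm G0 \<ge> \<kappa>/2"
    using norm_diff_ineq[of V X] nX by (simp add: G0 add.commute \<epsilon>_def)
  define A' where "A' = (\<Union>n. A (s n))"
  have A': "A' \<in> sets I01" using A by (auto simp: A'_def)
  have "restr A' (v (s n)) = v (s n)" for n
  proof -
    have "A' \<inter> A (s n) = A (s n)" by (auto simp: A'_def)
    then show ?thesis by (simp add: v_def restr_restr A A')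
  qed
  then have cV: "restr A' V = V"
    unfolding V_def using A' by (simp add: linear_sum[OF linear_restr] restr_scaleR)
  show ?thesis
  proof (rule that[of "G0 /\<^sub>R norm G0" A'])
    have "f (s n) \<in> Y" for n using f(1)[of "s n"] by (simp add: \<B>_def)
    then show "G0 /\<^sub>R norm G0 \<in> Y"
      unfolding G0_def using Y by (intro subspace_scale subspace_sum) auto
    have "norm G0 \<noteq> 0" using nG0 k by linarith
    then show "norm (G0 /\<^sub>R norm G0) = 1" by simp
    show "A' \<in> sets I01" by fact
    have sm: "(\<lambda>n. d * (1/2::real)^Suc n) sums d"
      using sums_mult[OF power_half_series, of d] by simp
    have smA: "summable (\<lambda>n. measure I01 (A (s n)))"
      using s(2) sm by (intro summable_comparison_test'[OF sums_summable[OF sm], of 0]) (auto simp: less_imp_le)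
    have "measure I01 A' \<le> (\<Sum>n. measure I01 (A (s n)))"
      unfolding A'_def using A smA by (intro I01.finite_measure_subadditive_countably) auto
    also have "\<dots> \<le> (\<Sum>n. d * (1/2::real)^Suc n)"
      using s(2) smA sm by (intro suminf_le) (auto simp: sums_iff less_imp_le)
    also have "\<dots> = d" using sm by (simp add: sums_iff)
    finally show "measure I01 A' \<le> d" .
    have "G0 - restr A' G0 = X - restr A' X" using A' cV by (simp add: G0 restr_add)
    then have le: "norm (G0 - restr A' G0) \<le> 2 * \<epsilon>" using norm_off_restr_le[OF A', of X] nX by simp
    have "norm (G0 /\<^sub>R norm G0 - restr A' (G0 /\<^sub>R norm G0)) = norm (G0 - restr A' G0) / norm G0"
      unfolding restr_scaleR[OF A'] scaleR_diff_right[symmetric] by (simp add: divide_inverse)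
    also have "\<dots> \<le> 2 * \<epsilon> / (\<kappa>/2)" using le nG0 k \<epsilon> by (intro frac_le) auto
    also have "\<dots> \<le> e"
    proof -
      have "2 * \<epsilon> \<le> e * (\<kappa>/2)" using e k by (simp add: \<epsilon>_def min_def)
      then show ?thesis using k by (simp add: divide_le_eq)
    qed
    finally show "norm (G0 /\<^sub>R norm G0 - restr A' (G0 /\<^sub>R norm G0)) \<le> e" .
  qed
qed

lemma not_equi_int_almost_disjoint_sequence:
  fixes Y :: "'a::euclidean_space L1 set"
  assumes "subspace Y" and "\<not> equi_int {f\<in>Y. norm f \<le> 1}"
  obtains G B where "\<And>n::nat. G n \<in> Y" "\<And>n. norm (G n) = 1" "\<And>n. B n \<in> sets I01"
    "disjoint_family B" "\<And>n. norm (G n - restr (B n) (G n)) \<le> (1/8) * (1/2)^n"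
proof -
  have "\<exists>G A. G \<in> Y \<and> norm G = 1 \<and> A \<in> sets I01 \<and> measure I01 A \<le> 1 / real (Suc n) \<and> 
      norm (G - restr A G) \<le> 1 / real (Suc n)" for n
    by (rule not_equi_int_concentrated[OF assms, of "1 / real (Suc n)" "1 / real (Suc n)"]) auto
  then obtain G A where G: "\<And>n. G n \<in> Y" "\<And>n. norm (G n) = 1" and A: "\<And>n. A n \<in> sets I01"
    and mA: "\<And>n. measure I01 (A n) \<le> 1 / real (Suc n)"
    and GA: "\<And>n. norm (G n - restr (A n) (G n)) \<le> 1 / real (Suc n)"
    by metis
  have lim: "(\<lambda>n. measure I01 (A n)) \<longlonglongrightarrow> 0"
    by (rule tendsto_sandwich[OF _ _ tendsto_const LIMSEQ_Suc[OF lim_1_over_n]]) (use mA in auto)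
  \<comment> \<open>Imperfect concentration and overlap of the supports may cost 1/16 each, which
    together give the 1/8 of the statement.\<close>
  have P: "\<forall>\<^sub>F r in sequentially. 1 / real (Suc r) < (1/16) * (1/2)^n" for n
    by (intro order_tendstoD(2)[OF LIMSEQ_Suc[OF lim_1_over_n]]) auto
  obtain s B where s: "strict_mono s" "\<And>n. 1 / real (Suc (s n)) < (1/16) * (1/2)^n"
    and B: "\<And>n. B n \<in> sets I01" "disjoint_family B"
    and th: "\<And>n. norm (G (s n) - restr (B n) (G (s n))) \<le> norm (G (s n) - restr (A (s n)) (G (s n))) + 1/16 * (1/2)^n"
    using almost_disjoint_subseq[of A "1/16" "\<lambda>n r. 1 / real (Suc r) < (1/16) * (1/2)^n" G, OF A lim _ P]
    by (metis zero_less_divide_1_iff zero_less_numeral)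
  show ?thesis
  proof (rule that[of "G \<circ> s" B])
    fix n
    show "norm ((G \<circ> s) n - restr (B n) ((G \<circ> s) n)) \<le> (1/8) * (1/2)^n"
      using th[of n] GA[of "s n"] s(2)[of n] by simp
  qed (use G B in auto)
qed

section \<open>Failure of the fixed point property\<close>

text \<open>The norms \<open>norm (e j)\<close> decrease just fast enough for the right shift on the closed convex hull
  of the sequence to be nonexpansive; it has no fixed point since it shifts the coefficients.\<close>

lemma not_fixed_point_property_shift:
  fixes Y :: "'b::banach set" and e :: "nat \<Rightarrow> 'b"
  assumes Y: "subspace Y" "closed Y" and eY: "\<And>j. e j \<in> Y"
    and e_le: "\<And>j. norm (e j) \<le> 2" and e_ge: "\<And>j. 1 \<le> norm (e j)"
    and lower: "\<And>n s. (\<Sum>j<n. \<bar>s j\<bar> * norm (e (Suc j))) \<le> norm (\<Sum>j<n. s j *\<^sub>R e j)"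
  shows "\<not> fixed_point_property Y"
proof -
  define \<Psi> where "\<Psi> t = (\<Sum>j. t j *\<^sub>R e j)" for t
  define D :: "(nat \<Rightarrow> real) set" where "D = {t. (\<forall>j. 0 \<le> t j) \<and> t sums 1}"
  have sn: "summable (\<lambda>j. norm (t j *\<^sub>R e j))" if "summable (\<lambda>j. \<bar>t j\<bar>)" for t
    by (rule summable_comparison_test'[OF summable_mult[OF that, of 2], of 0])
      (use mult_right_mono[OF e_le] in \<open>auto simp: mult.commute\<close>)
  have sv: "summable (\<lambda>j. t j *\<^sub>R e j)" if "summable (\<lambda>j. \<bar>t j\<bar>)" for t
    using sn[OF that] by (rule summable_norm_cancel)
  have D_abs: "summable (\<lambda>j. \<bar>t j\<bar>)" "(\<Sum>j. \<bar>t j\<bar>) = 1" if "t \<in> D" for t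
    using that by (auto simp: D_def sums_iff)
  have sdiff: "summable (\<lambda>j. \<bar>t j - r j\<bar>)" if "summable (\<lambda>j. \<bar>t j\<bar>)" "summable (\<lambda>j. \<bar>r j\<bar>)" for t r :: "nat \<Rightarrow> real"
    by (rule summable_comparison_test'[OF summable_add[OF that], of 0]) auto
  have Psi_diff: "\<Psi> t - \<Psi> r = \<Psi> (\<lambda>j. t j - r j)" 
    if "summable (\<lambda>j. \<bar>t j\<bar>)" "summable (\<lambda>j. \<bar>r j\<bar>)" for t r
    unfolding \<Psi>_def using sv[OF that(1)] sv[OF that(2)]
    by (simp add: suminf_diff scaleR_diff_left)
  have Psi_le: "norm (\<Psi> t) \<le> (\<Sum>j. \<bar>t j\<bar> * norm (e j))" if "summable (\<lambda>j. \<bar>t j\<bar>)" for t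
    unfolding \<Psi>_def using summable_norm[OF sn[OF that]] by simp
  have Psi_le2: "norm (\<Psi> t) \<le> 2 * (\<Sum>j. \<bar>t j\<bar>)" if t: "summable (\<lambda>j. \<bar>t j\<bar>)" for t
  proof -
    have "(\<Sum>j. \<bar>t j\<bar> * norm (e j)) \<le> (\<Sum>j. 2 * \<bar>t j\<bar>)"
    proof (rule suminf_le)
      show "\<bar>t j\<bar> * norm (e j) \<le> 2 * \<bar>t j\<bar>" for j
        using mult_left_mono[OF e_le[of j], of "\<bar>t j\<bar>"] by simp
    qed (use sn[OF t] summable_mult[OF t] in auto)
    then show ?thesis using Psi_le[OF t] t by (simp add: suminf_mult)
  qed
  have sSuc: "summable (\<lambda>j. \<bar>t j\<bar> * norm (e (Suc j)))" if "summable (\<lambda>j. \<bar>t j\<bar>)" for t :: "nat \<Rightarrow> real"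
    by (rule summable_comparison_test'[OF summable_mult[OF that, of 2], of 0])
      (use mult_left_mono[OF e_le] in \<open>auto simp: mult.commute[of 2]\<close>)
  have Psi_ge: "(\<Sum>j. \<bar>t j\<bar> * norm (e (Suc j))) \<le> norm (\<Psi> t)" if t: "summable (\<lambda>j. \<bar>t j\<bar>)" for t
  proof (rule LIMSEQ_le)
    show "(\<lambda>n. \<Sum>j<n. \<bar>t j\<bar> * norm (e (Suc j))) \<longlonglongrightarrow> (\<Sum>j. \<bar>t j\<bar> * norm (e (Suc j)))"
      using sSuc[OF t] by (rule summable_LIMSEQ)
    show "(\<lambda>n. norm (\<Sum>j<n. t j *\<^sub>R e j)) \<longlonglongrightarrow> norm (\<Psi> t)"
      unfolding \<Psi>_def using sv[OF t] by (intro tendsto_norm summable_LIMSEQ)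
  qed (use lower in auto)
  have Psi_ge1: "(\<Sum>j. \<bar>t j\<bar>) \<le> norm (\<Psi> t)" if t: "summable (\<lambda>j. \<bar>t j\<bar>)" for t
  proof -
    have "(\<Sum>j. \<bar>t j\<bar>) \<le> (\<Sum>j. \<bar>t j\<bar> * norm (e (Suc j)))"
    proof (rule suminf_le)
      show "\<bar>t j\<bar> \<le> \<bar>t j\<bar> * norm (e (Suc j))" for j
        using mult_left_mono[OF e_ge[of "Suc j"], of "\<bar>t j\<bar>"] by simp
    qed (use t sSuc[OF t] in auto)
    then show ?thesis using Psi_ge[OF t] by simp
  qed
  define sh :: "(nat \<Rightarrow> real) \<Rightarrow> nat \<Rightarrow> real" where
    "sh t = (\<lambda>j. case j of 0 \<Rightarrow> 0 | Suc i \<Rightarrow> t i)" for t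
  have shD: "sh t \<in> D" if "t \<in> D" for t
  proof -
    have "(\<lambda>j. sh t (Suc j)) sums 1" using that by (simp add: sh_def D_def)
    then have "sh t sums 1" by (subst (asm) sums_Suc_iff) (simp add: sh_def)
    then show ?thesis using that by (auto simp: D_def sh_def split: nat.split)
  qed
  have Psi_sh: "norm (\<Psi> (sh t) - \<Psi> (sh r)) \<le> norm (\<Psi> t - \<Psi> r)" if tr: "t \<in> D" "r \<in> D" for t r
  proof -
    let ?d = "\<lambda>j. t j - r j"
    have d: "summable (\<lambda>j. \<bar>?d j\<bar>)" using sdiff D_abs tr by blast
    have d': "summable (\<lambda>j. \<bar>sh t j - sh r j\<bar>)" using sdiff D_abs shD tr by blast
    \<comment> \<open>The triangle inequality for the shifted coefficients produces exactly the sum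
      that bounds the unshifted difference from below in \<open>Psi_ge\<close>.\<close>
    have "norm (\<Psi> (sh t) - \<Psi> (sh r)) \<le> (\<Sum>j. \<bar>sh t j - sh r j\<bar> * norm (e j))"
      using Psi_le[OF d'] Psi_diff D_abs shD tr by simp
    also have "\<dots> = (\<Sum>j. \<bar>?d j\<bar> * norm (e (Suc j)))"
      using suminf_split_head[of "\<lambda>j. \<bar>sh t j - sh r j\<bar> * norm (e j)"] sn[OF d'] by (simp add: sh_def)
    also have "\<dots> \<le> norm (\<Psi> t - \<Psi> r)"
      using Psi_ge[OF d] Psi_diff D_abs tr by simp
    finally show ?thesis .
  qed
  have inj: "inj_on \<Psi> D"
  proof (rule inj_onI)
    fix t r assume tr: "t \<in> D" "r \<in> D" "\<Psi> t = \<Psi> r"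
    have d: "summable (\<lambda>j. \<bar>t j - r j\<bar>)" using sdiff D_abs tr by blast
    have "\<Psi> (\<lambda>j. t j - r j) = 0"
      using Psi_diff[OF D_abs(1)[OF tr(1)] D_abs(1)[OF tr(2)]] tr(3) by simp
    then have "(\<Sum>j. \<bar>t j - r j\<bar>) \<le> 0" using Psi_ge1[OF d] by simp
    then have "(\<Sum>j. \<bar>t j - r j\<bar>) = 0" using suminf_nonneg[OF d] by simp
    then have "\<forall>j. \<bar>t j - r j\<bar> = 0" using suminf_eq_zero_iff[OF d] by simp
    then show "t = r" by auto
  qed
  define C where "C = \<Psi> ` D"
  define T where "T x = \<Psi> (sh (inv_into D \<Psi> x))" for x
  have T: "T (\<Psi> t) = \<Psi> (sh t)" if "t \<in> D" for t using that inj by (simp add: T_def)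
  have "C \<subseteq> Y"
  proof
    fix x assume "x \<in> C"
    then obtain t where t: "t \<in> D" "x = \<Psi> t" by (auto simp: C_def)
    have "(\<lambda>n. \<Sum>j<n. t j *\<^sub>R e j) \<longlonglongrightarrow> x"
      unfolding t(2) \<Psi>_def by (rule summable_LIMSEQ[OF sv[OF D_abs(1)[OF t(1)]]])
    moreover have "(\<Sum>j<n. t j *\<^sub>R e j) \<in> Y" for n
      using Y eY by (intro subspace_sum subspace_scale) auto
    ultimately show "x \<in> Y" using closed_sequentially[OF Y(2), of "\<lambda>n. \<Sum>j<n. t j *\<^sub>R e j" x] by simp
  qed
  moreover have "C \<noteq> {}"
  proof -
    have "(\<lambda>j. if j = 0 then 1 else 0) \<in> D" using sums_single[of 0 "\<lambda>_. 1::real"] by (simp add: D_def)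
    then show ?thesis by (auto simp: C_def)
  qed
  \<comment> \<open>Along a convergent sequence in \<open>C\<close> the coefficients converge
    coordinatewise. The bound \<open>part_le\<close> on partial sums survives this limit, so they
    even converge in l1, and the limit keeps total mass 1.\<close>
  moreover have "closed C"
    unfolding closed_sequential_limits
  proof (intro allI impI, elim conjE)
    fix X x assume X: "\<forall>n. X n \<in> C" and lim: "X \<longlonglongrightarrow> x"
    then obtain t where t: "\<And>n. t n \<in> D" "\<And>n. X n = \<Psi> (t n)" unfolding C_def image_iff by metis
    have sd: "summable (\<lambda>j. \<bar>t n j - t m j\<bar>)" for n m using sdiff D_abs t by blast
    have dist_ge: "(\<Sum>j. \<bar>t n j - t m j\<bar>) \<le> norm (X n - X m)" for n m
      using Psi_ge1[OF sd[of n m]] Psi_diff D_abs t by simp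
    have part_le: "(\<Sum>j<k. \<bar>t n j - t m j\<bar>) \<le> norm (X n - X m)" for n m k
      using sum_le_suminf[OF sd[of n m], of "{..<k}"] dist_ge[of n m] by auto
    have coord: "\<bar>t n j - t m j\<bar> \<le> norm (X n - X m)" for n m j
      using part_le[of n m "Suc j"] member_le_sum[of j "{..<Suc j}" "\<lambda>j. \<bar>t n j - t m j\<bar>"]
      by (simp del: sum.lessThan_Suc)
    have CX: "Cauchy X" using lim by (rule LIMSEQ_imp_Cauchy)
    have "Cauchy (\<lambda>n. t n j)" for j
    proof (rule CauchyI)
      fix \<epsilon> :: real assume "\<epsilon> > 0"
      then obtain M where "\<forall>m\<ge>M. \<forall>n\<ge>M. norm (X m - X n) < \<epsilon>" using CauchyD[OF CX] by blast
      then show "\<exists>M. \<forall>m\<ge>M. \<forall>n\<ge>M. norm (t m j - t n j) < \<epsilon>"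
        by (intro exI[of _ M]) (auto intro!: le_less_trans[OF coord])
    qed
    then have "\<exists>l. (\<lambda>n. t n j) \<longlonglongrightarrow> l" for j by (simp add: Cauchy_convergent_iff convergent_def)
    then obtain l where l: "\<And>j. (\<lambda>n. t n j) \<longlonglongrightarrow> l j" by metis
    have l0: "l j \<ge> 0" for j
      using l[of j] t(1) by (intro LIMSEQ_le_const[OF l[of j]]) (auto simp: D_def)
    have pl: "(\<Sum>j<k. \<bar>t n j - l j\<bar>) \<le> norm (X n - x)" for n k
    proof (rule LIMSEQ_le)
      show "(\<lambda>m. \<Sum>j<k. \<bar>t n j - t m j\<bar>) \<longlonglongrightarrow> (\<Sum>j<k. \<bar>t n j - l j\<bar>)"
        by (intro tendsto_intros l)
      show "(\<lambda>m. norm (X n - X m)) \<longlonglongrightarrow> norm (X n - x)" by (intro tendsto_intros lim)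
    qed (use part_le in auto)
    have sl': "summable (\<lambda>j. \<bar>t n j - l j\<bar>)" for n
      by (rule bounded_imp_summable[where B = "norm (X n - x)"])
        (simp, simp only: lessThan_Suc_atMost[symmetric] pl)
    have sle: "(\<Sum>j. \<bar>t n j - l j\<bar>) \<le> norm (X n - x)" for n
      using sl' pl by (intro suminf_le_const) auto
    have sl: "summable (\<lambda>j. \<bar>l j\<bar>)"
      by (rule summable_comparison_test'[OF summable_add[OF D_abs(1)[OF t(1)[of 0]] sl'[of 0]], of 0]) auto
    have lim0: "(\<lambda>n. norm (X n - x)) \<longlonglongrightarrow> 0" using lim by (simp add: tendsto_norm_zero_iff LIM_zero_iff)
    have tl: "norm (\<Psi> (t n) - \<Psi> l) \<le> 2 * norm (X n - x)" for n
      using Psi_le2[OF sl'[of n]] sle[of n] Psi_diff[OF D_abs(1)[OF t(1)[of n]] sl] by simp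
    have "(\<lambda>n. X n) \<longlonglongrightarrow> \<Psi> l"
    proof (rule LIM_zero_cancel, rule tendsto_0_le[OF lim0, of _ 2], rule always_eventually, rule allI)
      show "norm (X n - \<Psi> l) \<le> norm (norm (X n - x)) * 2" for n using tl[of n] t(2)[of n] by simp
    qed
    then have x: "x = \<Psi> l" by (rule LIMSEQ_unique[OF lim])
    have "\<bar>suminf l - 1\<bar> \<le> norm (X n - x)" for n
    proof -
      have sl1: "summable l" using sl l0 by simp
      have st: "summable (t n)" "suminf (t n) = 1" using t(1)[of n] by (auto simp: D_def sums_iff)
      have "\<bar>suminf l - 1\<bar> = \<bar>\<Sum>j. t n j - l j\<bar>" using suminf_diff[OF st(1) sl1] st by simp
      also have "\<dots> \<le> (\<Sum>j. \<bar>t n j - l j\<bar>)" using sl' by (rule summable_rabs)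
      finally show ?thesis using sle[of n] by simp
    qed
    then have "\<bar>suminf l - 1\<bar> \<le> 0" by (intro LIMSEQ_le_const[OF lim0]) auto
    then have "l sums 1" using sl l0 by (simp add: sums_iff)
    then show "x \<in> C" using l0 by (auto simp: C_def D_def x)
  qed
  moreover have "bounded C"
  proof -
    have "norm x \<le> 2" if "x \<in> C" for x using that Psi_le2 D_abs by (force simp: C_def)
    then show ?thesis by (auto simp: bounded_iff)
  qed
  moreover have "convex C"
  proof (rule convexI)
    fix x y and a b :: real assume xy: "x \<in> C" "y \<in> C" and ab: "0 \<le> a" "0 \<le> b" "a + b = 1"
    then obtain t r where tr: "t \<in> D" "r \<in> D" "x = \<Psi> t" "y = \<Psi> r" by (auto simp: C_def)
    have "(\<lambda>j. t j *\<^sub>R e j) sums x" "(\<lambda>j. r j *\<^sub>R e j) sums y"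
      using summable_sums[OF sv[OF D_abs(1)[OF tr(1)]]] summable_sums[OF sv[OF D_abs(1)[OF tr(2)]]] tr(3,4)
      by (simp_all add: \<Psi>_def)
    then have "(\<lambda>j. a *\<^sub>R t j *\<^sub>R e j + b *\<^sub>R r j *\<^sub>R e j) sums (a *\<^sub>R x + b *\<^sub>R y)"
      by (intro sums_add sums_scaleR_right)
    then have "a *\<^sub>R x + b *\<^sub>R y = \<Psi> (\<lambda>j. a * t j + b * r j)"
      by (simp add: \<Psi>_def sums_iff scaleR_add_left)
    moreover have "(\<lambda>j. a * t j + b * r j) \<in> D"
      using tr ab sums_add[OF sums_mult[of t 1 a] sums_mult[of r 1 b]] by (auto simp: D_def)
    ultimately show "a *\<^sub>R x + b *\<^sub>R y \<in> C" by (auto simp: C_def)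
  qed
  moreover have "T \<in> C \<rightarrow> C" using T shD by (auto simp: C_def)
  moreover have "\<forall>x\<in>C. \<forall>y\<in>C. norm (T x - T y) \<le> norm (x - y)"
    using T Psi_sh by (auto simp: C_def)
  moreover have "T x \<noteq> x" if x: "x \<in> C" for x
  proof
    assume "T x = x"
    obtain t where t: "t \<in> D" "x = \<Psi> t" using x by (auto simp: C_def)
    have "sh t = t" using inj_onD[OF inj, of "sh t" t] \<open>T x = x\<close> T t shD by simp
    moreover have "sh t 0 = 0" "sh t (Suc j) = t j" for j by (simp_all add: sh_def)
    ultimately have "t 0 = 0" "t (Suc j) = t j" for j by simp_all
    then have "t j = 0" for j by (induction j) auto
    then have "t = (\<lambda>_. 0)" by auto
    then show False using t(1) sums_unique2[OF sums_zero, of "1::real"] by (auto simp: D_def)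
  qed
  ultimately have "C \<subseteq> Y \<and> C \<noteq> {} \<and> closedin (top_of_set Y) C \<and> bounded C \<and> convex C \<and>
      T \<in> C \<rightarrow> C \<and> (\<forall>x\<in>C. \<forall>y\<in>C. norm (T x - T y) \<le> norm (x - y)) \<and> \<not> (\<exists>x\<in>C. T x = x)"
    by (auto intro: closed_subset)
  then show ?thesis unfolding fixed_point_property_def by blast
qed

text \<open>With \<open>x = (1/2)^j\<close> the weight is \<open>L j = 1 + x\<close> and the next
  one is \<open>1 + x/2\<close>, while imperfect disjointness costs at most the factor
  \<open>1 - x/4\<close>. The inequality \<open>1 + x/2 \<le> (1 + x) * (1 - x/4)\<close> for
  \<open>x \<le> 1\<close> says that the drop of the weights pays for this cost; the bound 1/8 on
  the overlap is made for it.\<close>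

lemma fixed_point_property_imp_equi_int:
  fixes Y :: "'a::euclidean_space L1 set"
  assumes Y: "subspace Y" "closed Y" and fpp: "fixed_point_property Y"
  shows "equi_int {f\<in>Y. norm f \<le> 1}"
proof (rule ccontr)
  assume "\<not> equi_int {f\<in>Y. norm f \<le> 1}"
  then obtain G B where G: "\<And>n::nat. G n \<in> Y" "\<And>n. norm (G n) = 1" and B: "\<And>n. B n \<in> sets I01"
    "disjoint_family B" and th: "\<And>n. norm (G n - restr (B n) (G n)) \<le> (1/8) * (1/2)^n"
    using not_equi_int_almost_disjoint_sequence[OF Y(1)] by blast
  define L :: "nat \<Rightarrow> real" where "L j = 1 + (1/2)^j" for j
  have L: "1 \<le> L j" "L j \<le> 2" for j
    using power_le_one[of "1/2::real" j] by (auto simp: L_def)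
  have nrm: "norm (L j *\<^sub>R G j) = L j" for j using L(1)[of j] G by simp
  have "\<not> fixed_point_property Y"
  proof (rule not_fixed_point_property_shift[OF Y, where e = "\<lambda>j. L j *\<^sub>R G j"])
    fix n :: nat and s :: "nat \<Rightarrow> real"
    have "(\<Sum>j<n. \<bar>s j\<bar> * L (Suc j)) \<le> (\<Sum>j<n. \<bar>s j * L j\<bar> * (norm (G j) - 2 * norm (G j - restr (B j) (G j))))"
    proof (rule sum_mono)
      fix j
      define x :: real where "x = (1/2)^j"
      have x: "0 \<le> x" "x \<le> 1" using power_le_one[of "1/2::real" j] by (auto simp: x_def)
      have "x * x \<le> x" using mult_left_mono[OF x(2) x(1)] by simp
      moreover have "L (Suc j) = 1 + x/2" by (simp add: L_def x_def)
      moreover have "(1 + x) * (1 - x/4) = 1 + 3 * x / 4 - x * x / 4" by (simp add: field_simps)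
      ultimately have "L (Suc j) \<le> (1 + x) * (1 - x/4)" by linarith
      also have "\<dots> \<le> L j * (norm (G j) - 2 * norm (G j - restr (B j) (G j)))"
        using th[of j] x G(2)[of j] by (intro mult_mono) (auto simp: L_def x_def[symmetric])
      finally have "\<bar>s j\<bar> * L (Suc j) \<le> \<bar>s j\<bar> * (L j * (norm (G j) - 2 * norm (G j - restr (B j) (G j))))"
        by (rule mult_left_mono) simp
      then show "\<bar>s j\<bar> * L (Suc j) \<le> \<bar>s j * L j\<bar> * (norm (G j) - 2 * norm (G j - restr (B j) (G j)))"
        using L(1)[of j] by (simp add: abs_mult mult.assoc)
    qed
    also have "\<dots> \<le> norm (\<Sum>j<n. (s j * L j) *\<^sub>R G j)"
      using B by (intro norm_sum_almost_disjoint_ge) (auto simp: disjoint_family_on_def)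
    finally show "(\<Sum>j<n. \<bar>s j\<bar> * norm (L (Suc j) *\<^sub>R G (Suc j))) \<le> norm (\<Sum>j<n. s j *\<^sub>R L j *\<^sub>R G j)"
      unfolding nrm by simp
  qed (use L G Y nrm in \<open>auto intro: subspace_scale\<close>)
  then show False using fpp by simp
qed

section \<open>Reflexivity\<close>

definition ultra :: "'i filter \<Rightarrow> bool" where
  "ultra F \<longleftrightarrow> F \<noteq> bot \<and> (\<forall>P. eventually P F \<or> eventually (\<lambda>x. \<not> P x) F)"

text \<open>Zorn's lemma for proper filters, finer ones counting as larger: a chain is a filter
  base, so its infimum is still proper.\<close>

lemma ultra_exists:
  assumes "F \<noteq> bot" obtains U where "ultra U" "U \<le> F"
proof -
  define \<A> where "\<A> = {G. G \<noteq> bot \<and> G \<le> F}"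
  have "\<exists>m\<in>\<A>. \<forall>a\<in>\<A>. a \<le> m \<longrightarrow> a = m"
  proof (rule predicate_Zorn[where P = "\<lambda>x y. y \<le> x"])
    show "partial_order_on \<A> (relation_of (\<lambda>x y. y \<le> x) \<A>)"
      by (rule partial_order_on_relation_ofI) auto
    fix C assume C: "C \<in> Chains (relation_of (\<lambda>x y. y \<le> x) \<A>)"
    have CA: "C \<subseteq> \<A>" using C by (rule Chains_relation_of)
    show "\<exists>u\<in>\<A>. \<forall>a\<in>C. u \<le> a"
    proof (cases "C = {}")
      case True
      then show ?thesis using assms by (auto simp: \<A>_def)
    next
      case False
      have "eventually P (Inf C) \<longleftrightarrow> (\<exists>b\<in>C. eventually P b)" for P
      proof (rule eventually_Inf_base[OF False])
        fix G H assume GH: "G \<in> C" "H \<in> C"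
        then have "H \<le> G \<or> G \<le> H" using C by (auto simp: Chains_def relation_of_def)
        then show "\<exists>x\<in>C. x \<le> inf G H" using GH by (metis inf_greatest order_refl)
      qed
      then have "Inf C \<noteq> bot"
        using CA unfolding trivial_limit_def by (auto simp: \<A>_def trivial_limit_def)
      moreover have "Inf C \<le> F" using False CA by (auto simp: \<A>_def intro: Inf_lower2)
      ultimately show ?thesis by (intro bexI[of _ "Inf C"]) (auto simp: \<A>_def intro: Inf_lower)
    qed
  qed
  then obtain U where U: "U \<noteq> bot" "U \<le> F" "\<And>G. G \<noteq> bot \<Longrightarrow> G \<le> F \<Longrightarrow> G \<le> U \<Longrightarrow> G = U"
    by (auto simp: \<A>_def)
  have "eventually P U \<or> eventually (\<lambda>x. \<not> P x) U" for P
  proof (cases "inf U (principal {x. P x}) = bot")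
    case True
    then show ?thesis by (simp add: trivial_limit_def eventually_inf_principal)
  next
    case False
    then have "inf U (principal {x. P x}) = U" using U(2) by (intro U(3)) (auto intro: le_infI1)
    then have "U \<le> principal {x. P x}" by (metis inf_le2)
    then show ?thesis by (simp add: le_principal)
  qed
  then show ?thesis using that U by (auto simp: ultra_def)
qed

lemma ultra_not_eventually:
  assumes U: "ultra U" shows "\<not> eventually P U \<longleftrightarrow> eventually (\<lambda>x. \<not> P x) U"
proof
  show "\<not> eventually P U \<Longrightarrow> eventually (\<lambda>x. \<not> P x) U" using U by (auto simp: ultra_def)
  assume not_P: "eventually (\<lambda>x. \<not> P x) U"
  show "\<not> eventually P U"
  proof
    assume "eventually P U"
    with not_P have "eventually (\<lambda>x. False) U" by eventually_elim simp
    then show False using U by (simp add: ultra_def)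
  qed
qed

lemma ultra_tendsto_compact:
  assumes U: "ultra U" and K: "compact K" and ev: "eventually (\<lambda>x. f x \<in> K) U"
  obtains l where "(f \<longlongrightarrow> l) U"
proof -
  have "filtermap f U \<noteq> bot" using U by (simp add: ultra_def filtermap_bot_iff)
  moreover have "eventually (\<lambda>y. y \<in> K) (filtermap f U)" using ev by (simp add: eventually_filtermap)
  ultimately obtain l where l: "inf (nhds l) (filtermap f U) \<noteq> bot"
    using K unfolding compact_filter by blast
  have "eventually (\<lambda>x. f x \<in> S) U" if S: "open S" "l \<in> S" for S
  proof (rule ccontr)
    assume "\<not> eventually (\<lambda>x. f x \<in> S) U"
    then have "eventually (\<lambda>y. y \<notin> S) (filtermap f U)"
      using ultra_not_eventually[OF U] by (simp add: eventually_filtermap)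
    moreover have "eventually (\<lambda>y. y \<in> S) (nhds l)" using S by (rule eventually_nhds_in_open)
    ultimately have "eventually (\<lambda>y. False) (inf (nhds l) (filtermap f U))"
      unfolding eventually_inf by (intro exI[of _ "\<lambda>y. y \<in> S"] exI[of _ "\<lambda>y. y \<notin> S"]) auto
    then show False using l by (simp add: trivial_limit_def)
  qed
  then show ?thesis using that by (auto simp: tendsto_def)
qed

section \<open>Functionals given by bounded multipliers, and the step from reflexivity to uniform
  integrability\<close>

lemma AE_rep_scale: "AE x in I01. rep_L1 (scale_L1 c f) x = c * rep_L1 f x"
  using AE_rep_abs_L1[of "\<lambda>x. c * rep_L1 f x"] scale_L1.abs_eq[of "rep_L1 f" c]
  by simp

lemma norm_scale_L1: "norm (scale_L1 c f) = norm c * norm f"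
  by transfer (simp add: norm_mult)

lemma L1_subspace_imp_subspace:
  fixes Y :: "'a::{real_normed_field, banach, second_countable_topology} L1 set"
  assumes "L1.subspace Y" shows "subspace Y"
  using assms L1.subspace_scale[OF assms]
  by (auto simp: L1.subspace_def subspace_def scaleR_L1_eq_scale_L1)

text \<open>There is no conjugation, so that the functional is linear over either scalar
  field.\<close>

definition pairing :: "(real \<Rightarrow> 'a) \<Rightarrow> 'a::{real_normed_field, banach, second_countable_topology} L1 \<Rightarrow> 'a" where
  "pairing h f = (\<integral>x. h x * rep_L1 f x \<partial>I01)"

context
  fixes h :: "real \<Rightarrow> 'a::{real_normed_field, banach, second_countable_topology}"
  assumes h [measurable]: "h \<in> borel_measurable I01" and h1: "\<And>x. norm (h x) \<le> 1"
begin

lemma integrable_pairing: "integrable I01 (\<lambda>x. h x * rep_L1 f x)"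
  by (rule Bochner_Integration.integrable_bound[of _ "rep_L1 f"])
    (auto simp: norm_mult intro!: mult_left_le_one_le h1)

lemma pairing_add: "pairing h (f + g) = pairing h f + pairing h g"
proof -
  have "pairing h (f + g) = (\<integral>x. h x * rep_L1 f x + h x * rep_L1 g x \<partial>I01)"
    unfolding pairing_def
  proof (rule integral_cong_AE)
    show "AE x in I01. h x * rep_L1 (f + g) x = h x * rep_L1 f x + h x * rep_L1 g x"
      using AE_rep_add[of f g] by eventually_elim (simp add: distrib_left)
  qed auto
  then show ?thesis unfolding pairing_def
    by (simp add: Bochner_Integration.integral_add integrable_pairing)
qed

lemma pairing_scale: "pairing h (scale_L1 c f) = c * pairing h f"
proof -
  have "pairing h (scale_L1 c f) = (\<integral>x. c * (h x * rep_L1 f x) \<partial>I01)"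
    unfolding pairing_def
  proof (rule integral_cong_AE)
    show "AE x in I01. h x * rep_L1 (scale_L1 c f) x = c * (h x * rep_L1 f x)"
      using AE_rep_scale[of c f] by eventually_elim simp
  qed auto
  then show ?thesis by (simp add: pairing_def)
qed

lemma norm_pairing_le: "norm (pairing h f) \<le> norm f"
proof -
  have "norm (pairing h f) \<le> (\<integral>x. norm (h x * rep_L1 f x) \<partial>I01)"
    unfolding pairing_def by (rule integral_norm_bound)
  also have "\<dots> \<le> norm f"
    unfolding norm_L1_eq using integrable_pairing
    by (intro Bochner_Integration.integral_mono integrable_norm)
      (auto simp: norm_mult intro!: mult_left_le_one_le h1)
  finally show ?thesis .
qed

lemma pairing_in_dual:
  assumes "L1.subspace Y"
  shows "(\<lambda>y. if y \<in> Y then pairing h y else 0) \<in> dual_space scale_L1 norm Y"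
  using assms
  by (auto simp: dual_space_def L1.subspace_add L1.subspace_scale pairing_add pairing_scale
      intro!: exI[of _ 1] norm_pairing_le)

end

lemma dual_norm_bdd:
  assumes "\<phi> \<in> dual_space s norm V"
  shows "bdd_above ((\<lambda>x. norm (\<phi> x)) ` {x\<in>V. norm x \<le> 1})"
proof -
  obtain K where K: "\<And>x. x \<in> V \<Longrightarrow> norm (\<phi> x) \<le> K * norm x"
    using assms unfolding dual_space_def by blast
  have "norm (\<phi> x) \<le> \<bar>K\<bar>" if "x \<in> V" "norm x \<le> 1" for x
  proof -
    have "norm (\<phi> x) \<le> \<bar>K\<bar> * norm x" 
      using K[OF that(1)] mult_right_mono[OF abs_ge_self[of K], of "norm x"] by simp
    also have "\<dots> \<le> \<bar>K\<bar> * 1" using that by (intro mult_left_mono) auto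
    finally show ?thesis by simp
  qed
  then show ?thesis by (auto intro!: bdd_aboveI[of _ "\<bar>K\<bar>"])
qed

lemma dual_norm_upper:
  assumes "\<phi> \<in> dual_space s norm V" "x \<in> V" "norm x \<le> 1"
  shows "norm (\<phi> x) \<le> dual_norm norm V \<phi>"
  unfolding dual_norm_def using dual_norm_bdd[OF assms(1)] assms(2,3) by (intro cSUP_upper) auto

lemma dual_add:
  assumes "\<phi> \<in> dual_space s N V" "\<psi> \<in> dual_space s N V"
  shows "\<phi> + \<psi> \<in> dual_space s N V"
proof -
  obtain K where K: "\<And>x. x \<in> V \<Longrightarrow> norm (\<phi> x) \<le> K * N x"
    using assms(1) unfolding dual_space_def by blast
  obtain L where L: "\<And>x. x \<in> V \<Longrightarrow> norm (\<psi> x) \<le> L * N x"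
    using assms(2) unfolding dual_space_def by blast
  have "norm (\<phi> x + \<psi> x) \<le> (K + L) * N x" if "x \<in> V" for x
    using norm_triangle_ineq[of "\<phi> x" "\<psi> x"] K[OF that] L[OF that] by (simp add: distrib_right)
  then have "\<exists>K. \<forall>x\<in>V. norm (\<phi> x + \<psi> x) \<le> K * N x" by blast
  then show ?thesis
    using assms by (simp add: dual_space_def plus_fun_def distrib_left add.commute add.left_commute)
qed

lemma dual_scale:
  assumes "\<phi> \<in> dual_space s N V"
  shows "(\<lambda>x. c * \<phi> x) \<in> dual_space s N V"
proof -
  obtain K where K: "\<And>x. x \<in> V \<Longrightarrow> norm (\<phi> x) \<le> K * N x"
    using assms unfolding dual_space_def by blast
  have "norm (c * \<phi> x) \<le> (norm c * K) * N x" if "x \<in> V" for x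
    using mult_left_mono[OF K[OF that], of "norm c"] by (simp add: norm_mult mult.assoc)
  then have "\<exists>K. \<forall>x\<in>V. norm (c * \<phi> x) \<le> K * N x" by blast
  then show ?thesis
    using assms by (simp add: dual_space_def distrib_left mult.left_commute)
qed

lemma zero_in_dual: "(\<lambda>x. 0) \<in> dual_space s N V"
  by (auto simp: dual_space_def intro!: exI[of _ 0])

text \<open>Were the limit functional the evaluation at some \<open>k\<close> in \<open>Y\<close>,
  it would act on bounded multipliers as countably additively as integration against
  \<open>k\<close>. But the phase function \<open>g\<close> of all the disjoint supports gives 1,
  whereas its restriction \<open>gm m\<close> to the first \<open>m\<close> supports gives 0 for
  every \<open>m\<close>.\<close>

lemma reflexive_imp_equi_int:
  fixes Y :: "'a::{real_normed_field, euclidean_space} L1 set"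
  assumes Y: "L1.subspace Y" and rfx: "reflexive_space scale_L1 norm Y"
  shows "equi_int {f\<in>Y. norm f \<le> 1}"
proof (rule ccontr)
  assume "\<not> equi_int {f\<in>Y. norm f \<le> 1}"
  then obtain G B where G: "\<And>n::nat. G n \<in> Y" "\<And>n. norm (G n) = 1" and B: "\<And>n. B n \<in> sets I01"
    "disjoint_family B" and th: "\<And>n. norm (G n - restr (B n) (G n)) \<le> (1/8) * (1/2)^n"
    using not_equi_int_almost_disjoint_sequence[OF L1_subspace_imp_subspace[OF Y]] by blast
  obtain U :: "nat filter" where U: "ultra U" "U \<le> sequentially"
    using ultra_exists[of sequentially] by auto
  have Ubot: "U \<noteq> bot" using U by (simp add: ultra_def)
  let ?D = "dual_space scale_L1 norm Y"
  define \<Phi> where "\<Phi> \<phi> = (if \<phi> \<in> ?D then Lim U (\<lambda>j. \<phi> (G j)) else 0)" for \<phi> :: "'a L1 \<Rightarrow> 'a"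
  have bnd: "norm (\<phi> (G j)) \<le> dual_norm norm Y \<phi>" if "\<phi> \<in> ?D" for \<phi> j
    using dual_norm_upper[OF that G(1)] G(2) by simp
  have lim: "((\<lambda>j. \<phi> (G j)) \<longlongrightarrow> \<Phi> \<phi>) U" if phi: "\<phi> \<in> ?D" for \<phi>
  proof -
    have "\<forall>\<^sub>F j in U. \<phi> (G j) \<in> cball 0 (dual_norm norm Y \<phi>)" using bnd[OF phi] by simp
    then obtain l where l: "((\<lambda>j. \<phi> (G j)) \<longlongrightarrow> l) U"
      by (rule ultra_tendsto_compact[OF U(1) compact_cball])
    show ?thesis using l tendsto_Lim[OF Ubot l] phi by (simp add: \<Phi>_def)
  qed
  have "\<Phi> \<in> bidual_space scale_L1 norm Y"
    unfolding bidual_space_def dual_space_def[of "\<lambda>c \<phi> x. c * \<phi> x"]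
  proof (intro CollectI conjI ballI allI impI)
    fix \<phi> \<psi> assume d: "\<phi> \<in> ?D" "\<psi> \<in> ?D"
    have "((\<lambda>j. (\<phi> + \<psi>) (G j)) \<longlongrightarrow> \<Phi> \<phi> + \<Phi> \<psi>) U"
      using tendsto_add[OF lim[OF d(1)] lim[OF d(2)]] by (simp add: plus_fun_def)
    then show "\<Phi> (\<phi> + \<psi>) = \<Phi> \<phi> + \<Phi> \<psi>"
      by (rule tendsto_unique[OF Ubot lim[OF dual_add[OF d]]])
  next
    fix c and \<phi> :: "'a L1 \<Rightarrow> 'a" assume d: "\<phi> \<in> ?D"
    show "\<Phi> (\<lambda>x. c * \<phi> x) = c * \<Phi> \<phi>"
      by (rule tendsto_unique[OF Ubot lim[OF dual_scale[OF d, of c]] tendsto_mult_left[OF lim[OF d], of c]])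
  next
    show "\<exists>K. \<forall>\<phi>\<in>?D. norm (\<Phi> \<phi>) \<le> K * dual_norm norm Y \<phi>"
    proof (intro exI[of _ 1] ballI)
      fix \<phi> assume d: "\<phi> \<in> ?D"
      show "norm (\<Phi> \<phi>) \<le> 1 * dual_norm norm Y \<phi>"
        using tendsto_upperbound[OF tendsto_norm[OF lim[OF d]] _ Ubot] bnd[OF d] by simp
    qed
  qed (auto simp: \<Phi>_def)
  then obtain k where k: "k \<in> Y" "\<Phi> = canonical_embedding scale_L1 norm Y k"
    using rfx unfolding reflexive_space_def by blast
  have lim_pairing: "((\<lambda>j. pairing h (G j)) \<longlongrightarrow> pairing h k) U"
    if "h \<in> borel_measurable I01" "\<And>x. norm (h x) \<le> 1" for h :: "real \<Rightarrow> 'a"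
  proof -
    let ?\<phi> = "\<lambda>y. if y \<in> Y then pairing h y else 0"
    have "?\<phi> \<in> ?D" using pairing_in_dual[OF that Y] by simp
    from lim[OF this] this show ?thesis using k G(1) by (simp add: canonical_embedding_def)
  qed
  \<comment> \<open>The conjugate phase of \<open>G j\<close> on \<open>B j\<close>, with
    \<open>0 / 0 = 0\<close> where \<open>G j\<close> vanishes; its product with \<open>G j\<close>
    is the modulus there.\<close>
  define f where "f j x = indicator (B j) x *\<^sub>R (of_real (norm (rep_L1 (G j) x)) / rep_L1 (G j) x)" for j x
  have [measurable]: "f j \<in> borel_measurable I01" for j
    unfolding f_def using B(1)[of j] by measurable
  have f1: "norm (f j x) \<le> 1" for j x
    by (auto simp: f_def indicator_def norm_divide)
  have f0: "x \<notin> B j \<Longrightarrow> f j x = 0" for j x by (simp add: f_def)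
  have Bu: "x \<in> B i \<Longrightarrow> x \<in> B j \<Longrightarrow> i = j" for x i j
    using B(2) by (auto simp: disjoint_family_on_def)
  define g where "g x = (\<Sum>j. f j x)" for x
  define gm where "gm m x = (\<Sum>j<m. f j x)" for m x
  have f_eq: "f j x = (if j = i then f i x else 0)" if x: "x \<in> B i" for x i j
    using Bu[OF x, of j] f0[of x j] by auto
  have g_eq: "g x = f i x" if x: "x \<in> B i" for x i
  proof -
    have "(\<lambda>j. f j x) = (\<lambda>j. if j = i then f i x else 0)"
      by (rule ext) (rule f_eq[OF x])
    then have "(\<lambda>j. f j x) sums f i x"
      using sums_single[of i "\<lambda>_. f i x"] by (simp only:)
    then show ?thesis unfolding g_def by (rule sums_unique[symmetric])
  qed
  have gm_eq: "gm m x = (if i < m then f i x else 0)" if x: "x \<in> B i" for x i m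
  proof -
    have "gm m x = (\<Sum>j<m. if j = i then f i x else 0)"
      unfolding gm_def
    proof (rule sum.cong[OF refl])
      fix j show "f j x = (if j = i then f i x else 0)" by (rule f_eq[OF x])
    qed
    then show ?thesis by simp
  qed
  have none: "g x = 0" "gm m x = 0" if "\<And>j. x \<notin> B j" for x m
    using that f0 by (simp_all add: g_def gm_def)
  have [measurable]: "g \<in> borel_measurable I01" "gm m \<in> borel_measurable I01" for m
    unfolding g_def gm_def by measurable
  have g1: "norm (g x) \<le> 1" and gm1: "norm (gm m x) \<le> 1" for x m
  proof -
    have "norm (g x) \<le> 1 \<and> norm (gm m x) \<le> 1"
    proof (cases "\<exists>i. x \<in> B i")
      case True
      then obtain i where "x \<in> B i" ..
      then show ?thesis using f1[of i x] by (simp add: g_eq gm_eq)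
    next
      case False
      then show ?thesis using none by simp
    qed
    then show "norm (g x) \<le> 1" "norm (gm m x) \<le> 1" by auto
  qed
  have th0: "(\<lambda>j. c * norm (G j - restr (B j) (G j))) \<longlonglongrightarrow> 0" for c
  proof -
    have "(\<lambda>n. norm (G n - restr (B n) (G n))) \<longlonglongrightarrow> 0"
    proof (rule tendsto_sandwich[OF _ _ tendsto_const])
      show "(\<lambda>n. (1/8) * (1/2::real)^n) \<longlonglongrightarrow> 0"
        by (intro tendsto_mult_right_zero LIMSEQ_realpow_zero) auto
    qed (use th in auto)
    then show ?thesis by (rule tendsto_mult_right_zero)
  qed
  have split: "pairing h (G j) = pairing h (restr (B j) (G j)) + pairing h (G j - restr (B j) (G j))"
    if "h \<in> borel_measurable I01" "\<And>x. norm (h x) \<le> 1" for h :: "real \<Rightarrow> 'a" and j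
    using pairing_add[OF that, of "restr (B j) (G j)" "G j - restr (B j) (G j)"] by simp
  have "pairing g (restr (B j) (G j)) = of_real (norm (restr (B j) (G j)))" for j
  proof -
    have "pairing g (restr (B j) (G j)) = (\<integral>x. of_real (indicator (B j) x * norm (rep_L1 (G j) x)) \<partial>I01)"
      unfolding pairing_def
    proof (rule integral_cong_AE)
      show "AE x in I01. g x * rep_L1 (restr (B j) (G j)) x = of_real (indicator (B j) x * norm (rep_L1 (G j) x))"
        using AE_rep_restr[OF B(1), of j "G j"]
        by eventually_elim (auto simp: indicator_def g_eq f_def)
    qed (use B(1)[of j] in measurable)
    then show ?thesis
      unfolding norm_restr[OF B(1)]
      using integral_bounded_linear[OF bounded_linear_of_real integrable_restr[OF B(1)]] by simp
  qed
  note pg = this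
  have "norm (pairing g (G j) - 1) \<le> 2 * norm (G j - restr (B j) (G j))" for j
  proof -
    have "norm (restr (B j) (G j)) = 1 - norm (G j - restr (B j) (G j))"
      using norm_restr_split[OF B(1)[of j], of "G j"] G(2) by simp
    then have "pairing g (G j) - 1 = pairing g (G j - restr (B j) (G j)) - of_real (norm (G j - restr (B j) (G j)))"
      using split[of g j] g1 pg[of j] by simp
    then show ?thesis
      using norm_triangle_ineq4[of "pairing g (G j - restr (B j) (G j))" "of_real (norm (G j - restr (B j) (G j)))"]
        norm_pairing_le[of g "G j - restr (B j) (G j)"] g1 by simp
  qed
  then have "(\<lambda>j. pairing g (G j)) \<longlonglongrightarrow> 1"
    by (intro LIM_zero_cancel[of _ 1] Lim_null_comparison[OF _ th0[of 2]]) simp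
  then have "((\<lambda>j. pairing g (G j)) \<longlongrightarrow> 1) U" using U(2) by (rule tendsto_mono[rotated])
  then have g_k: "pairing g k = 1"
    by (rule tendsto_unique[OF Ubot lim_pairing[OF _ g1], rotated]) simp
  have gm_k: "pairing (gm m) k = 0" for m
  proof -
    have "norm (pairing (gm m) (G j)) \<le> 1 * norm (G j - restr (B j) (G j))" if "j \<ge> m" for j
    proof -
      have "pairing (gm m) (restr (B j) (G j)) = (\<integral>x. 0 \<partial>I01)"
        unfolding pairing_def
      proof (rule integral_cong_AE)
        show "AE x in I01. gm m x * rep_L1 (restr (B j) (G j)) x = 0"
          using AE_rep_restr[OF B(1), of j "G j"]
          by eventually_elim (use that in \<open>auto simp: indicator_def gm_eq\<close>)
      qed auto
      then show ?thesis
        using split[of "gm m" j] gm1 norm_pairing_le[of "gm m" "G j - restr (B j) (G j)"] by simp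
    qed
    then have "(\<lambda>j. pairing (gm m) (G j)) \<longlonglongrightarrow> 0"
      by (intro Lim_null_comparison[OF _ th0[of 1]]) (auto simp: eventually_sequentially)
    then have "((\<lambda>j. pairing (gm m) (G j)) \<longlongrightarrow> 0) U" using U(2) by (rule tendsto_mono[rotated])
    then show ?thesis
      by (rule tendsto_unique[OF Ubot lim_pairing[OF _ gm1], rotated]) simp
  qed
  have "(\<lambda>m. pairing (gm m) k) \<longlonglongrightarrow> pairing g k"
    unfolding pairing_def
  proof (rule integral_dominated_convergence[where w = "\<lambda>x. norm (rep_L1 k x)"])
    show "AE x in I01. (\<lambda>m. gm m x * rep_L1 k x) \<longlonglongrightarrow> g x * rep_L1 k x"
    proof (rule AE_I2)
      fix x
      have "(\<lambda>m. gm m x) \<longlonglongrightarrow> g x"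
      proof (cases "\<exists>i. x \<in> B i")
        case True
        then obtain i where "x \<in> B i" ..
        then show ?thesis
          by (intro tendsto_eventually)
            (auto simp: eventually_sequentially g_eq gm_eq intro!: exI[of _ "Suc i"])
      next
        case False
        then show ?thesis using none by simp
      qed
      then show "(\<lambda>m. gm m x * rep_L1 k x) \<longlonglongrightarrow> g x * rep_L1 k x" by (intro tendsto_intros)
    qed
    show "AE x in I01. norm (gm m x * rep_L1 k x) \<le> norm (rep_L1 k x)" for m
      by (auto simp: norm_mult intro!: mult_left_le_one_le gm1)
  qed auto
  then show False by (simp add: g_k gm_k LIMSEQ_const_iff)
qed


section \<open>The scalar field as a real inner product space, and Helly's lemma\<close>

definition field_cnj :: "'a::real_normed_field \<Rightarrow> 'a" where
  "field_cnj w = of_real ((norm w)\<^sup>2) * inverse w"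

text \<open>Multiplicativity of the norm, carried over to the inner product by polarisation.\<close>

lemma inner_mult_left_isometry:
  fixes c :: "'a::{real_normed_field, real_inner}"
  shows "(c * x) \<bullet> (c * y) = (norm c)\<^sup>2 * (x \<bullet> y)"
  unfolding dot_norm distrib_left[symmetric] norm_mult power_mult_distrib
  by (simp add: field_simps)

text \<open>For both fields at hand \<open>field_cnj\<close> is conjugation, with value 0 at 0, and
  \<open>1 \<bullet> x\<close> is the real part. Multiplying both arguments by the conjugate of
  \<open>w\<close> scales the inner product by \<open>(norm w)\<^sup>2\<close> and turns
  \<open>w\<close> itself into that real number.\<close>

lemma inner_field_cnj:
  fixes w :: "'a::{real_normed_field, real_inner}"
  shows "w \<bullet> a = 1 \<bullet> (field_cnj w * a)"
proof (cases "w = 0")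
  case False
  have "(norm w)\<^sup>2 * (w \<bullet> a) = (field_cnj w * w) \<bullet> (field_cnj w * a)"
    using False by (simp add: inner_mult_left_isometry field_cnj_def norm_mult norm_inverse power2_eq_square)
  also have "field_cnj w * w = (norm w)\<^sup>2 *\<^sub>R 1"
    using False by (simp add: field_cnj_def scaleR_conv_of_real)
  finally show ?thesis using False by simp
qed (simp add: field_cnj_def)

lemma inner_one_le_norm:
  fixes x :: "'a::{real_normed_field, real_inner}"
  shows "\<bar>1 \<bullet> x\<bar> \<le> norm x"
  using Cauchy_Schwarz_ineq2[of 1 x] by simp

text \<open>Converts bounds on the real part of a functional over a balanced set into bounds on its
  modulus. At \<open>z = 0\<close> the quotient by the norm is 0, whence only
  \<open>norm c \<le> 1\<close>.\<close>

lemma unimodular_rotation: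
  fixes z :: "'a::{real_normed_field, real_inner}"
  obtains c where "norm c \<le> 1" "1 \<bullet> (c * z) = norm z"
proof (rule that[of "field_cnj z / of_real (norm z)"])
  show "norm (field_cnj z / of_real (norm z)) \<le> 1"
    by (cases "z = 0") (simp_all add: field_cnj_def norm_mult norm_divide norm_inverse power2_eq_square)
  have "1 \<bullet> (field_cnj z / of_real (norm z) * z) = 1 \<bullet> (inverse (norm z) *\<^sub>R (field_cnj z * z))"
    by (simp add: divide_inverse scaleR_conv_of_real ac_simps)
  also have "\<dots> = inverse (norm z) * (z \<bullet> z)" by (simp add: inner_field_cnj[of z z])
  also have "\<dots> = norm z"
    by (cases "z = 0") (simp_all add: power2_norm_eq_inner[symmetric] power2_eq_square)
  finally show "1 \<bullet> (field_cnj z / of_real (norm z) * z) = norm z" .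
qed

context
  fixes \<Phi> :: "('v::plus \<Rightarrow> 'k::real_normed_field) \<Rightarrow> 'k" and s N V
  assumes \<Phi>: "\<Phi> \<in> bidual_space s N V"
begin

lemma bidual_add:
  "\<phi> \<in> dual_space s N V \<Longrightarrow> \<psi> \<in> dual_space s N V \<Longrightarrow> \<Phi> (\<phi> + \<psi>) = \<Phi> \<phi> + \<Phi> \<psi>"
  using \<Phi> by (simp add: bidual_space_def dual_space_def[of "\<lambda>c \<phi> x. c * \<phi> x"])

lemma bidual_scale: "\<phi> \<in> dual_space s N V \<Longrightarrow> \<Phi> (\<lambda>x. c * \<phi> x) = c * \<Phi> \<phi>"
  using \<Phi> by (simp add: bidual_space_def dual_space_def[of "\<lambda>c \<phi> x. c * \<phi> x"])

lemma bidual_outside: "\<phi> \<notin> dual_space s N V \<Longrightarrow> \<Phi> \<phi> = 0"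
  using \<Phi> by (simp add: bidual_space_def dual_space_def[of "\<lambda>c \<phi> x. c * \<phi> x"])

end

lemma dual_sum:
  fixes \<Phi> :: "('v::plus \<Rightarrow> 'k::real_normed_field) \<Rightarrow> 'k"
  assumes \<Phi>: "\<Phi> \<in> bidual_space s N V" and F: "finite F" "F \<subseteq> dual_space s N V"
  shows "(\<lambda>x. \<Sum>\<phi>\<in>F. c \<phi> * \<phi> x) \<in> dual_space s N V \<and>
    \<Phi> (\<lambda>x. \<Sum>\<phi>\<in>F. c \<phi> * \<phi> x) = (\<Sum>\<phi>\<in>F. c \<phi> * \<Phi> \<phi>)"
  using F
proof (induction F)
  case empty
  have "\<Phi> (\<lambda>x. 0 * 0) = 0 * \<Phi> (\<lambda>x. 0)"
    by (rule bidual_scale[OF \<Phi> zero_in_dual])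
  then show ?case using zero_in_dual[of s N V] by simp
next
  case (insert \<phi> F)
  have eq: "(\<lambda>x. \<Sum>\<phi>\<in>insert \<phi> F. c \<phi> * \<phi> x) = (\<lambda>x. c \<phi> * \<phi> x) + (\<lambda>x. \<Sum>\<phi>\<in>F. c \<phi> * \<phi> x)"
    using insert.hyps by (simp add: plus_fun_def)
  have d: "(\<lambda>x. c \<phi> * \<phi> x) \<in> dual_space s N V" "(\<lambda>x. \<Sum>\<phi>\<in>F. c \<phi> * \<phi> x) \<in> dual_space s N V"
    using insert by (auto intro: dual_scale)
  have "\<Phi> ((\<lambda>x. c \<phi> * \<phi> x) + (\<lambda>x. \<Sum>\<phi>\<in>F. c \<phi> * \<phi> x)) = \<Phi> (\<lambda>x. c \<phi> * \<phi> x) + \<Phi> (\<lambda>x. \<Sum>\<phi>\<in>F. c \<phi> * \<phi> x)"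
    by (rule bidual_add[OF \<Phi> d])
  moreover have "\<Phi> (\<lambda>x. c \<phi> * \<phi> x) = c \<phi> * \<Phi> \<phi>"
    using insert.prems by (intro bidual_scale[OF \<Phi>]) auto
  ultimately show ?case
    unfolding eq using dual_add[OF d] insert by simp
qed

text \<open>At a near-minimiser of the squared distance, the first-order condition bounds the distance by the
  amount by which \<open>\<Phi>\<close> exceeds its norm bound, that is, by almost 0.\<close>

lemma Helly:
  fixes Y :: "'a::{real_normed_field, euclidean_space} L1 set"
  assumes Y: "L1.subspace Y" and \<Phi>: "\<Phi> \<in> bidual_space scale_L1 norm Y"
    and K: "K > 0" "\<And>\<phi>. \<phi> \<in> dual_space scale_L1 norm Y \<Longrightarrow> norm (\<Phi> \<phi>) \<le> K * dual_norm norm Y \<phi>"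
    and F: "finite F" "F \<subseteq> dual_space scale_L1 norm Y" and \<epsilon>: "\<epsilon> > 0"
  shows "\<exists>y\<in>Y. norm y \<le> K \<and> (\<forall>\<phi>\<in>F. norm (\<phi> y - \<Phi> \<phi>) \<le> \<epsilon>)"
proof -
  note Ys = L1_subspace_imp_subspace[OF Y]
  let ?D = "dual_space scale_L1 norm Y"
  define W where "W = {y\<in>Y. norm y \<le> K}"
  define q where "q y = (\<Sum>\<phi>\<in>F. (norm (\<Phi> \<phi> - \<phi> y))\<^sup>2)" for y
  have "0 \<in> W" using subspace_0[OF Ys] K by (simp add: W_def)
  then have W0: "W \<noteq> {}" by blast
  have "W = Y \<inter> cball 0 K" by (auto simp: W_def)
  then have cW: "convex W" using Ys by (simp add: convex_Int subspace_imp_convex)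
  have add: "\<phi> (x + y) = \<phi> x + \<phi> y" if "\<phi> \<in> ?D" "x \<in> Y" "y \<in> Y" for \<phi> x y
    using that by (simp add: dual_space_def)
  have scale: "\<phi> (scale_L1 c x) = c * \<phi> x" if "\<phi> \<in> ?D" "x \<in> Y" for \<phi> c x
    using that by (simp add: dual_space_def)
  have scaleR: "\<phi> (r *\<^sub>R x) = r *\<^sub>R \<phi> x" if "\<phi> \<in> ?D" "x \<in> Y" for \<phi> r x
    using scale[OF that] by (simp add: scaleR_L1_eq_scale_L1 scaleR_conv_of_real)
  have diff: "\<phi> (x - y) = \<phi> x - \<phi> y" if "\<phi> \<in> ?D" "x \<in> Y" "y \<in> Y" for \<phi> x y
    using add[OF that(1,2), of "(-1) *\<^sub>R y"] scaleR[OF that(1,3), of "-1"] that Ys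
    by (simp add: subspace_neg)
  \<comment> \<open>Bounds the quadratic term of \<open>q\<close> along every segment inside
    \<open>W\<close>.\<close>
  define M where "M = (\<Sum>\<phi>\<in>F. (2 * K * dual_norm norm Y \<phi>)\<^sup>2)"
  have M0: "M \<ge> 0" by (simp add: M_def sum_nonneg)
  have bnd: "norm (\<phi> x) \<le> K * dual_norm norm Y \<phi>" if "\<phi> \<in> ?D" "x \<in> W" for \<phi> x
  proof -
    have "norm (\<phi> ((1/K) *\<^sub>R x)) \<le> dual_norm norm Y \<phi>"
      using that K Ys by (intro dual_norm_upper) (auto simp: W_def subspace_scale)
    then show ?thesis using that scaleR[OF that(1), of x "1/K"] K
      by (simp add: W_def field_simps)
  qed
  have M: "(\<Sum>\<phi>\<in>F. (norm (\<phi> (x - y)))\<^sup>2) \<le> M" if "x \<in> W" "y \<in> W" for x y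
    unfolding M_def
  proof (intro sum_mono power_mono)
    fix \<phi> assume "\<phi> \<in> F"
    then have d: "\<phi> \<in> ?D" using F by auto
    show "norm (\<phi> (x - y)) \<le> 2 * K * dual_norm norm Y \<phi>"
      using diff[OF d, of x y] that bnd[OF d that(1)] bnd[OF d that(2)]
        norm_triangle_ineq4[of "\<phi> x" "\<phi> y"] by (simp add: W_def)
  qed simp
  \<comment> \<open>Minimality up to \<open>t\<^sup>2\<close>, tested with step length
    \<open>t\<close>, yields the first-order condition up to \<open>t * (1 + M) / 2\<close>, and
    this is to be at most \<open>\<epsilon>\<^sup>2 / 2\<close>.\<close>
  define t where "t = min 1 (\<epsilon>\<^sup>2 / (1 + M))"
  have t: "t > 0" "t \<le> 1" "t * (1 + M) \<le> \<epsilon>\<^sup>2"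
  proof -
    show "t > 0" "t \<le> 1" using \<epsilon> M0 by (auto simp: t_def)
    have "t \<le> \<epsilon>\<^sup>2 / (1 + M)" by (simp add: t_def)
    then show "t * (1 + M) \<le> \<epsilon>\<^sup>2" using M0 by (simp add: field_simps)
  qed
  have bq: "bdd_below (q ` W)" by (intro bdd_belowI[of _ 0]) (auto simp: q_def sum_nonneg)
  have "(INF y\<in>W. q y) < (INF y\<in>W. q y) + t\<^sup>2" using t by simp
  then obtain y where y: "y \<in> W" "q y < (INF y\<in>W. q y) + t\<^sup>2"
    using cINF_less_iff[OF W0 bq] by blast
  have near: "q y \<le> q z + t\<^sup>2" if "z \<in> W" for z using cINF_lower[OF bq that] y by linarith
  have yY: "y \<in> Y" using y by (simp add: W_def)
  define w where "w \<phi> = \<Phi> \<phi> - \<phi> y" for \<phi>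
  \<comment> \<open>The real part of this functional is minus half the derivative of
    \<open>q\<close> at \<open>y\<close>.\<close>
  define \<psi> where "\<psi> = (\<lambda>x. \<Sum>\<phi>\<in>F. field_cnj (w \<phi>) * \<phi> x)"
  have psi: "\<psi> \<in> ?D" and Psi: "\<Phi> \<psi> = (\<Sum>\<phi>\<in>F. field_cnj (w \<phi>) * \<Phi> \<phi>)"
    using dual_sum[OF \<Phi> F, of "\<lambda>\<phi>. field_cnj (w \<phi>)"] by (auto simp: \<psi>_def)
  have in_psi: "(\<Sum>\<phi>\<in>F. w \<phi> \<bullet> \<phi> x) = 1 \<bullet> \<psi> x" for x
    unfolding \<psi>_def inner_sum_right by (intro sum.cong refl inner_field_cnj)
  have opt: "1 \<bullet> \<psi> z \<le> 1 \<bullet> \<psi> y + \<epsilon>\<^sup>2 / 2" if z: "z \<in> W" for z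
  proof -
    have zY: "z \<in> Y" using z by (simp add: W_def)
    let ?d = "z - y"
    have dY: "?d \<in> Y" using Ys zY yY by (rule subspace_diff)
    have "(1 - t) *\<^sub>R y + t *\<^sub>R z \<in> W" using cW y z t by (intro convexD) auto
    then have yt: "y + t *\<^sub>R ?d \<in> W" by (simp add: algebra_simps)
    have "q (y + t *\<^sub>R ?d) = (\<Sum>\<phi>\<in>F. (norm (w \<phi>))\<^sup>2 - 2 * t * (w \<phi> \<bullet> \<phi> ?d) + t\<^sup>2 * (norm (\<phi> ?d))\<^sup>2)"
      unfolding q_def
    proof (rule sum.cong)
      fix \<phi> assume "\<phi> \<in> F"
      then have d: "\<phi> \<in> ?D" using F by auto
      have sq: "(norm (a - t *\<^sub>R b))\<^sup>2 = (norm a)\<^sup>2 - 2 * t * (a \<bullet> b) + t\<^sup>2 * (norm b)\<^sup>2" for a b :: 'a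
        unfolding power2_norm_eq_inner
        by (simp add: inner_diff_left inner_diff_right inner_commute power2_eq_square algebra_simps)
      have "\<Phi> \<phi> - \<phi> (y + t *\<^sub>R ?d) = w \<phi> - t *\<^sub>R \<phi> ?d"
        using add[OF d yY, of "t *\<^sub>R ?d"] scaleR[OF d dY] dY Ys by (simp add: w_def subspace_scale)
      then show "(norm (\<Phi> \<phi> - \<phi> (y + t *\<^sub>R ?d)))\<^sup>2 = (norm (w \<phi>))\<^sup>2 - 2 * t * (w \<phi> \<bullet> \<phi> ?d) + t\<^sup>2 * (norm (\<phi> ?d))\<^sup>2"
        by (simp only: sq)
    qed simp
    also have "\<dots> = q y - 2 * t * (1 \<bullet> \<psi> ?d) + t\<^sup>2 * (\<Sum>\<phi>\<in>F. (norm (\<phi> ?d))\<^sup>2)"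
      unfolding in_psi[symmetric] by (simp add: q_def w_def sum.distrib sum_subtractf sum_distrib_left)
    also have "\<dots> \<le> q y - 2 * t * (1 \<bullet> \<psi> ?d) + t\<^sup>2 * M"
      using M[OF z y(1)] by (simp add: mult_left_mono)
    finally have "2 * t * (1 \<bullet> \<psi> ?d) \<le> t\<^sup>2 * (1 + M)"
      using near[OF yt] by (simp add: algebra_simps)
    then have "2 * (1 \<bullet> \<psi> ?d) \<le> t * (1 + M)"
      using t(1) by (simp add: power2_eq_square mult.assoc mult.left_commute[of 2])
    then have "1 \<bullet> \<psi> ?d \<le> \<epsilon>\<^sup>2 / 2" using t(3) by linarith
    then show ?thesis using diff[OF psi zY yY] by (simp add: inner_diff_right)
  qed
  have "dual_norm norm Y \<psi> \<le> (1 \<bullet> \<psi> y + \<epsilon>\<^sup>2 / 2) / K"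
    unfolding dual_norm_def
  proof (rule cSUP_least)
    show "{x\<in>Y. norm x \<le> 1} \<noteq> {}" using Ys by (auto intro!: exI[of _ 0] subspace_0)
    fix x assume x: "x \<in> {x\<in>Y. norm x \<le> 1}"
    obtain c where c: "norm c \<le> 1" "1 \<bullet> (c * \<psi> x) = norm (\<psi> x)" by (rule unimodular_rotation)
    have cx: "scale_L1 c x \<in> Y" using Y x by (simp add: L1.subspace_scale)
    have "norm c * norm x \<le> 1" using c x by (simp add: mult_le_one)
    then have "K *\<^sub>R scale_L1 c x \<in> W"
      using cx Ys K by (simp add: W_def subspace_scale norm_scale_L1 mult_left_le)
    from opt[OF this] have "K * norm (\<psi> x) \<le> 1 \<bullet> \<psi> y + \<epsilon>\<^sup>2 / 2"
      using scaleR[OF psi cx] scale[OF psi] x c by simp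
    then show "norm (\<psi> x) \<le> (1 \<bullet> \<psi> y + \<epsilon>\<^sup>2 / 2) / K" using K by (simp add: field_simps)
  qed
  then have "K * dual_norm norm Y \<psi> \<le> 1 \<bullet> \<psi> y + \<epsilon>\<^sup>2 / 2" using K by (simp add: field_simps)
  moreover have "q y = 1 \<bullet> \<Phi> \<psi> - 1 \<bullet> \<psi> y"
  proof -
    have "q y = (\<Sum>\<phi>\<in>F. w \<phi> \<bullet> w \<phi>)" by (simp add: q_def w_def power2_norm_eq_inner)
    also have "\<dots> = (\<Sum>\<phi>\<in>F. w \<phi> \<bullet> \<Phi> \<phi>) - (\<Sum>\<phi>\<in>F. w \<phi> \<bullet> \<phi> y)"
      by (simp add: sum_subtractf[symmetric] inner_diff_right[symmetric] w_def)
    also have "\<dots> = 1 \<bullet> \<Phi> \<psi> - 1 \<bullet> \<psi> y"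
      unfolding in_psi Psi inner_sum_right by (simp add: inner_field_cnj[symmetric])
    finally show ?thesis .
  qed
  ultimately have "q y \<le> \<epsilon>\<^sup>2"
    using K(2)[OF psi] inner_one_le_norm[of "\<Phi> \<psi>"] zero_le_power2[of \<epsilon>] by linarith
  have "norm (\<phi> y - \<Phi> \<phi>) \<le> \<epsilon>" if "\<phi> \<in> F" for \<phi>
  proof -
    have "(norm (\<Phi> \<phi> - \<phi> y))\<^sup>2 \<le> q y"
      unfolding q_def using F that by (intro member_le_sum[of \<phi> F "\<lambda>\<phi>. (norm (\<Phi> \<phi> - \<phi> y))\<^sup>2"]) auto
    then have "(norm (\<phi> y - \<Phi> \<phi>))\<^sup>2 \<le> \<epsilon>\<^sup>2" using \<open>q y \<le> \<epsilon>\<^sup>2\<close> by (simp add: norm_minus_commute)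
    then show ?thesis by (rule power2_le_imp_le) (use \<epsilon> in simp)
  qed
  then show ?thesis using y by (auto simp: W_def)
qed

text \<open>For finitely many functionals and a tolerance, Helly's lemma provides a nonempty closed
  convex set of approximants in a fixed ball of \<open>Y\<close>. These sets are directed, and a
  point common to all of them represents the given element of the bidual.\<close>

lemma equi_int_imp_reflexive:
  fixes Y :: "'a::{real_normed_field, euclidean_space} L1 set"
  assumes Y: "L1.subspace Y" "closed Y" and eq: "equi_int {f\<in>Y. norm f \<le> 1}"
  shows "reflexive_space scale_L1 norm Y"
proof -
  note Ys = L1_subspace_imp_subspace[OF Y(1)]
  let ?D = "dual_space scale_L1 norm Y"
  have le: "norm (\<phi> x) \<le> norm x * dual_norm norm Y \<phi>" if d: "\<phi> \<in> ?D" and x: "x \<in> Y" for \<phi> x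
  proof (cases "x = 0")
    case True
    have "\<forall>c. \<forall>x\<in>Y. \<phi> (scale_L1 c x) = c * \<phi> x" using d by (simp add: dual_space_def)
    from this[rule_format, OF x, of 0] show ?thesis using True by simp
  next
    case False
    have "\<phi> (scale_L1 (of_real (inverse (norm x))) x) = of_real (inverse (norm x)) * \<phi> x"
      using d x by (simp add: dual_space_def)
    moreover have "norm (\<phi> (scale_L1 (of_real (inverse (norm x))) x)) \<le> dual_norm norm Y \<phi>"
      using Y x False by (intro dual_norm_upper[OF d]) (auto simp: L1.subspace_scale norm_scale_L1 norm_inverse)
    ultimately have "inverse (norm x) * norm (\<phi> x) \<le> dual_norm norm Y \<phi>"
      by (simp add: norm_mult norm_inverse)
    then show ?thesis using False by (simp add: field_simps)
  qed
  have "canonical_embedding scale_L1 norm Y k \<in> bidual_space scale_L1 norm Y" if k: "k \<in> Y" for k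
  proof -
    have "\<exists>K. \<forall>\<phi>\<in>?D. norm (canonical_embedding scale_L1 norm Y k \<phi>) \<le> K * dual_norm norm Y \<phi>"
      using le[OF _ k] by (intro exI[of _ "norm k"]) (simp add: canonical_embedding_def)
    then show ?thesis
      unfolding bidual_space_def dual_space_def[of "\<lambda>c \<phi> x. c * \<phi> x"]
      by (auto simp: canonical_embedding_def dual_add dual_scale)
  qed
  moreover have "\<Phi> \<in> canonical_embedding scale_L1 norm Y ` Y" if \<Phi>: "\<Phi> \<in> bidual_space scale_L1 norm Y" for \<Phi>
  proof -
    obtain K0 where K0: "\<And>\<phi>. \<phi> \<in> ?D \<Longrightarrow> norm (\<Phi> \<phi>) \<le> K0 * dual_norm norm Y \<phi>"
      using \<Phi> unfolding bidual_space_def dual_space_def[of "\<lambda>c \<phi> x. c * \<phi> x"] by blast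
    \<comment> \<open>\<open>K0\<close> may fail to be positive, whereas Helly's lemma asks for a
      ball of positive radius.\<close>
    define K where "K = \<bar>K0\<bar> + 1"
    have dn0: "dual_norm norm Y \<phi> \<ge> 0" if "\<phi> \<in> ?D" for \<phi>
      using dual_norm_upper[OF that, of 0] subspace_0[OF Ys] norm_ge_zero order_trans by (metis norm_zero zero_le_one)
    have K: "K > 0" "\<And>\<phi>. \<phi> \<in> ?D \<Longrightarrow> norm (\<Phi> \<phi>) \<le> K * dual_norm norm Y \<phi>"
    proof -
      show "K > 0" by (simp add: K_def)
      fix \<phi> assume d: "\<phi> \<in> ?D"
      have "K0 * dual_norm norm Y \<phi> \<le> K * dual_norm norm Y \<phi>"
        using dn0[OF d] by (intro mult_right_mono) (auto simp: K_def)
      then show "norm (\<Phi> \<phi>) \<le> K * dual_norm norm Y \<phi>" using K0[OF d] by linarith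
    qed
    define C where "C = (\<lambda>(F, \<epsilon>). {y\<in>Y. norm y \<le> K \<and> (\<forall>\<phi>\<in>F. norm (\<phi> y - \<Phi> \<phi>) \<le> \<epsilon>)})"
    define I where "I = {F. finite F \<and> F \<subseteq> ?D} \<times> {0::real<..}"
    have eqK: "equi_int {y\<in>Y. norm y \<le> K}"
    proof (rule equi_int_subset[OF equi_int_scaleR[OF eq, of K]])
      show "{y\<in>Y. norm y \<le> K} \<subseteq> (*\<^sub>R) K ` {f\<in>Y. norm f \<le> 1}"
      proof clarify
        fix y assume "y \<in> Y" "norm y \<le> K"
        then show "y \<in> (*\<^sub>R) K ` {f\<in>Y. norm f \<le> 1}"
          using K(1) Ys by (intro image_eqI[of _ _ "(1/K) *\<^sub>R y"]) (auto simp: subspace_scale)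
      qed
    qed
    have "\<Inter>(C ` I) \<noteq> {}"
    proof (rule equi_int_directed_Inter[OF eqK])
      have "({}, 1) \<in> I" by (simp add: I_def)
      then show "C ` I \<noteq> {}" by blast
      fix S assume "S \<in> C ` I"
      then obtain F \<epsilon> where F: "finite F" "F \<subseteq> ?D" and e: "\<epsilon> > 0" and S: "S = C (F, \<epsilon>)" by (auto simp: I_def)
      show "S \<subseteq> {y\<in>Y. norm y \<le> K}" by (auto simp: S C_def)
      have cl: "closed {y\<in>Y. norm (\<phi> y - \<Phi> \<phi>) \<le> \<epsilon>}" and cv: "convex {y\<in>Y. norm (\<phi> y - \<Phi> \<phi>) \<le> \<epsilon>}" 
        if "\<phi> \<in> F" for \<phi>
      proof -
        have d: "\<phi> \<in> ?D" using that F by auto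
        have add: "\<phi> (x + y) = \<phi> x + \<phi> y" if "x \<in> Y" "y \<in> Y" for x y
          using that d by (simp add: dual_space_def)
        have sc: "\<phi> (r *\<^sub>R x) = r *\<^sub>R \<phi> x" if "x \<in> Y" for r x
          using that d by (simp add: dual_space_def scaleR_L1_eq_scale_L1 scaleR_conv_of_real)
        have diff: "\<phi> (x - y) = \<phi> x - \<phi> y" if "x \<in> Y" "y \<in> Y" for x y
          using add[OF that(1), of "(-1) *\<^sub>R y"] sc[OF that(2), of "-1"] that Ys by (simp add: subspace_neg)
        have "continuous_on Y \<phi>"
        proof (rule continuous_onI)
          fix x e :: "'a L1" and r :: real assume x: "x \<in> Y" and r: "r > 0"
          show "\<exists>d>0. \<forall>x'\<in>Y. dist x' x < d \<longrightarrow> dist (\<phi> x') (\<phi> x) \<le> r"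
          proof (intro exI[of _ "r / (dual_norm norm Y \<phi> + 1)"] conjI ballI impI)
            show "0 < r / (dual_norm norm Y \<phi> + 1)" using r dn0[OF d] by simp
            fix x' assume x': "x' \<in> Y" "dist x' x < r / (dual_norm norm Y \<phi> + 1)"
            have "dist (\<phi> x') (\<phi> x) \<le> norm (x' - x) * dual_norm norm Y \<phi>"
              using le[OF d subspace_diff[OF Ys x'(1) x]] diff[OF x'(1) x] by (simp add: dist_norm)
            also have "\<dots> \<le> norm (x' - x) * (dual_norm norm Y \<phi> + 1)" by (intro mult_left_mono) auto
            also have "\<dots> \<le> r" using x'(2) dn0[OF d] by (simp add: dist_norm field_simps)
            finally show "dist (\<phi> x') (\<phi> x) \<le> r" .
          qed
        qed
        then have "continuous_on Y (\<lambda>y. norm (\<phi> y - \<Phi> \<phi>))" by (intro continuous_intros)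
        from continuous_closed_preimage[OF this Y(2), of "{..\<epsilon>}"]
        show "closed {y\<in>Y. norm (\<phi> y - \<Phi> \<phi>) \<le> \<epsilon>}" by (simp add: vimage_def Int_def)
        show "convex {y\<in>Y. norm (\<phi> y - \<Phi> \<phi>) \<le> \<epsilon>}"
        proof (rule convexI, clarify, intro conjI)
          fix x y and u v :: real
          assume *: "0 \<le> u" "0 \<le> v" "u + v = 1" "x \<in> Y" "y \<in> Y" 
            "norm (\<phi> x - \<Phi> \<phi>) \<le> \<epsilon>" "norm (\<phi> y - \<Phi> \<phi>) \<le> \<epsilon>"
          show "u *\<^sub>R x + v *\<^sub>R y \<in> Y" using Ys * by (intro subspace_add subspace_scale)
          have "u *\<^sub>R \<Phi> \<phi> + v *\<^sub>R \<Phi> \<phi> = \<Phi> \<phi>" using * by (simp add: scaleR_add_left[symmetric])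
          then have "\<phi> (u *\<^sub>R x + v *\<^sub>R y) - \<Phi> \<phi> = u *\<^sub>R (\<phi> x - \<Phi> \<phi>) + v *\<^sub>R (\<phi> y - \<Phi> \<phi>)"
            using * Ys add[of "u *\<^sub>R x" "v *\<^sub>R y"] sc by (simp add: subspace_scale algebra_simps)
          then have "norm (\<phi> (u *\<^sub>R x + v *\<^sub>R y) - \<Phi> \<phi>) \<le> u * norm (\<phi> x - \<Phi> \<phi>) + v * norm (\<phi> y - \<Phi> \<phi>)"
            using * norm_triangle_ineq[of "u *\<^sub>R (\<phi> x - \<Phi> \<phi>)" "v *\<^sub>R (\<phi> y - \<Phi> \<phi>)"] by simp
          also have "\<dots> \<le> \<epsilon>" using * by (intro convex_bound_le) auto
          finally show "norm (\<phi> (u *\<^sub>R x + v *\<^sub>R y) - \<Phi> \<phi>) \<le> \<epsilon>" .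
        qed
      qed
      have S_eq: "S = (Y \<inter> cball 0 K) \<inter> (\<Inter>\<phi>\<in>F. {y\<in>Y. norm (\<phi> y - \<Phi> \<phi>) \<le> \<epsilon>})"
        by (auto simp: S C_def)
      have "closed S" unfolding S_eq using cl Y(2) by (intro closed_Int closed_INT) auto
      moreover have "convex S" unfolding S_eq using cv Ys
        by (intro convex_Int convex_INT) (auto simp: subspace_imp_convex)
      moreover have "S \<noteq> {}" using Helly[OF Y(1) \<Phi> K F e] by (auto simp: S C_def)
      ultimately show "convex S \<and> closed S \<and> S \<noteq> {}" by simp
    next
      fix S S' assume "S \<in> C ` I" "S' \<in> C ` I"
      then obtain F \<epsilon> F' \<epsilon>' where *: "finite F" "F \<subseteq> ?D" "\<epsilon> > 0" "S = C (F, \<epsilon>)" 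
        "finite F'" "F' \<subseteq> ?D" "\<epsilon>' > 0" "S' = C (F', \<epsilon>')" by (auto simp: I_def)
      then have "(F \<union> F', min \<epsilon> \<epsilon>') \<in> I" by (simp add: I_def)
      moreover have "C (F \<union> F', min \<epsilon> \<epsilon>') \<subseteq> S \<inter> S'" by (auto simp: C_def *)
      ultimately show "\<exists>E\<in>C ` I. E \<subseteq> S \<inter> S'" by blast
    qed
    then obtain k where k: "\<And>p. p \<in> I \<Longrightarrow> k \<in> C p" by blast
    have "k \<in> C ({}, 1)" by (rule k) (simp add: I_def)
    then have kY: "k \<in> Y" by (simp add: C_def)
    have "\<phi> k = \<Phi> \<phi>" if "\<phi> \<in> ?D" for \<phi>
    proof -
      have "norm (\<phi> k - \<Phi> \<phi>) \<le> \<epsilon>" if "\<epsilon> > 0" for \<epsilon>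
        using k[of "({\<phi>}, \<epsilon>)"] that \<open>\<phi> \<in> ?D\<close> by (simp add: I_def C_def)
      then have "norm (\<phi> k - \<Phi> \<phi>) \<le> 0" using field_le_epsilon[of "norm (\<phi> k - \<Phi> \<phi>)" 0] by simp
      then show ?thesis by simp
    qed
    moreover have "\<Phi> \<phi> = 0" if "\<phi> \<notin> ?D" for \<phi>
      using that by (rule bidual_outside[OF \<Phi>])
    ultimately have "\<Phi> = canonical_embedding scale_L1 norm Y k"
      by (auto simp: canonical_embedding_def fun_eq_iff)
    then show ?thesis using kY by blast
  qed
  ultimately show ?thesis unfolding reflexive_space_def by blast
qed

section \<open>Minimal invariant sets and approximate fixed points\<close>

locale minimal_invariant =
  fixes K :: "'a::euclidean_space L1 set" and T
  assumes closed_K: "closed K" and convex_K: "convex K" and K_nonempty: "K \<noteq> {}"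
    and equi_int_K: "equi_int K"
    and T_in: "\<And>x. x \<in> K \<Longrightarrow> T x \<in> K"
    and nonexp: "\<And>x y. x \<in> K \<Longrightarrow> y \<in> K \<Longrightarrow> norm (T x - T y) \<le> norm (x - y)"
    and minimal: "\<And>L. L \<subseteq> K \<Longrightarrow> closed L \<Longrightarrow> convex L \<Longrightarrow> L \<noteq> {} \<Longrightarrow> T ` L \<subseteq> L \<Longrightarrow> L = K"

text \<open>Zorn's lemma; that chains have nonempty intersection comes from
  \<open>equi_int_directed_Inter\<close>.\<close>

lemma exists_minimal_invariant:
  fixes C :: "'a::euclidean_space L1 set"
  assumes C: "closed C" "convex C" "C \<noteq> {}" "equi_int C"
    and T: "\<And>x. x \<in> C \<Longrightarrow> T x \<in> C"
    and ne: "\<And>x y. x \<in> C \<Longrightarrow> y \<in> C \<Longrightarrow> norm (T x - T y) \<le> norm (x - y)"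
  obtains K where "K \<subseteq> C" "minimal_invariant K T"
proof -
  define \<A> where "\<A> = {L. L \<subseteq> C \<and> closed L \<and> convex L \<and> L \<noteq> {} \<and> T ` L \<subseteq> L}"
  have "\<exists>m\<in>\<A>. \<forall>a\<in>\<A>. a \<subseteq> m \<longrightarrow> a = m"
  proof (rule predicate_Zorn[where P = "\<lambda>x y. y \<subseteq> x"])
    show "partial_order_on \<A> (relation_of (\<lambda>x y. y \<subseteq> x) \<A>)"
      by (rule partial_order_on_relation_ofI) auto
    fix \<C> assume \<C>: "\<C> \<in> Chains (relation_of (\<lambda>x y. y \<subseteq> x) \<A>)"
    have CA: "\<C> \<subseteq> \<A>" using \<C> by (rule Chains_relation_of)
    show "\<exists>u\<in>\<A>. \<forall>a\<in>\<C>. u \<subseteq> a"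
    proof (cases "\<C> = {}")
      case True
      then show ?thesis using C T by (auto simp: \<A>_def)
    next
      case False
      have "\<Inter>\<C> \<noteq> {}"
      proof (rule equi_int_directed_Inter[OF C(4) _ False])
        fix A B assume AB: "A \<in> \<C>" "B \<in> \<C>"
        then have "A \<subseteq> B \<or> B \<subseteq> A" using \<C> by (auto simp: Chains_def relation_of_def)
        then show "\<exists>E\<in>\<C>. E \<subseteq> A \<inter> B" using AB by blast
      qed (use CA in \<open>auto simp: \<A>_def\<close>)
      moreover have "closed (\<Inter>\<C>)" "convex (\<Inter>\<C>)"
        using CA by (auto simp: \<A>_def intro!: closed_Inter convex_Inter)
      moreover have "\<Inter>\<C> \<subseteq> C" using CA False by (auto simp: \<A>_def)
      moreover have "T ` \<Inter>\<C> \<subseteq> \<Inter>\<C>"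
      proof (rule Inter_greatest)
        fix L assume L: "L \<in> \<C>"
        then have "T ` L \<subseteq> L" using CA by (auto simp: \<A>_def)
        then show "T ` \<Inter>\<C> \<subseteq> L" using L by blast
      qed
      ultimately have "\<Inter>\<C> \<in> \<A>" by (simp add: \<A>_def)
      then show ?thesis by blast
    qed
  qed
  then obtain K where K: "K \<in> \<A>" "\<And>L. L \<in> \<A> \<Longrightarrow> L \<subseteq> K \<Longrightarrow> L = K" by blast
  show ?thesis
  proof (rule that)
    show "K \<subseteq> C" using K by (simp add: \<A>_def)
    show "minimal_invariant K T"
    proof
      fix L assume "L \<subseteq> K" "closed L" "convex L" "L \<noteq> {}" "T ` L \<subseteq> L"
      then show "L = K" using K(1) by (intro K(2)) (auto simp: \<A>_def)
    qed (use K ne equi_int_subset[OF C(4)] in \<open>auto simp: \<A>_def subset_iff\<close>)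
  qed
qed

text \<open>The point \<open>k\<close> lies in the closed convex hull of the values over every set
  of \<open>U\<close>. A ball that eventually contains the values is closed and convex, so it
  contains \<open>k\<close> as well; this is the weak lower semicontinuity of distances.\<close>

lemma ultra_weak_limit:
  fixes c :: "'i \<Rightarrow> 'a::euclidean_space L1"
  assumes U: "ultra U" and K: "equi_int K" "closed K" "convex K" and c: "\<And>i. c i \<in> K"
  shows "\<exists>k\<in>K. \<forall>y r. eventually (\<lambda>i. norm (y - c i) \<le> r) U \<longrightarrow> norm (y - k) \<le> r"
proof -
  define \<C> where "\<C> = (\<lambda>A. closure (convex hull (c ` A))) ` {A. eventually (\<lambda>i. i \<in> A) U}"
  have "\<Inter>\<C> \<noteq> {}"
  proof (rule equi_int_directed_Inter[OF K(1)])
    have "eventually (\<lambda>i. i \<in> UNIV) U" by simp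
    then show "\<C> \<noteq> {}" unfolding \<C>_def by blast
    fix S assume "S \<in> \<C>"
    then obtain A where A: "eventually (\<lambda>i. i \<in> A) U" and S: "S = closure (convex hull (c ` A))"
      by (auto simp: \<C>_def)
    show "S \<subseteq> K" unfolding S using c K by (intro closure_minimal hull_minimal) auto
    have "A \<noteq> {}" using A U by (auto simp: ultra_def)
    then have "convex hull (c ` A) \<noteq> {}" by (simp only: convex_hull_eq_empty image_is_empty not_False_eq_True)
    then show "convex S \<and> closed S \<and> S \<noteq> {}" by (simp add: S convex_closure)
  next
    fix S S' assume "S \<in> \<C>" "S' \<in> \<C>"
    then obtain A A' where A: "eventually (\<lambda>i. i \<in> A) U" "eventually (\<lambda>i. i \<in> A') U"
      and S: "S = closure (convex hull (c ` A))" "S' = closure (convex hull (c ` A'))"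
      by (auto simp: \<C>_def)
    have "closure (convex hull (c ` (A \<inter> A'))) \<in> \<C>"
      unfolding \<C>_def using A by (intro imageI) (simp add: eventually_conj)
    moreover have "closure (convex hull (c ` (A \<inter> A'))) \<subseteq> S \<inter> S'"
      unfolding S by (intro Int_greatest closure_mono hull_mono image_mono) auto
    ultimately show "\<exists>E\<in>\<C>. E \<subseteq> S \<inter> S'" by blast
  qed
  then obtain k where k: "\<And>A. eventually (\<lambda>i. i \<in> A) U \<Longrightarrow> k \<in> closure (convex hull (c ` A))"
    by (auto simp: \<C>_def)
  show ?thesis
  proof (intro bexI[of _ k] allI impI)
    have "k \<in> closure (convex hull (c ` UNIV))" by (rule k) simp
    moreover have "closure (convex hull (c ` UNIV)) \<subseteq> K"
      using c K by (intro closure_minimal hull_minimal) auto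
    ultimately show "k \<in> K" by blast
    fix y r assume "eventually (\<lambda>i. norm (y - c i) \<le> r) U"
    then have "k \<in> closure (convex hull (c ` {i. norm (y - c i) \<le> r}))" by (intro k) simp
    moreover have "closure (convex hull (c ` {i. norm (y - c i) \<le> r})) \<subseteq> cball y r"
      by (intro closure_minimal hull_minimal) (auto simp: dist_norm)
    ultimately show "norm (y - k) \<le> r" by (auto simp: dist_norm)
  qed
qed

lemma closed_convex_normed_le:
  fixes w :: "'b::real_normed_vector"
  shows "closed {x. norm (w - x) \<le> r}" "convex {x. norm (w - x) \<le> r}"
proof -
  have "{x. norm (w - x) \<le> r} = cball w r" by (auto simp: dist_norm)
  then show "closed {x. norm (w - x) \<le> r}" "convex {x. norm (w - x) \<le> r}" by simp_all
qed

section \<open>Geometry of a minimal invariant set\<close>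

context minimal_invariant
begin

abbreviation d where "d \<equiv> diameter K"

lemma bounded_K: "bounded K"
  using equi_int_K by (rule equi_int_bounded)

lemma dist_le_d: "x \<in> K \<Longrightarrow> y \<in> K \<Longrightarrow> norm (x - y) \<le> d"
  using diameter_bounded_bound[OF bounded_K] by (simp add: dist_norm)

lemma d_nonneg: "0 \<le> d"
  using diameter_ge_0[OF bounded_K] .

lemma hull_T: "closure (convex hull (T ` K)) = K"
proof (rule minimal)
  show sub: "closure (convex hull (T ` K)) \<subseteq> K"
    using closed_K convex_K T_in by (intro closure_minimal hull_minimal) auto
  show "T ` closure (convex hull (T ` K)) \<subseteq> closure (convex hull (T ` K))"
  proof -
    have "T ` closure (convex hull (T ` K)) \<subseteq> T ` K" using sub by (rule image_mono)
    also have "\<dots> \<subseteq> convex hull (T ` K)" by (rule hull_subset)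
    also have "\<dots> \<subseteq> closure (convex hull (T ` K))" by (rule closure_subset)
    finally show ?thesis .
  qed
  show "closure (convex hull (T ` K)) \<noteq> {}" using K_nonempty by simp
qed (simp_all add: convex_closure)

text \<open>Let \<open>L\<close> consist of the points of \<open>K\<close> whose closed ball of
  radius \<open>c\<close> contains \<open>K\<close>. For \<open>x'\<close> in \<open>L\<close> the
  ball about \<open>T x'\<close> contains the image of \<open>K\<close>, hence by
  \<open>hull_T\<close> all of \<open>K\<close>. So \<open>L\<close> is invariant, minimality gives
  \<open>L = K\<close>, and no two points of \<open>K\<close> are more than \<open>c\<close>
  apart.\<close>

lemma diametral:
  assumes x: "x \<in> K" and c: "\<And>y. y \<in> K \<Longrightarrow> norm (x - y) \<le> c" shows "d \<le> c"
proof -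
  define L where "L = K \<inter> (\<Inter>y\<in>K. {x. norm (y - x) \<le> c})"
  have "L = K"
  proof (rule minimal)
    show "closed L" unfolding L_def by (intro closed_Int closed_K closed_INT ballI closed_convex_normed_le)
    show "convex L" unfolding L_def by (intro convex_Int convex_K convex_INT closed_convex_normed_le)
    show "L \<noteq> {}" using x c by (auto simp: L_def norm_minus_commute)
    show "T ` L \<subseteq> L"
    proof
      fix z assume "z \<in> T ` L"
      then obtain x' where x': "x' \<in> L" "z = T x'" by blast
      have x'K: "x' \<in> K" and x'c: "\<And>y. y \<in> K \<Longrightarrow> norm (y - x') \<le> c" using x'(1) by (auto simp: L_def)
      have "T ` K \<subseteq> cball z c"
      proof clarify
        fix y assume "y \<in> K"
        then show "T y \<in> cball z c"
          using nonexp[OF x'K, of y] x'c[of y] by (simp add: x'(2) dist_norm norm_minus_commute)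
      qed
      then have "K \<subseteq> cball z c"
        by (subst hull_T[symmetric]) (intro closure_minimal hull_minimal, auto)
      then show "z \<in> L" using x' T_in by (auto simp: L_def dist_norm norm_minus_commute)
    qed
  qed (auto simp: L_def)
  then have "norm (y - x) \<le> c" if "x \<in> K" "y \<in> K" for x y using that by (auto simp: L_def)
  then show ?thesis using K_nonempty by (intro diameter_le) auto
qed

text \<open>Otherwise there are approximate fixed points \<open>w n\<close>, with displacements
  tending to 0, within \<open>d - \<epsilon>\<close> of \<open>y\<close>. The points at asymptotic
  distance at most \<open>d - \<epsilon>\<close> from the \<open>w n\<close> form a closed convex
  invariant set, hence all of \<open>K\<close>. A weak limit of the \<open>w n\<close> is then
  closer than \<open>d\<close> to all of \<open>K\<close> by a fixed margin, against
  \<open>diametral\<close>.\<close>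

lemma Goebel_Karlovitz:
  assumes y: "y \<in> K" and e: "\<epsilon> > 0"
  shows "\<exists>\<delta>>0. \<forall>w\<in>K. norm (T w - w) \<le> \<delta> \<longrightarrow> d - \<epsilon> \<le> norm (w - y)"
proof (rule ccontr)
  assume "\<not> ?thesis"
  then have "\<exists>w\<in>K. norm (T w - w) \<le> 1 / real (Suc n) \<and> norm (w - y) < d - \<epsilon>" for n
    by (auto simp: not_le dest: spec[of _ "1 / real (Suc n)"])
  then obtain w where w: "\<And>n. w n \<in> K" "\<And>n. norm (T (w n) - w n) \<le> 1 / real (Suc n)"
    "\<And>n. norm (w n - y) < d - \<epsilon>" by metis
  define L where "L = {x\<in>K. \<forall>\<eta>>0. eventually (\<lambda>n. norm (w n - x) \<le> d - \<epsilon> + \<eta>) sequentially}"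
  have "L = K"
  proof (rule minimal)
    show "L \<noteq> {}" proof -
      have "norm (w n - y) \<le> d - \<epsilon> + \<eta>" if "\<eta> > 0" for n \<eta> using w(3)[of n] that by simp
      then have "y \<in> L" using y by (simp add: L_def)
      then show ?thesis by blast
    qed
    show "closed L"
      unfolding closed_sequential_limits
    proof (intro allI impI, elim conjE)
      fix X x assume X: "\<forall>n. X n \<in> L" and lim: "X \<longlonglongrightarrow> x"
      have "x \<in> K" using closed_sequentially[OF closed_K _ lim] X by (auto simp: L_def)
      moreover have "eventually (\<lambda>n. norm (w n - x) \<le> d - \<epsilon> + \<eta>) sequentially" if "\<eta> > 0" for \<eta>
      proof -
        obtain m where m: "norm (X m - x) < \<eta>/2"
          using LIMSEQ_D[OF lim, of "\<eta>/2"] \<open>\<eta> > 0\<close> by auto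
        have "eventually (\<lambda>n. norm (w n - X m) \<le> d - \<epsilon> + \<eta>/2) sequentially"
          using X \<open>\<eta> > 0\<close> by (simp add: L_def)
        then show ?thesis
        proof eventually_elim
          case (elim n)
          then show ?case using m norm_triangle_ineq[of "w n - X m" "X m - x"] by simp
        qed
      qed
      ultimately show "x \<in> L" by (simp add: L_def)
    qed
    show "convex L"
    proof (rule convexI)
      fix a b and u v :: real assume ab: "a \<in> L" "b \<in> L" and uv: "0 \<le> u" "0 \<le> v" "u + v = 1"
      have "u *\<^sub>R a + v *\<^sub>R b \<in> K" using ab uv convex_K by (intro convexD) (auto simp: L_def)
      moreover have "eventually (\<lambda>n. norm (w n - (u *\<^sub>R a + v *\<^sub>R b)) \<le> d - \<epsilon> + \<eta>) sequentially" if "\<eta> > 0" for \<eta>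
      proof -
        have "eventually (\<lambda>n. norm (w n - a) \<le> d - \<epsilon> + \<eta>) sequentially"
          "eventually (\<lambda>n. norm (w n - b) \<le> d - \<epsilon> + \<eta>) sequentially"
          using ab that by (auto simp: L_def)
        then show ?thesis
        proof eventually_elim
          case (elim n)
          then show ?case using convexD[OF closed_convex_normed_le(2), of a "w n" "d - \<epsilon> + \<eta>" b u v] uv by simp
        qed
      qed
      ultimately show "u *\<^sub>R a + v *\<^sub>R b \<in> L" by (simp add: L_def)
    qed
    show "T ` L \<subseteq> L"
    proof
      fix z assume "z \<in> T ` L"
      then obtain x where x: "x \<in> L" "z = T x" by blast
      have xK: "x \<in> K" using x by (simp add: L_def)
      have "eventually (\<lambda>n. norm (w n - z) \<le> d - \<epsilon> + \<eta>) sequentially" if "\<eta> > 0" for \<eta>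
      proof -
        have "eventually (\<lambda>n. norm (w n - x) \<le> d - \<epsilon> + \<eta>/2) sequentially"
          using x that by (simp add: L_def)
        moreover have "eventually (\<lambda>n. 1 / real (Suc n) < \<eta>/2) sequentially"
          using that by (intro order_tendstoD(2)[OF LIMSEQ_Suc[OF lim_1_over_n]]) auto
        ultimately show ?thesis
        proof eventually_elim
          case (elim n)
          then show ?case
            using w(2)[of n] nonexp[OF w(1)[of n] xK] norm_triangle_ineq[of "w n - T (w n)" "T (w n) - T x"]
            by (simp add: x(2) norm_minus_commute)
        qed
      qed
      then show "z \<in> L" using T_in[OF xK] x by (simp add: L_def)
    qed
  qed (auto simp: L_def)
  obtain U :: "nat filter" where U: "ultra U" "U \<le> sequentially"
    using ultra_exists[of sequentially] by auto
  obtain k where k: "k \<in> K" "\<And>y r. eventually (\<lambda>i. norm (y - w i) \<le> r) U \<Longrightarrow> norm (y - k) \<le> r"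
    using ultra_weak_limit[of U K w, OF U(1) equi_int_K closed_K convex_K w(1)] by auto
  have "d \<le> d - \<epsilon> + \<epsilon>/2"
  proof (rule diametral[OF k(1)])
    fix x assume "x \<in> K"
    then have "x \<in> L" using \<open>L = K\<close> by simp
    then have "\<forall>\<eta>>0. eventually (\<lambda>n. norm (w n - x) \<le> d - \<epsilon> + \<eta>) sequentially"
      by (simp add: L_def)
    from this[rule_format, of "\<epsilon>/2"]
    have "eventually (\<lambda>n. norm (w n - x) \<le> d - \<epsilon> + \<epsilon>/2) sequentially"
      using e by simp
    then have "eventually (\<lambda>n. norm (x - w n) \<le> d - \<epsilon> + \<epsilon>/2) U"
      using U(2) by (simp add: filter_leD norm_minus_commute)
    from k(2)[OF this] show "norm (k - x) \<le> d - \<epsilon> + \<epsilon>/2"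
      by (simp add: norm_minus_commute[of k x])
  qed
  then show False using e by simp
qed

section \<open>Resolvents and chains between approximate fixed points\<close>

lemma resolvent:
  assumes l: "0 < \<mu>" "\<mu> \<le> 1" and w: "w \<in> K"
  obtains z where "z \<in> K" "z = (1 - \<mu>) *\<^sub>R T z + \<mu> *\<^sub>R w"
proof -
  have "\<exists>!z\<in>K. (1 - \<mu>) *\<^sub>R T z + \<mu> *\<^sub>R w = z"
  proof (rule Banach_fix[where c = "1 - \<mu>"])
    show "complete K" using closed_K by (simp add: complete_eq_closed)
    show "(\<lambda>z. (1 - \<mu>) *\<^sub>R T z + \<mu> *\<^sub>R w) ` K \<subseteq> K"
    proof clarify
      fix z assume "z \<in> K"
      then show "(1 - \<mu>) *\<^sub>R T z + \<mu> *\<^sub>R w \<in> K"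
        using l w T_in by (intro convexD[OF convex_K]) auto
    qed
    fix x y assume "x \<in> K" "y \<in> K"
    have "dist ((1 - \<mu>) *\<^sub>R T x + \<mu> *\<^sub>R w) ((1 - \<mu>) *\<^sub>R T y + \<mu> *\<^sub>R w) = (1 - \<mu>) * norm (T x - T y)"
      using l by (simp add: dist_norm scaleR_diff_right[symmetric])
    then show "dist ((1 - \<mu>) *\<^sub>R T x + \<mu> *\<^sub>R w) ((1 - \<mu>) *\<^sub>R T y + \<mu> *\<^sub>R w) \<le> (1 - \<mu>) * dist x y"
      using l nonexp[OF \<open>x \<in> K\<close> \<open>y \<in> K\<close>] by (simp add: dist_norm mult_left_mono)
  qed (use K_nonempty l in auto)
  then show ?thesis using that by metis
qed

lemma resolvent_displacement:
  assumes l: "0 < \<mu>" and w: "w \<in> K" and z: "z \<in> K" "z = (1 - \<mu>) *\<^sub>R T z + \<mu> *\<^sub>R w"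
  shows "norm (T z - z) \<le> \<mu> * d"
proof -
  have "T z - z = \<mu> *\<^sub>R (T z - w)" by (subst (2) z(2)) (simp add: algebra_simps)
  then show ?thesis using l dist_le_d[OF T_in[OF z(1)] w] by simp
qed

text \<open>The equation for \<open>z\<close> bounds \<open>norm (z - u)\<close> in terms of itself
  with factor \<open>1 - \<mu>\<close>; absorbing that term divides the displacement of
  \<open>u\<close> by \<mu>. For this reason the ends of a chain must be fixed up to
  \<open>\<mu>\<^sup>2\<close>, while its inner points are fixed only up to the order of
  \<mu>.\<close>

lemma resolvent_dist:
  assumes l: "0 < \<mu>" "\<mu> \<le> 1" and z: "z \<in> K" "z = (1 - \<mu>) *\<^sub>R T z + \<mu> *\<^sub>R w"
    and u: "u \<in> K" and \<delta>: "norm (T u - u) \<le> \<delta>"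
  shows "norm (z - u) \<le> norm (w - u) + \<delta> / \<mu>"
proof -
  have "norm ((1 - \<mu>) *\<^sub>R (T z - u) + \<mu> *\<^sub>R (w - u)) \<le> (1 - \<mu>) * norm (T z - u) + \<mu> * norm (w - u)"
    using l norm_triangle_ineq[of "(1 - \<mu>) *\<^sub>R (T z - u)" "\<mu> *\<^sub>R (w - u)"] by simp
  moreover have "(1 - \<mu>) *\<^sub>R (T z - u) + \<mu> *\<^sub>R (w - u) = z - u"
    by (subst (2) z(2)) (simp add: algebra_simps)
  moreover have "norm (T z - u) \<le> norm (z - u) + \<delta>"
    using nonexp[OF z(1) u] \<delta> norm_triangle_ineq[of "T z - T u" "T u - u"] by simp
  then have "(1 - \<mu>) * norm (T z - u) \<le> (1 - \<mu>) * (norm (z - u) + \<delta>)"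
    using l by (intro mult_left_mono) auto
  moreover have "\<delta> \<ge> 0" using \<delta> norm_ge_zero order_trans by blast
  moreover have "(1 - \<mu>) * (norm (z - u) + \<delta>) = norm (z - u) + \<delta> - \<mu> * norm (z - u) - \<mu> * \<delta>"
    by (simp add: algebra_simps)
  ultimately have "\<mu> * norm (z - u) \<le> \<mu> * norm (w - u) + \<delta>"
    using mult_nonneg_nonneg[of \<mu> \<delta>] l(1) by (smt (verit))
  then show ?thesis using l by (simp add: field_simps)
qed

lemma resolvent_nonexpansive:
  assumes l: "0 < \<mu>" "\<mu> \<le> 1" and z: "z \<in> K" "z = (1 - \<mu>) *\<^sub>R T z + \<mu> *\<^sub>R w"
    and z': "z' \<in> K" "z' = (1 - \<mu>) *\<^sub>R T z' + \<mu> *\<^sub>R w'"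
  shows "norm (z - z') \<le> norm (w - w')"
proof -
  have "norm ((1 - \<mu>) *\<^sub>R (T z - T z') + \<mu> *\<^sub>R (w - w')) \<le> (1 - \<mu>) * norm (T z - T z') + \<mu> * norm (w - w')"
    using l norm_triangle_ineq[of "(1 - \<mu>) *\<^sub>R (T z - T z')" "\<mu> *\<^sub>R (w - w')"] by simp
  moreover have "(1 - \<mu>) *\<^sub>R (T z - T z') + \<mu> *\<^sub>R (w - w') = ((1 - \<mu>) *\<^sub>R T z + \<mu> *\<^sub>R w) - ((1 - \<mu>) *\<^sub>R T z' + \<mu> *\<^sub>R w')"
    by (simp add: algebra_simps)
  then have "(1 - \<mu>) *\<^sub>R (T z - T z') + \<mu> *\<^sub>R (w - w') = z - z'"
    unfolding z(2)[symmetric] z'(2)[symmetric] .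
  moreover have "(1 - \<mu>) * norm (T z - T z') \<le> (1 - \<mu>) * norm (z - z')"
    using l nonexp[OF z(1) z'(1)] by (intro mult_left_mono) auto
  moreover have "(1 - \<mu>) * norm (z - z') = norm (z - z') - \<mu> * norm (z - z')"
    by (simp add: algebra_simps)
  ultimately have "\<mu> * norm (z - z') \<le> \<mu> * norm (w - w')" by (smt (verit))
  then show ?thesis using l by simp
qed

text \<open>The inner \<open>z i\<close> are the fixed points of the contractions \<open>(1 - \<mu>) T + \<mu> w i\<close>, where \<open>w i\<close> divides the
  segment \<open>[a, b]\<close> into \<open>N\<close> parts. They stay as close to \<open>a\<close> and \<open>b\<close> as \<open>w i\<close> since \<open>a\<close> and \<open>b\<close> are much
  better approximate fixed points.\<close>

lemma chain:
  assumes N: "0 < N" and a: "a \<in> K" and b: "b \<in> K" and l: "0 < \<mu>" "\<mu> \<le> 1"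
    and Ta: "norm (T a - a) \<le> \<mu>\<^sup>2" and Tb: "norm (T b - b) \<le> \<mu>\<^sup>2"
  shows "\<exists>z. z 0 = a \<and> z N = b \<and> (\<forall>i\<le>N. z i \<in> K \<and> norm (T (z i) - z i) \<le> \<mu> * (d + 1) \<and>
      norm (z i - a) \<le> real i / N * d + \<mu> \<and> norm (z i - b) \<le> (1 - real i / N) * d + \<mu>) \<and>
      (\<forall>i<N. norm (z (Suc i) - z i) \<le> d / N + \<mu>)"
proof -
  define w where "w i = (1 - real i / N) *\<^sub>R a + (real i / N) *\<^sub>R b" for i
  have wK: "w i \<in> K" if "i \<le> N" for i
    unfolding w_def using that N a b convex_K by (intro convexD) (auto simp: divide_simps)
  have "\<exists>z. z \<in> K \<and> z = (1 - \<mu>) *\<^sub>R T z + \<mu> *\<^sub>R w i" if "i \<le> N" for i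
    using resolvent[OF l wK[OF that]] by blast
  then obtain z where z: "\<And>i. i \<le> N \<Longrightarrow> z i \<in> K" "\<And>i. i \<le> N \<Longrightarrow> z i = (1 - \<mu>) *\<^sub>R T (z i) + \<mu> *\<^sub>R w i"
    by metis
  have wa: "norm (w i - a) \<le> real i / N * d" if "i \<le> N" for i
  proof -
    have "w i - a = (real i / N) *\<^sub>R (b - a)" by (simp add: w_def algebra_simps)
    then show ?thesis using dist_le_d[OF b a] N by (simp add: divide_right_mono mult_left_mono)
  qed
  have wb: "norm (w i - b) \<le> (1 - real i / N) * d" if "i \<le> N" for i
  proof -
    have "w i - b = (1 - real i / N) *\<^sub>R (a - b)" by (simp add: w_def algebra_simps)
    moreover have "real i / N \<le> 1" using that N by (simp add: divide_simps)
    ultimately show ?thesis using dist_le_d[OF a b] by (simp add: mult_left_mono)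
  qed
  have ww: "norm (w (Suc i) - w i) \<le> d / N" for i
  proof -
    have "w (Suc i) - w i = (1 / N) *\<^sub>R (b - a)"
      by (simp add: w_def add_divide_distrib algebra_simps)
    then show ?thesis using dist_le_d[OF b a] N by (simp add: divide_right_mono)
  qed
  have ll: "\<mu>\<^sup>2 / \<mu> = \<mu>" using l by (simp add: power2_eq_square)
  have za: "norm (z i - a) \<le> real i / N * d + \<mu>" if "i \<le> N" for i
    using resolvent_dist[OF l z(1)[OF that] z(2)[OF that] a Ta] wa[OF that] ll by simp
  have zb: "norm (z i - b) \<le> (1 - real i / N) * d + \<mu>" if "i \<le> N" for i
    using resolvent_dist[OF l z(1)[OF that] z(2)[OF that] b Tb] wb[OF that] ll by simp
  have zT: "norm (T (z i) - z i) \<le> \<mu> * d" if "i \<le> N" for i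
    using resolvent_displacement[OF l(1) wK[OF that] z(1)[OF that] z(2)[OF that]] .
  have l2: "\<mu>\<^sup>2 \<le> \<mu> * (d + 1)"
    using l d_nonneg mult_left_mono[of \<mu> "d + 1" \<mu>] by (simp add: power2_eq_square)
  have zz: "norm (z (Suc i) - z i) \<le> d / N" if "i < N" for i
    using resolvent_nonexpansive[OF l z(1)[of "Suc i"] z(2)[of "Suc i"] z(1)[of i] z(2)[of i]] ww[of i] that by simp
  \<comment> \<open>The resolvents belonging to the end points may differ from \<open>a\<close> and
    \<open>b\<close>, so the ends are put in by hand. The first and the last step are then bounded
    by \<open>za\<close> and \<open>zb\<close> instead of \<open>zz\<close>.\<close>
  define y where "y i = (if i = 0 then a else if i = N then b else z i)" for i
  show ?thesis
  proof (intro exI[of _ y] conjI allI impI)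
    show "y 0 = a" "y N = b" using N by (auto simp: y_def)
    fix i
    have "norm (b - a) \<le> d + \<mu>" "norm (a - b) \<le> d + \<mu>" 
      using dist_le_d[OF b a] dist_le_d[OF a b] l by auto
    note ba = this
    {
      assume i: "i \<le> N"
      show "y i \<in> K" using z(1)[OF i] a b by (simp add: y_def)
      have "\<mu> * d \<le> \<mu> * (d + 1)" using l by simp
      then show "norm (T (y i) - y i) \<le> \<mu> * (d + 1)"
        using zT[OF i] Ta Tb l2 by (auto simp: y_def)
      show "norm (y i - a) \<le> real i / N * d + \<mu>" using za[OF i] ba N l by (auto simp: y_def)
      show "norm (y i - b) \<le> (1 - real i / N) * d + \<mu>" using zb[OF i] ba N l by (auto simp: y_def)
    }
    assume i: "i < N"
    have s1: "real (Suc 0) / N * d = d / N" by simp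
    have s2: "(1 - real i / N) * d = d / N" if "Suc i = N"
      using N unfolding that[symmetric] by (simp add: field_simps)
    show "norm (y (Suc i) - y i) \<le> d / N + \<mu>"
    proof (cases "i = 0")
      case True
      show ?thesis
      proof (cases "N = 1")
        case True
        then show ?thesis using \<open>i = 0\<close> ba by (simp add: y_def)
      next
        case False
        then show ?thesis using \<open>i = 0\<close> za[of 1] N by (simp add: y_def)
      qed
    next
      case i0: False
      show ?thesis
      proof (cases "Suc i = N")
        case True
        have "norm (b - z i) \<le> d / N + \<mu>"
          using zb[of i] s2[OF True] i by (simp add: norm_minus_commute[of b])
        then show ?thesis using True i0 by (simp add: y_def)
      next
        case False
        then show ?thesis using zz[OF i] i0 i l by (simp add: y_def)
      qed
    qed
  qed
qed

end


section \<open>Independent chains along iterated ultrafilters\<close>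

lemma weak_limit_lower:
  fixes c :: "'i \<Rightarrow> 'a::euclidean_space L1"
  assumes U: "ultra U" and K: "equi_int K" "closed K" "convex K" and c: "\<And>i. c i \<in> K"
  obtains k where "k \<in> K"
    "\<And>y \<epsilon>. \<epsilon> > 0 \<Longrightarrow> eventually (\<lambda>i. norm (y - k) - \<epsilon> \<le> norm (y - c i)) U"
proof -
  obtain k where k: "k \<in> K" "\<And>y r. eventually (\<lambda>i. norm (y - c i) \<le> r) U \<Longrightarrow> norm (y - k) \<le> r"
    using ultra_weak_limit[of U K c, OF U K c] by auto
  have "eventually (\<lambda>i. norm (y - k) - \<epsilon> \<le> norm (y - c i)) U" if e: "\<epsilon> > 0" for y \<epsilon>
  proof (rule ccontr)
    assume "\<not> ?thesis"
    \<comment> \<open>The negation holds eventually along an ultrafilter, so the values eventually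
      lie in a ball about \<open>y\<close> that is too small to contain \<open>k\<close>, although
      the weak limit has to lie in it.\<close>
    then have "eventually (\<lambda>i. \<not> norm (y - k) - \<epsilon> \<le> norm (y - c i)) U"
      by (simp only: ultra_not_eventually[OF U])
    then have "eventually (\<lambda>i. norm (y - c i) \<le> norm (y - k) - \<epsilon>) U" by eventually_elim simp
    from k(2)[OF this] show False using e by simp
  qed
  then show ?thesis using that k(1) by blast
qed

text \<open>The distance of \<open>a\<close> from the midpoint of \<open>b\<close> and
  \<open>c\<close> is half the distance of \<open>c\<close> from \<open>2 *\<^sub>R a - b\<close>.
  That point may lie outside \<open>K\<close>, which is why \<open>weak_limit_lower\<close> speaks
  about arbitrary \<open>y\<close>.\<close>

lemma half_lower:
  fixes a b k c :: "'b::real_normed_vector"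
  assumes "norm ((2 *\<^sub>R a - b) - k) - 2 * \<epsilon> \<le> norm ((2 *\<^sub>R a - b) - c)"
  shows "norm (a - (1/2) *\<^sub>R (b + k)) - \<epsilon> \<le> norm (a - (1/2) *\<^sub>R (b + c))"
proof -
  have "norm (a - (1/2) *\<^sub>R (b + x)) = (1/2) * norm ((2 *\<^sub>R a - b) - x)" for x
  proof -
    have "a - (1/2) *\<^sub>R (b + x) = (1/2) *\<^sub>R ((2 *\<^sub>R a - b) - x)" by (simp add: algebra_simps)
    then show ?thesis by simp
  qed
  note eq = this
  show ?thesis unfolding eq using assms by simp
qed

text \<open>In a set of diameter \<open>d\<close>, a value \<open>r\<close> close to
  \<open>d\<close> also forces the three mutual distances to be close to \<open>d\<close>, since
  each median is at most the mean of two sides.\<close>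

definition midpoint_far :: "real \<Rightarrow> 'b::real_normed_vector \<Rightarrow> 'b \<Rightarrow> 'b \<Rightarrow> bool" where
  "midpoint_far r a b c \<longleftrightarrow> r \<le> norm (a - (1/2) *\<^sub>R (b + c)) \<and>
     r \<le> norm (b - (1/2) *\<^sub>R (a + c)) \<and> r \<le> norm (c - (1/2) *\<^sub>R (a + b))"

text \<open>The Fubini product of \<open>U\<close> with itself: the second coordinate is chosen
  late, depending on the first.\<close>

definition iterate_filter :: "'i filter \<Rightarrow> ('i \<times> 'i) filter" where
  "iterate_filter U = Abs_filter (\<lambda>P. eventually (\<lambda>a. eventually (\<lambda>b. P (a, b)) U) U)"

lemma eventually_iterate_filter:
  "eventually P (iterate_filter U) \<longleftrightarrow> eventually (\<lambda>a. eventually (\<lambda>b. P (a, b)) U) U"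
  unfolding iterate_filter_def
proof (rule eventually_Abs_filter, rule is_filter.intro)
  fix P Q assume "eventually (\<lambda>a. eventually (\<lambda>b. P (a, b)) U) U" "eventually (\<lambda>a. eventually (\<lambda>b. Q (a, b)) U) U"
  then show "eventually (\<lambda>a. eventually (\<lambda>b. P (a, b) \<and> Q (a, b)) U) U"
    by eventually_elim (rule eventually_conj)
next
  fix P Q :: "'a \<times> 'a \<Rightarrow> bool" 
  assume PQ: "\<forall>x. P x \<longrightarrow> Q x" and "eventually (\<lambda>a. eventually (\<lambda>b. P (a, b)) U) U"
  from this(2) show "eventually (\<lambda>a. eventually (\<lambda>b. Q (a, b)) U) U"
    by eventually_elim (use PQ in \<open>auto elim: eventually_mono\<close>)
qed simp

lemma ultra_iterate_filter:
  assumes "ultra U" shows "ultra (iterate_filter U)"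
  unfolding ultra_def eventually_iterate_filter
proof (intro conjI allI)
  show "iterate_filter U \<noteq> bot"
    using assms by (simp add: trivial_limit_def eventually_iterate_filter ultra_def)
  fix P
  show "eventually (\<lambda>a. eventually (\<lambda>b. P (a, b)) U) U \<or> eventually (\<lambda>a. eventually (\<lambda>b. \<not> P (a, b)) U) U"
    unfolding ultra_not_eventually[OF assms, symmetric] by blast
qed

context minimal_invariant
begin

lemma Goebel_Karlovitz_eventually:
  assumes c: "\<And>i. c i \<in> K" and small: "\<And>\<delta>. \<delta> > 0 \<Longrightarrow> eventually (\<lambda>i. norm (T (c i) - c i) \<le> \<delta>) F"
    and y: "y \<in> K" and e: "\<epsilon> > 0"
  shows "eventually (\<lambda>i. d - \<epsilon> \<le> norm (c i - y)) F"
proof -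
  obtain \<delta> where "\<delta> > 0" and \<delta>: "\<forall>w\<in>K. norm (T w - w) \<le> \<delta> \<longrightarrow> d - \<epsilon> \<le> norm (w - y)"
    using Goebel_Karlovitz[OF y e] by blast
  from small[OF \<open>\<delta> > 0\<close>] show ?thesis by eventually_elim (use \<delta> c in blast)
qed

lemma midpoint_in: "x \<in> K \<Longrightarrow> y \<in> K \<Longrightarrow> (1/2) *\<^sub>R (x + y) \<in> K"
  using convexD[OF convex_K, of x y "1/2" "1/2"] by (simp add: scaleR_add_right)

text \<open>Mutually far apart copies of a chain: \<open>p n\<close>, \<open>q n\<close> and all \<open>z n i\<close> behave like independent
  samples (for different \<open>n\<close>), relative to the metric midpoints.\<close>

lemma exists_independent_chains:
  fixes N :: nat
  assumes N: "0 < N" and e: "0 < \<epsilon>"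
  obtains p q :: "nat \<Rightarrow> 'a L1" and z :: "nat \<Rightarrow> nat \<Rightarrow> 'a L1"
  where "\<And>n. z n 0 = p n" "\<And>n. z n N = q n" "\<And>n i. i \<le> N \<Longrightarrow> z n i \<in> K"
    "\<And>n i. i \<le> N \<Longrightarrow> norm (z n i - p n) \<le> real i / N * d + \<epsilon>"
    "\<And>n i. i \<le> N \<Longrightarrow> norm (z n i - q n) \<le> (1 - real i / N) * d + \<epsilon>"
    "\<And>n i. i < N \<Longrightarrow> norm (z n (Suc i) - z n i) \<le> d / N + \<epsilon>"
    "\<And>n. d - \<epsilon> \<le> norm (p n - q n)"
    "\<And>n m i. n \<noteq> m \<Longrightarrow> i \<le> N \<Longrightarrow> midpoint_far (d - \<epsilon>) (p n) (q n) (z m i)"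
proof -
  obtain x0 where x0: "x0 \<in> K" using K_nonempty by blast
  have "\<exists>u\<in>K. norm (T u - u) \<le> (1 / real (Suc n))\<^sup>2" for n
  proof -
    define m where "m = (1 / real (Suc n))\<^sup>2 / (d + 1)"
    have m: "0 < m" "m \<le> 1" "m * d \<le> (1 / real (Suc n))\<^sup>2"
    proof -
      have s: "(1 / real (Suc n))\<^sup>2 \<le> 1" by (simp add: power_le_one)
      show "0 < m" using d_nonneg by (simp add: m_def)
      show "m \<le> 1" using d_nonneg s by (simp add: m_def divide_le_eq)
      have "m * (d + 1) = (1 / real (Suc n))\<^sup>2" using d_nonneg by (simp add: m_def)
      then show "m * d \<le> (1 / real (Suc n))\<^sup>2" using \<open>0 < m\<close> by (simp add: distrib_left)
    qed
    obtain u where "u \<in> K" "u = (1 - m) *\<^sub>R T u + m *\<^sub>R x0" using resolvent[OF m(1,2) x0] by blast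
    then show ?thesis using resolvent_displacement[OF m(1) x0, of u] m(3) by (intro bexI[of _ u]) auto
  qed
  then obtain u where u: "\<And>n. u n \<in> K" "\<And>n. norm (T (u n) - u n) \<le> (1 / real (Suc n))\<^sup>2" by metis
  define x1 x2 where "x1 g = u (fst g)" and "x2 g = u (snd g)" for g :: "nat \<times> nat"
  \<comment> \<open>The chain between two approximate fixed points takes its parameter from the
    worse one, so that both displacements are at most \<open>(l g)\<^sup>2\<close> as
    \<open>chain\<close> requires.\<close>
  define l where "l g = 1 / real (Suc (min (fst g) (snd g)))" for g :: "nat \<times> nat"
  have l: "0 < l g" "l g \<le> 1" for g by (auto simp: l_def)
  have lu: "norm (T (x1 g) - x1 g) \<le> (l g)\<^sup>2" "norm (T (x2 g) - x2 g) \<le> (l g)\<^sup>2" for g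
  proof -
    have "(1 / real (Suc n))\<^sup>2 \<le> (l g)\<^sup>2" if "min (fst g) (snd g) \<le> n" for n
      using that by (intro power_mono) (auto simp: l_def divide_simps)
    then show "norm (T (x1 g) - x1 g) \<le> (l g)\<^sup>2" "norm (T (x2 g) - x2 g) \<le> (l g)\<^sup>2"
      using u(2)[of "fst g"] u(2)[of "snd g"] order_trans unfolding x1_def x2_def by (meson min.cobounded1 min.cobounded2)+
  qed
  have x12: "x1 g \<in> K" "x2 g \<in> K" for g by (auto simp: x1_def x2_def u)
  obtain z where z: "\<And>g. z g 0 = x1 g" "\<And>g. z g N = x2 g" "\<And>g i. i \<le> N \<Longrightarrow> z g i \<in> K"
      "\<And>g i. i \<le> N \<Longrightarrow> norm (T (z g i) - z g i) \<le> l g * (d + 1)"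
      "\<And>g i. i \<le> N \<Longrightarrow> norm (z g i - x1 g) \<le> real i / N * d + l g"
      "\<And>g i. i \<le> N \<Longrightarrow> norm (z g i - x2 g) \<le> (1 - real i / N) * d + l g"
      "\<And>g i. i < N \<Longrightarrow> norm (z g (Suc i) - z g i) \<le> d / N + l g"
    using chain[OF N x12 l lu] by metis
  obtain U :: "nat filter" where U: "ultra U" "U \<le> sequentially"
    using ultra_exists[of sequentially] by auto
  define W where "W = iterate_filter U"
  have W: "ultra W" unfolding W_def using U(1) by (rule ultra_iterate_filter)
  have evW: "eventually P W \<longleftrightarrow> eventually (\<lambda>a. eventually (\<lambda>b. P (a, b)) U) U" for P
    unfolding W_def by (rule eventually_iterate_filter)
  have l_small: "eventually (\<lambda>g. l g \<le> \<delta>) W" if \<delta>: "\<delta> > 0" for \<delta>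
  proof -
    obtain n0 where n0: "1 / real (Suc n0) < \<delta>" using nat_approx_posE[OF \<delta>] by auto
    have ev: "eventually (\<lambda>a. n0 \<le> a) U" using U(2) eventually_ge_at_top[of n0] by (rule filter_leD)
    have "l (a, b) \<le> \<delta>" if "n0 \<le> a" "n0 \<le> b" for a b
    proof -
      have "l (a, b) \<le> 1 / real (Suc n0)" using that by (simp add: l_def divide_simps)
      then show ?thesis using n0 by simp
    qed
    note * = this
    show ?thesis
      unfolding evW using ev
    proof eventually_elim
      case (elim a)
      from ev show ?case by eventually_elim (use elim * in blast)
    qed
  qed
  have u_small: "eventually (\<lambda>n. norm (T (u n) - u n) \<le> \<delta>) U" if "\<delta> > 0" for \<delta>
  proof -
    have "(\<lambda>n. (1 / real (Suc n))\<^sup>2) \<longlonglongrightarrow> 0\<^sup>2"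
      by (intro tendsto_power LIMSEQ_Suc[OF lim_1_over_n])
    then have "eventually (\<lambda>n. (1 / real (Suc n))\<^sup>2 < \<delta>) sequentially"
      using that by (intro order_tendstoD(2)) auto
    then have "eventually (\<lambda>n. (1 / real (Suc n))\<^sup>2 < \<delta>) U" by (rule filter_leD[OF U(2)])
    then show ?thesis
    proof eventually_elim
      case (elim n)
      then show ?case using u(2)[of n] by linarith
    qed
  qed
  have z_small: "eventually (\<lambda>g. norm (T (z g i) - z g i) \<le> \<delta>) W" if i: "i \<le> N" and "\<delta> > 0" for \<delta> i
  proof -
    have "\<delta> / (d + 1) > 0" using that d_nonneg by simp
    from l_small[OF this] show ?thesis
    proof eventually_elim
      case (elim g)
      then have "l g * (d + 1) \<le> \<delta>" using d_nonneg by (simp add: le_divide_eq)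
      then show ?case using z(4)[OF i, of g] by linarith
    qed
  qed
  have GKu: "eventually (\<lambda>n. d - \<epsilon>' \<le> norm (u n - y)) U" if "y \<in> K" "\<epsilon>' > 0" for y \<epsilon>'
    using Goebel_Karlovitz_eventually[of u U, OF u(1) u_small that] .
  have GKz: "eventually (\<lambda>g. d - \<epsilon>' \<le> norm (z g i - y)) W" if i: "i \<le> N" and "y \<in> K" "\<epsilon>' > 0" for y \<epsilon>' i
    using Goebel_Karlovitz_eventually[of "\<lambda>g. z g i" W, OF z(3)[OF i] z_small[OF i] that(2,3)] .
  \<comment> \<open>The weak limits \<open>k\<close>, \<open>k'\<close> and
    \<open>\<kappa> i\<close> of the single points, of the midpoints and of the chain points belong
    to \<open>K\<close>. In the estimates below an entry that is not yet chosen is replaced by its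
    weak limit, the Goebel-Karlovitz bound is applied, and the true entry is put back for all late
    choices.\<close>
  obtain k where k: "k \<in> K" "\<And>y \<epsilon>. \<epsilon> > 0 \<Longrightarrow> eventually (\<lambda>n. norm (y - k) - \<epsilon> \<le> norm (y - u n)) U"
    using weak_limit_lower[of U K u, OF U(1) equi_int_K closed_K convex_K u(1)] by blast
  obtain k' where k': "k' \<in> K"
    "\<And>y \<epsilon>. \<epsilon> > 0 \<Longrightarrow> eventually (\<lambda>g. norm (y - k') - \<epsilon> \<le> norm (y - (1/2) *\<^sub>R (x1 g + x2 g))) W"
    using weak_limit_lower[of W K "\<lambda>g. (1/2) *\<^sub>R (x1 g + x2 g)", OF W equi_int_K closed_K convex_K midpoint_in[OF x12]] by blast
  have "\<exists>k. k \<in> K \<and> (\<forall>y \<epsilon>. \<epsilon> > 0 \<longrightarrow> eventually (\<lambda>g. norm (y - k) - \<epsilon> \<le> norm (y - z g i)) W)" if "i \<le> N" for i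
    using weak_limit_lower[of W K "\<lambda>g. z g i", OF W equi_int_K closed_K convex_K z(3)[OF that]] by metis
  then obtain \<kappa> where \<kappa>: "\<And>i. i \<le> N \<Longrightarrow> \<kappa> i \<in> K"
    "\<And>i y \<epsilon>. i \<le> N \<Longrightarrow> \<epsilon> > 0 \<Longrightarrow> eventually (\<lambda>g. norm (y - \<kappa> i) - \<epsilon> \<le> norm (y - z g i)) W"
    by metis
  have G1: "eventually (\<lambda>g. d - \<epsilon>' \<le> norm (x1 g - (1/2) *\<^sub>R (x2 g + y))) W" if y: "y \<in> K" and e': "\<epsilon>' > 0" for y \<epsilon>'
    unfolding evW
  proof (rule eventually_mono[OF GKu[OF midpoint_in[OF y k(1)], of "\<epsilon>'/2"]])
    show "\<epsilon>'/2 > 0" using e' by simp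
    fix a assume a: "d - \<epsilon>'/2 \<le> norm (u a - (1/2) *\<^sub>R (y + k))"
    show "\<forall>\<^sub>F b in U. d - \<epsilon>' \<le> norm (x1 (a, b) - (1/2) *\<^sub>R (x2 (a, b) + y))"
    proof (rule eventually_mono[OF k(2)[OF e', of "2 *\<^sub>R u a - y"]])
      fix b assume "norm (2 *\<^sub>R u a - y - k) - \<epsilon>' \<le> norm (2 *\<^sub>R u a - y - u b)"
      then have "norm (u a - (1/2) *\<^sub>R (y + k)) - \<epsilon>'/2 \<le> norm (u a - (1/2) *\<^sub>R (y + u b))"
        by (intro half_lower) simp
      then show "d - \<epsilon>' \<le> norm (x1 (a, b) - (1/2) *\<^sub>R (x2 (a, b) + y))"
        using a by (simp add: x1_def x2_def add.commute)
    qed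
  qed
  have G2: "eventually (\<lambda>g. d - \<epsilon>' \<le> norm (x2 g - (1/2) *\<^sub>R (x1 g + y))) W" if y: "y \<in> K" and e': "\<epsilon>' > 0" for y \<epsilon>'
    unfolding evW x1_def x2_def fst_conv snd_conv
    by (rule always_eventually, rule allI) (rule GKu[OF midpoint_in[OF u(1) y] e'])
  have G12: "eventually (\<lambda>g. d - \<epsilon> \<le> norm (x1 g - x2 g)) W"
    unfolding evW x1_def x2_def fst_conv snd_conv
  proof (rule always_eventually, rule allI)
    fix a show "eventually (\<lambda>b. d - \<epsilon> \<le> norm (u a - u b)) U"
      using GKu[OF u(1) e, of a] by (simp only: norm_minus_commute[of "u a"])
  qed
  \<comment> \<open>Both orders are demanded: an earlier pair against a later chain
    (\<open>Qa\<close>) and an earlier chain against a later pair (\<open>Qb\<close>).\<close>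
  define Q where "Q g h \<longleftrightarrow> (\<forall>i\<in>{..N}. midpoint_far (d - \<epsilon>) (x1 g) (x2 g) (z h i)) \<and>
      (\<forall>i\<in>{..N}. midpoint_far (d - \<epsilon>) (x1 h) (x2 h) (z g i))" for g h
  have e2: "\<epsilon>/2 > 0" using e by simp
  have Qa: "eventually (\<lambda>g. eventually (\<lambda>h. midpoint_far (d - \<epsilon>) (x1 g) (x2 g) (z h i)) W) W" if i: "i \<le> N" for i
    using G1[OF \<kappa>(1)[OF i] e2] G2[OF \<kappa>(1)[OF i] e2]
  proof eventually_elim
    case (elim g)
    show ?case
      using GKz[OF i midpoint_in[OF x12] e, of g g] \<kappa>(2)[OF i e, of "2 *\<^sub>R x1 g - x2 g"] \<kappa>(2)[OF i e, of "2 *\<^sub>R x2 g - x1 g"]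
    proof eventually_elim
      case h: (elim h)
      have "norm (x1 g - (1/2) *\<^sub>R (x2 g + \<kappa> i)) - \<epsilon>/2 \<le> norm (x1 g - (1/2) *\<^sub>R (x2 g + z h i))"
        using h(2) by (intro half_lower) simp
      moreover have "norm (x2 g - (1/2) *\<^sub>R (x1 g + \<kappa> i)) - \<epsilon>/2 \<le> norm (x2 g - (1/2) *\<^sub>R (x1 g + z h i))"
        using h(3) by (intro half_lower) simp
      ultimately show ?case using elim h(1) by (simp add: midpoint_far_def)
    qed
  qed
  have Qb: "eventually (\<lambda>g. eventually (\<lambda>h. midpoint_far (d - \<epsilon>) (x1 h) (x2 h) (z g i)) W) W" if i: "i \<le> N" for i
    using GKz[OF i k'(1) e2]
  proof eventually_elim
    case (elim g)
    show ?case
      using G1[OF z(3)[OF i, of g] e] G2[OF z(3)[OF i, of g] e] k'(2)[OF e2, of "z g i"]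
      by eventually_elim (use elim in \<open>simp add: midpoint_far_def\<close>)
  qed
  have "eventually (\<lambda>g. \<forall>i\<in>{..N}. eventually (\<lambda>h. midpoint_far (d - \<epsilon>) (x1 g) (x2 g) (z h i)) W) W"
    using Qa by (intro eventually_ball_finite) auto
  moreover have "eventually (\<lambda>g. \<forall>i\<in>{..N}. eventually (\<lambda>h. midpoint_far (d - \<epsilon>) (x1 h) (x2 h) (z g i)) W) W"
    using Qb by (intro eventually_ball_finite) auto
  ultimately have Q: "eventually (\<lambda>g. eventually (Q g) W) W"
  proof eventually_elim
    case (elim g)
    then have "eventually (\<lambda>h. \<forall>i\<in>{..N}. midpoint_far (d - \<epsilon>) (x1 g) (x2 g) (z h i)) W"
      "eventually (\<lambda>h. \<forall>i\<in>{..N}. midpoint_far (d - \<epsilon>) (x1 h) (x2 h) (z g i)) W"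
      by (auto intro!: eventually_ball_finite)
    then show ?case unfolding Q_def by (rule eventually_conj)
  qed
  \<comment> \<open>The last conjunct records that \<open>g\<close> leaves room for later
    independent choices, which keeps the selection going.\<close>
  define S where "S g \<longleftrightarrow> d - \<epsilon> \<le> norm (x1 g - x2 g) \<and> l g \<le> \<epsilon> \<and> eventually (Q g) W" for g
  have S: "eventually S W"
    unfolding S_def using G12 l_small[OF e] Q by eventually_elim simp
  have "\<exists>f. \<forall>n::nat. S (f n) \<and> (\<forall>m<n. Q (f m) (f n))"
  proof -
    \<comment> \<open>The choice principle presents arbitrary predecessors. The premise
      \<open>S (f m)\<close> makes the selection step possible for them and is discharged
      afterwards.\<close>
    have "\<exists>f. \<forall>n::nat. S (f n) \<and> (\<forall>m<n. S (f m) \<longrightarrow> Q (f m) (f n))"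
    proof (rule dependent_wellorder_choice)
      fix r and f g :: "nat \<Rightarrow> nat \<times> nat" and n :: nat assume "\<And>m. m < n \<Longrightarrow> f m = g m"
      then show "(S r \<and> (\<forall>m<n. S (f m) \<longrightarrow> Q (f m) r)) = (S r \<and> (\<forall>m<n. S (g m) \<longrightarrow> Q (g m) r))"
        by auto
    next
      fix n :: nat and f :: "nat \<Rightarrow> nat \<times> nat"
      have "eventually (\<lambda>r. S r \<and> (\<forall>m\<in>{..<n}. S (f m) \<longrightarrow> Q (f m) r)) W"
      proof (intro eventually_conj S eventually_ball_finite ballI)
        fix m show "eventually (\<lambda>r. S (f m) \<longrightarrow> Q (f m) r) W"
          by (cases "S (f m)") (auto simp: S_def)
      qed simp
      moreover have "W \<noteq> bot" using W by (simp add: ultra_def)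
      ultimately have "\<exists>r. S r \<and> (\<forall>m\<in>{..<n}. S (f m) \<longrightarrow> Q (f m) r)" by (rule eventually_happens'[rotated])
      then show "\<exists>r. S r \<and> (\<forall>m<n. S (f m) \<longrightarrow> Q (f m) r)" by auto
    qed
    then show ?thesis by blast
  qed
  then obtain f where f: "\<And>n::nat. S (f n)" "\<And>n m. m < n \<Longrightarrow> Q (f m) (f n)" by blast
  have lf: "l (f n) \<le> \<epsilon>" for n using f(1)[of n] by (simp add: S_def)
  show ?thesis
  proof (rule that[of "\<lambda>n. z (f n)" "\<lambda>n. x1 (f n)" "\<lambda>n. x2 (f n)"])
    fix n m i :: nat assume "n \<noteq> m" and i: "i \<le> N"
    then consider "n < m" | "m < n" by linarith
    then show "midpoint_far (d - \<epsilon>) (x1 (f n)) (x2 (f n)) (z (f m) i)"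
      by cases (use f(2) i in \<open>auto simp: Q_def\<close>)
  next
    fix n show "d - \<epsilon> \<le> norm (x1 (f n) - x2 (f n))" using f(1)[of n] by (simp add: S_def)
  next
    fix n i assume i: "i \<le> N"
    show "norm (z (f n) i - x1 (f n)) \<le> real i / N * d + \<epsilon>" using z(5)[OF i, of "f n"] lf[of n] by linarith
    show "norm (z (f n) i - x2 (f n)) \<le> (1 - real i / N) * d + \<epsilon>" using z(6)[OF i, of "f n"] lf[of n] by linarith
  next
    fix n i assume i: "i < N"
    show "norm (z (f n) (Suc i) - z (f n) i) \<le> d / N + \<epsilon>" using z(7)[OF i, of "f n"] lf[of n] by linarith
  qed (use z in auto)
qed

end

section \<open>Midpoint deficits\<close>

definition min_dist3 :: "'b::real_normed_vector \<Rightarrow> 'b \<Rightarrow> 'b \<Rightarrow> real" where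
  "min_dist3 a b c = min (norm (a - b)) (min (norm (b - c)) (norm (a - c)))"

text \<open>With \<open>s = norm u + norm v\<close> and \<open>r = norm (u + v)\<close>, the
  identity \<open>(s - r) * (s + r) = 2 * (norm u * norm v - u \<bullet> v)\<close> and
  \<open>s + r \<le> 2 * s\<close> turn the angle into a deficit; \<open>h\<close> enters through
  \<open>h / 2 * s \<le> norm u * norm v\<close>.\<close>

lemma triangle_gap:
  fixes u v :: "'b::real_inner"
  assumes "u \<noteq> 0" "v \<noteq> 0" and h: "h \<le> norm u" "h \<le> norm v"
  shows "h / 2 * (1 - (u /\<^sub>R norm u) \<bullet> (v /\<^sub>R norm v)) \<le> norm u + norm v - norm (u + v)"
proof -
  define s r m where "s = norm u + norm v" and "r = norm (u + v)" and "m = norm u * norm v"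
  have pos: "norm u > 0" "norm v > 0" "m > 0" "s > 0" using assms by (auto simp: m_def s_def add_pos_pos)
  have rs: "r \<le> s" unfolding r_def s_def by (rule norm_triangle_ineq)
  have "(s - r) * (s + r) = 2 * (m - u \<bullet> v)"
    using power2_norm_eq_inner[of "u + v"] power2_norm_eq_inner[of u] power2_norm_eq_inner[of v]
    by (simp add: s_def r_def m_def inner_simps inner_commute power2_eq_square algebra_simps)
  moreover have "(s - r) * (s + r) \<le> (s - r) * (2 * s)" using rs by (intro mult_left_mono) auto
  ultimately have 1: "m - u \<bullet> v \<le> (s - r) * s" by simp
  have "h * norm v \<le> m" "h * norm u \<le> m"
    using mult_right_mono[OF h(1), of "norm v"] mult_right_mono[OF h(2), of "norm u"] by (simp_all add: m_def mult.commute)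
  then have 2: "h / 2 * s \<le> m" by (simp add: s_def algebra_simps)
  define t where "t = (u /\<^sub>R norm u) \<bullet> (v /\<^sub>R norm v)"
  have "t = (u \<bullet> v) / m" by (simp add: t_def m_def divide_inverse)
  then have t: "u \<bullet> v = m * t" using pos by simp
  have "t \<le> 1" using norm_cauchy_schwarz[of u v] pos by (simp add: t m_def[symmetric])
  then have "h / 2 * s * (1 - t) \<le> m * (1 - t)" using 2 by (intro mult_right_mono) auto
  also have "\<dots> \<le> (s - r) * s" using 1 by (simp add: t algebra_simps)
  finally have "(h / 2 * (1 - t)) * s \<le> (s - r) * s" by (simp add: mult.assoc mult.commute[of s])
  then show ?thesis using pos by (simp add: s_def r_def t_def)
qed

text \<open>The cosines of a triangle add up to at most 3/2, so that not all midpoint deficits can be small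
  compared to the shortest side.\<close>

lemma min_dist3_le:
  fixes a b c :: "'b::real_inner"
  shows "min_dist3 a b c \<le> 8/3 * (norm (a - b) + norm (b - c) + norm (a - c)
    - norm (a - (1/2) *\<^sub>R (b + c)) - norm (b - (1/2) *\<^sub>R (a + c)) - norm (c - (1/2) *\<^sub>R (a + b)))"
proof -
  have mid: "2 * norm (x - (1/2) *\<^sub>R (y + w)) = norm ((x - y) + (x - w))" for x y w :: 'b
  proof -
    have "(x - y) + (x - w) = 2 *\<^sub>R (x - (1/2) *\<^sub>R (y + w))" by (simp add: algebra_simps scaleR_2)
    then show ?thesis by simp
  qed
  have tri: "norm ((x - y) + (x - w)) \<le> norm (x - y) + norm (x - w)" for x y w :: 'b
    by (rule norm_triangle_ineq)
  show ?thesis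
  proof (cases "a = b \<or> b = c \<or> a = c")
    case True
    then have "min_dist3 a b c = 0" by (auto simp: min_dist3_def)
    moreover have "norm (x - (1/2) *\<^sub>R (y + w)) \<le> (norm (x - y) + norm (x - w)) / 2" for x y w :: 'b
      using mid[of x y w] tri[of x y w] by simp
    from this[of a b c] this[of b a c] this[of c a b]
    have "0 \<le> norm (a - b) + norm (b - c) + norm (a - c)
      - norm (a - (1/2) *\<^sub>R (b + c)) - norm (b - (1/2) *\<^sub>R (a + c)) - norm (c - (1/2) *\<^sub>R (a + b))"
      by (simp add: norm_minus_commute[of b a] norm_minus_commute[of c a] norm_minus_commute[of c b])
    ultimately show ?thesis by simp
  next
    case False
    define h where "h = min_dist3 a b c"
    have h: "h \<le> norm (a - b)" "h \<le> norm (b - c)" "h \<le> norm (a - c)" "0 \<le> h"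
      by (auto simp: h_def min_dist3_def)
    define P Q R where "P = (a - b) /\<^sub>R norm (a - b)" and "Q = (b - c) /\<^sub>R norm (b - c)"
      and "R = (c - a) /\<^sub>R norm (c - a)"
    have P': "(b - a) /\<^sub>R norm (b - a) = - P" and Q': "(c - b) /\<^sub>R norm (c - b) = - Q"
      and R': "(a - c) /\<^sub>R norm (a - c) = - R"
      by (simp_all add: P_def Q_def R_def norm_minus_commute scaleR_diff_right)
    have nz: "a - b \<noteq> 0" "b - a \<noteq> 0" "b - c \<noteq> 0" "c - b \<noteq> 0" "a - c \<noteq> 0" "c - a \<noteq> 0"
      using False by auto
    have h': "h \<le> norm (b - a)" "h \<le> norm (c - b)" "h \<le> norm (c - a)"
      using h by (simp_all add: norm_minus_commute)
    have A: "h / 2 * (1 + P \<bullet> R) \<le> norm (a - b) + norm (a - c) - norm ((a - b) + (a - c))"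
      using triangle_gap[OF nz(1,5) h(1,3)] unfolding P_def[symmetric] R' by simp
    have B: "h / 2 * (1 + P \<bullet> Q) \<le> norm (b - a) + norm (b - c) - norm ((b - a) + (b - c))"
      using triangle_gap[OF nz(2,3) h'(1) h(2)] unfolding Q_def[symmetric] P' by simp
    have C: "h / 2 * (1 + R \<bullet> Q) \<le> norm (c - a) + norm (c - b) - norm ((c - a) + (c - b))"
      using triangle_gap[OF nz(6,4) h'(3,2)] unfolding R_def[symmetric] Q' by simp
    have unit: "(w /\<^sub>R norm w) \<bullet> (w /\<^sub>R norm w) = 1" if "w \<noteq> 0" for w :: 'b
      using that by (simp add: dot_square_norm power2_eq_square)
    have one: "P \<bullet> P = 1" "Q \<bullet> Q = 1" "R \<bullet> R = 1"
      unfolding P_def Q_def R_def by (rule unit[OF nz(1)], rule unit[OF nz(3)], rule unit[OF nz(6)])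
    \<comment> \<open>\<open>P\<close>, \<open>Q\<close>, \<open>R\<close> are unit vectors running
      round the triangle, and the cosines of its angles are the negatives of their inner products.
      So the three values of one minus cosine add up to at least 3/2, and
      \<open>triangle_gap\<close> gives \<open>3/4 * h\<close> as a lower bound for twice the total
      deficit; hence the constant 8/3.\<close>
    have "0 \<le> (P + Q + R) \<bullet> (P + Q + R)" by simp
    also have "\<dots> = 3 + 2 * (P \<bullet> R + P \<bullet> Q + R \<bullet> Q)"
      by (simp add: inner_simps one inner_commute)
    finally have "3/2 \<le> (1 + P \<bullet> R) + (1 + P \<bullet> Q) + (1 + R \<bullet> Q)" by simp
    then have "h / 2 * (3/2) \<le> h / 2 * ((1 + P \<bullet> R) + (1 + P \<bullet> Q) + (1 + R \<bullet> Q))"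
      using h(4) by (intro mult_left_mono) auto
    then have "h / 2 * (3/2) \<le> h / 2 * (1 + P \<bullet> R) + h / 2 * (1 + P \<bullet> Q) + h / 2 * (1 + R \<bullet> Q)"
      by (simp add: distrib_left)
    from order_trans[OF this add_mono[OF add_mono[OF A B] C]]
    have "h * (3/4) \<le> 2 * (norm (a - b) + norm (b - c) + norm (a - c) - norm (a - (1/2) *\<^sub>R (b + c))
      - norm (b - (1/2) *\<^sub>R (a + c)) - norm (c - (1/2) *\<^sub>R (a + b)))"
      unfolding mid[symmetric] norm_minus_commute[of b a] norm_minus_commute[of c a] norm_minus_commute[of c b]
      by simp
    then show ?thesis unfolding h_def[symmetric] by simp
  qed
qed

section \<open>Integrated deficits\<close>

lemma norm_diff_eq_integral: "norm (f - g) = (\<integral>x. norm (rep_L1 f x - rep_L1 g x) \<partial>I01)"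
  unfolding norm_L1_eq
proof (rule integral_cong_AE)
  show "AE x in I01. norm (rep_L1 (f - g) x) = norm (rep_L1 f x - rep_L1 g x)"
    using AE_rep_diff[of f g] by eventually_elim simp
qed auto

lemma excess_diff_eq_integral: "excess c (f - g) = (\<integral>x. max (norm (rep_L1 f x - rep_L1 g x) - c) 0 \<partial>I01)"
  unfolding excess_def
proof (rule integral_cong_AE)
  show "AE x in I01. max (norm (rep_L1 (f - g) x) - c) 0 = max (norm (rep_L1 f x - rep_L1 g x) - c) 0"
    using AE_rep_diff[of f g] by eventually_elim simp
qed auto

lemma norm_midpoint_eq_integral:
  "norm (f - (1/2) *\<^sub>R (g + h)) = (\<integral>x. norm (rep_L1 f x - (1/2) *\<^sub>R (rep_L1 g x + rep_L1 h x)) \<partial>I01)"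
  unfolding norm_diff_eq_integral
proof (rule integral_cong_AE)
  show "AE x in I01. norm (rep_L1 f x - rep_L1 ((1/2) *\<^sub>R (g + h)) x) =
      norm (rep_L1 f x - (1/2) *\<^sub>R (rep_L1 g x + rep_L1 h x))"
    using AE_rep_add[of g h] AE_rep_scaleR[of "1/2" "g + h"] by eventually_elim simp
qed auto

lemma integrable_min_dist3 [simp, intro]:
  "integrable I01 (\<lambda>x. min_dist3 (rep_L1 f x) (rep_L1 g x) (rep_L1 h x))"
  unfolding min_dist3_def by (intro integrable_min integrable_norm Bochner_Integration.integrable_diff) auto

lemma integrable_norm_diff [simp, intro]: "integrable I01 (\<lambda>x. norm (rep_L1 f x - rep_L1 g x))"
  by (intro integrable_norm Bochner_Integration.integrable_diff) auto

lemma integrable_norm_midpoint [simp, intro]: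
  "integrable I01 (\<lambda>x. norm (rep_L1 f x - (1/2) *\<^sub>R (rep_L1 g x + rep_L1 h x)))"
  by (intro integrable_norm Bochner_Integration.integrable_diff integrable_scaleR_right Bochner_Integration.integrable_add) auto

lemma integrable_excess_diff [simp, intro]:
  "integrable I01 (\<lambda>x. max (norm (rep_L1 f x - rep_L1 g x) - c) 0)"
  by (intro integrable_max Bochner_Integration.integrable_diff integrable_norm) auto

text \<open>The deficit is linear in norms, so its integral is the sum of the three sides minus the
  three medians in the L1 norm, at most \<open>3 * d - 3 * (d - \<epsilon>)\<close>.\<close>

lemma integral_min_dist3_le:
  fixes f g h :: "'a::euclidean_space L1"
  assumes "norm (f - g) \<le> d" "norm (g - h) \<le> d" "norm (f - h) \<le> d" and far: "midpoint_far (d - \<epsilon>) f g h"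
  shows "(\<integral>x. min_dist3 (rep_L1 f x) (rep_L1 g x) (rep_L1 h x) \<partial>I01) \<le> 8 * \<epsilon>"
proof -
  let ?F = "rep_L1 f" and ?G = "rep_L1 g" and ?H = "rep_L1 h"
  have "(\<integral>x. min_dist3 (?F x) (?G x) (?H x) \<partial>I01) \<le> (\<integral>x. 8/3 * (norm (?F x - ?G x) + norm (?G x - ?H x) + norm (?F x - ?H x)
    - norm (?F x - (1/2) *\<^sub>R (?G x + ?H x)) - norm (?G x - (1/2) *\<^sub>R (?F x + ?H x)) - norm (?H x - (1/2) *\<^sub>R (?F x + ?G x))) \<partial>I01)"
    by (rule Bochner_Integration.integral_mono[OF _ _ min_dist3_le])
      (intro integrable_min_dist3 integrable_mult_right Bochner_Integration.integrable_diff
        Bochner_Integration.integrable_add integrable_norm_diff integrable_norm_midpoint)+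
  also have "\<dots> = 8/3 * (norm (f - g) + norm (g - h) + norm (f - h)
    - norm (f - (1/2) *\<^sub>R (g + h)) - norm (g - (1/2) *\<^sub>R (f + h)) - norm (h - (1/2) *\<^sub>R (f + g)))"
    unfolding norm_midpoint_eq_integral norm_diff_eq_integral[of f g] norm_diff_eq_integral[of g h]
      norm_diff_eq_integral[of f h]
    by simp
  also have "\<dots> \<le> 8/3 * (3 * \<epsilon>)"
    using assms by (intro mult_left_mono) (auto simp: midpoint_far_def)
  finally show ?thesis by simp
qed

lemma min_dist3_cases:
  assumes "min_dist3 a b c \<le> e" "e < norm (a - b)"
  shows "norm (c - a) \<le> e \<or> norm (c - b) \<le> e"
  using assms by (auto simp: min_dist3_def min_le_iff_disj norm_minus_commute)

text \<open>At most one of the pairs \<open>(p n, q n)\<close> can be spread out while all others are concentrated;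
  whenever two pairs are spread out, they take the same two values, and \<open>z n\<close> takes one of them.\<close>

lemma sum_min_dist_le:
  fixes p q z :: "nat \<Rightarrow> 'b::real_normed_vector"
  assumes e: "0 \<le> e" and D: "0 \<le> D" "\<And>n. n < M \<Longrightarrow> norm (p n - q n) \<le> D"
    and tri: "\<And>n m. n < M \<Longrightarrow> m < M \<Longrightarrow> n \<noteq> m \<Longrightarrow> min_dist3 (p n) (q n) (p m) \<le> e"
      "\<And>n m. n < M \<Longrightarrow> m < M \<Longrightarrow> n \<noteq> m \<Longrightarrow> min_dist3 (p n) (q n) (q m) \<le> e"
      "\<And>n m. n < M \<Longrightarrow> m < M \<Longrightarrow> n \<noteq> m \<Longrightarrow> min_dist3 (p m) (q m) (z n) \<le> e"
  shows "(\<Sum>n<M. min (norm (z n - p n)) (norm (z n - q n))) \<le>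
    (\<Sum>n<M. 5 * e + (norm (z n - p n) + norm (z n - q n) - norm (p n - q n)) / 2) + D / 2"
proof -
  define r where "r n = min (norm (z n - p n)) (norm (z n - q n))" for n
  \<comment> \<open>The slack of the path from \<open>p n\<close> over \<open>z n\<close> to
    \<open>q n\<close>; it will have a small integral because the chain divides the segment
    metrically. The smaller distance \<open>r n\<close> is at most the mean of the two.\<close>
  define x where "x n = norm (z n - p n) + norm (z n - q n) - norm (p n - q n)" for n
  have x0: "0 \<le> x n" for n
    using norm_triangle_ineq[of "p n - z n" "z n - q n"] by (simp add: x_def norm_minus_commute[of "p n"])
  have r_le: "r n \<le> norm (p n - q n) / 2 + x n / 2" for n
    by (auto simp: r_def x_def min_def field_simps)
  \<comment> \<open>The threshold \<open>10 * e\<close> separates concentrated from spread-out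
    pairs: below it the mean of the two distances already suffices.\<close>
  have good1: "r n \<le> 5 * e + x n / 2" if "norm (p n - q n) \<le> 10 * e" for n
    using r_le[of n] that by linarith
  have good2: "r n \<le> 5 * e + x n / 2" 
    if n: "n < M" "m < M" "n \<noteq> m" and Dn: "norm (p n - q n) > 10 * e" and Dm: "norm (p m - q m) > 10 * e" for n m
  proof -
    have 1: "norm (p m - p n) \<le> e \<or> norm (p m - q n) \<le> e"
      using tri(1)[OF n] Dn e by (intro min_dist3_cases) auto
    have 2: "norm (q m - p n) \<le> e \<or> norm (q m - q n) \<le> e"
      using tri(2)[OF n] Dn e by (intro min_dist3_cases) auto
    have 3: "norm (z n - p m) \<le> e \<or> norm (z n - q m) \<le> e"
      using tri(3)[OF n] Dm e by (intro min_dist3_cases) auto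
    have "norm (p n - q n) \<le> norm (p m - p n) + norm (p m - q n)" 
      "norm (p n - q n) \<le> norm (q m - p n) + norm (q m - q n)"
      using norm_triangle_ineq4[of "p m - q n" "p m - p n"] norm_triangle_ineq4[of "q m - q n" "q m - p n"] by simp_all
    have t1: "norm (z n - p n) \<le> norm (z n - p m) + norm (p m - p n)"
      using norm_triangle_ineq[of "z n - p m" "p m - p n"] by simp
    have t2: "norm (z n - q n) \<le> norm (z n - p m) + norm (p m - q n)"
      using norm_triangle_ineq[of "z n - p m" "p m - q n"] by simp
    have t3: "norm (z n - p n) \<le> norm (z n - q m) + norm (q m - p n)"
      using norm_triangle_ineq[of "z n - q m" "q m - p n"] by simp
    have t4: "norm (z n - q n) \<le> norm (z n - q m) + norm (q m - q n)"
      using norm_triangle_ineq[of "z n - q m" "q m - q n"] by simp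
    \<comment> \<open>Both \<open>p m\<close> and \<open>q m\<close> are within \<open>e\<close> of
      \<open>p n\<close> or \<open>q n\<close>, and \<open>z n\<close> is within \<open>e\<close> of
      \<open>p m\<close> or \<open>q m\<close>.\<close>
    have "norm (z n - p n) \<le> 2 * e \<or> norm (z n - q n) \<le> 2 * e"
      using 1 2 3 t1 t2 t3 t4 by linarith
    then have "r n \<le> 2 * e" by (auto simp: r_def min_le_iff_disj)
    then show ?thesis using e x0[of n] by linarith
  qed
  have "(\<Sum>n<M. r n) \<le> (\<Sum>n<M. 5 * e + x n / 2) + D / 2"
  proof (cases "\<exists>n m. n < M \<and> m < M \<and> n \<noteq> m \<and> norm (p n - q n) > 10 * e \<and> norm (p m - q m) > 10 * e")
    case True
    then obtain a b where ab: "a < M" "b < M" "a \<noteq> b" "norm (p a - q a) > 10 * e" "norm (p b - q b) > 10 * e"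
      by blast
    have "r n \<le> 5 * e + x n / 2" if n: "n < M" for n
    proof (cases "norm (p n - q n) \<le> 10 * e")
      case False
      then show ?thesis
        using good2[OF n ab(1)] good2[OF n ab(2)] ab by (cases "n = a") auto
    qed (rule good1)
    then have "(\<Sum>n<M. r n) \<le> (\<Sum>n<M. 5 * e + x n / 2)" by (intro sum_mono) simp
    then show ?thesis using D(1) by simp
  next
    case False
    then obtain n0 where n0: "\<And>n. n < M \<Longrightarrow> n \<noteq> n0 \<Longrightarrow> norm (p n - q n) \<le> 10 * e"
      by (metis not_le)
    have "(\<Sum>n<M. r n) \<le> (\<Sum>n<M. (5 * e + x n / 2) + (if n = n0 then D / 2 else 0))"
    proof (rule sum_mono)
      fix n assume "n \<in> {..<M}"
      then have n: "n < M" by simp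
      show "r n \<le> (5 * e + x n / 2) + (if n = n0 then D / 2 else 0)"
        using good1[of n] n0[OF n] r_le[of n] D(2)[OF n] e by (cases "n = n0") auto
    qed
    also have "\<dots> = (\<Sum>n<M. 5 * e + x n / 2) + (\<Sum>n<M. if n = n0 then D / 2 else 0)"
      by (rule sum.distrib)
    also have "(\<Sum>n<M. if n = n0 then D / 2 else 0) \<le> D / 2" using D(1) by simp
    finally show ?thesis by simp
  qed
  then show ?thesis by (simp only: r_def x_def)
qed

text \<open>The pointwise lemma is applied with \<open>E t\<close>, the sum of all triple distances
  at \<open>t\<close>, as its error, and with \<open>D t\<close> as a common bound for all
  \<open>norm (p n - q n)\<close> at \<open>t\<close>. The integral of \<open>D\<close> is at most
  \<open>c + real M * \<eta>\<close>, so that its share per copy becomes small for large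
  \<open>M\<close> and small \<eta>.\<close>

lemma sum_integral_min_dist_le:
  fixes p q z :: "nat \<Rightarrow> 'a::euclidean_space L1"
  assumes c: "0 \<le> c" and ex: "\<And>n. n < M \<Longrightarrow> excess c (p n - q n) \<le> \<eta>"
    and x: "\<And>n. n < M \<Longrightarrow> norm (z n - p n) + norm (z n - q n) - norm (p n - q n) \<le> x"
    and tri: "\<And>n m. n < M \<Longrightarrow> m < M \<Longrightarrow> n \<noteq> m \<Longrightarrow> (\<integral>t. min_dist3 (rep_L1 (p n) t) (rep_L1 (q n) t) (rep_L1 (p m) t) \<partial>I01) \<le> e"
      "\<And>n m. n < M \<Longrightarrow> m < M \<Longrightarrow> n \<noteq> m \<Longrightarrow> (\<integral>t. min_dist3 (rep_L1 (p n) t) (rep_L1 (q n) t) (rep_L1 (q m) t) \<partial>I01) \<le> e"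
      "\<And>n m. n < M \<Longrightarrow> m < M \<Longrightarrow> n \<noteq> m \<Longrightarrow> (\<integral>t. min_dist3 (rep_L1 (p m) t) (rep_L1 (q m) t) (rep_L1 (z n) t) \<partial>I01) \<le> e"
    and e: "0 \<le> e"
  shows "(\<Sum>n<M. \<integral>t. min (norm (rep_L1 (z n) t - rep_L1 (p n) t)) (norm (rep_L1 (z n) t - rep_L1 (q n) t)) \<partial>I01)
    \<le> real M * (5 * (real M * (real M * (3 * e)))) + real M * (x / 2) + (c + real M * \<eta>) / 2"
proof -
  let ?P = "\<lambda>n. rep_L1 (p n)" and ?Q = "\<lambda>n. rep_L1 (q n)" and ?Z = "\<lambda>n. rep_L1 (z n)"
  define E1 where "E1 n m t = (if n = m then 0 else min_dist3 (?P n t) (?Q n t) (?P m t) +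
    min_dist3 (?P n t) (?Q n t) (?Q m t) + min_dist3 (?P m t) (?Q m t) (?Z n t))" for n m t
  define E where "E t = (\<Sum>n<M. \<Sum>m<M. E1 n m t)" for t
  define D where "D t = c + (\<Sum>n<M. max (norm (?P n t - ?Q n t) - c) 0)" for t
  have md0: "0 \<le> min_dist3 a b c" for a b c :: 'a by (simp add: min_dist3_def)
  have intE1: "integrable I01 (E1 n m)" for n m
    unfolding E1_def by (cases "n = m") (auto intro!: Bochner_Integration.integrable_add)
  have intE: "integrable I01 E" unfolding E_def by (intro Bochner_Integration.integrable_sum intE1)
  have intD: "integrable I01 D" unfolding D_def
    by (intro Bochner_Integration.integrable_add Bochner_Integration.integrable_sum) auto
  have E10: "0 \<le> E1 n m t" for n m t by (simp add: E1_def md0)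
  have E1E: "E1 n m t \<le> E t" if "n < M" "m < M" for n m t
  proof -
    have "E1 n m t \<le> (\<Sum>m<M. E1 n m t)" using that E10 by (intro member_le_sum) auto
    also have "\<dots> \<le> E t" unfolding E_def
      using that E10 by (intro member_le_sum[of n "{..<M}" "\<lambda>n. \<Sum>m<M. E1 n m t"]) (auto intro: sum_nonneg)
    finally show ?thesis .
  qed
  have intE_le: "(\<integral>t. E t \<partial>I01) \<le> real M * (real M * (3 * e))"
  proof -
    have le: "(\<integral>t. E1 n m t \<partial>I01) \<le> 3 * e" if nm: "n < M" "m < M" for n m
    proof (cases "n = m")
      case True
      then show ?thesis using e by (simp add: E1_def)
    next
      case False
      then have "(\<integral>t. E1 n m t \<partial>I01) = (\<integral>t. min_dist3 (?P n t) (?Q n t) (?P m t) \<partial>I01) +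
        (\<integral>t. min_dist3 (?P n t) (?Q n t) (?Q m t) \<partial>I01) + (\<integral>t. min_dist3 (?P m t) (?Q m t) (?Z n t) \<partial>I01)"
        by (simp add: E1_def Bochner_Integration.integral_add)
      then show ?thesis using tri(1)[OF nm False] tri(2)[OF nm False] tri(3)[OF nm False] by linarith
    qed
    have "(\<integral>t. E t \<partial>I01) = (\<Sum>n<M. \<Sum>m<M. \<integral>t. E1 n m t \<partial>I01)"
      unfolding E_def using intE1 by (simp add: Bochner_Integration.integral_sum Bochner_Integration.integrable_sum)
    also have "\<dots> \<le> (\<Sum>n<M. \<Sum>m<M. 3 * e)" by (intro sum_mono le) auto
    finally show ?thesis by simp
  qed
  have intD_le: "(\<integral>t. D t \<partial>I01) \<le> c + real M * \<eta>"
  proof -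
    have "(\<integral>t. D t \<partial>I01) = c + (\<Sum>n<M. excess c (p n - q n))"
      unfolding D_def excess_diff_eq_integral
      by (subst Bochner_Integration.integral_add) (auto intro!: Bochner_Integration.integrable_sum)
    also have "\<dots> \<le> c + (\<Sum>n<M. \<eta>)" using ex by (intro add_left_mono sum_mono) auto
    finally show ?thesis by simp
  qed
  define X where "X n t = norm (?Z n t - ?P n t) + norm (?Z n t - ?Q n t) - norm (?P n t - ?Q n t)" for n t
  have intX: "integrable I01 (X n)" for n
    unfolding X_def by (intro Bochner_Integration.integrable_add Bochner_Integration.integrable_diff) auto
  have intX_le: "(\<integral>t. X n t \<partial>I01) \<le> x" if "n < M" for n
  proof -
    have "(\<integral>t. X n t \<partial>I01) = norm (z n - p n) + norm (z n - q n) - norm (p n - q n)"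
      unfolding X_def norm_diff_eq_integral by simp
    then show ?thesis using x[OF that] by simp
  qed
  let ?r = "\<lambda>n t. min (norm (?Z n t - ?P n t)) (norm (?Z n t - ?Q n t))"
  have intr: "integrable I01 (?r n)" for n by (intro integrable_min) auto
  have "(\<Sum>n<M. \<integral>t. ?r n t \<partial>I01) = (\<integral>t. (\<Sum>n<M. ?r n t) \<partial>I01)"
    by (rule Bochner_Integration.integral_sum[symmetric]) (rule intr)
  also have "\<dots> \<le> (\<integral>t. (\<Sum>n<M. 5 * E t + X n t / 2) + D t / 2 \<partial>I01)"
  proof (rule Bochner_Integration.integral_mono)
    show "integrable I01 (\<lambda>t. \<Sum>n<M. ?r n t)" using intr by (rule Bochner_Integration.integrable_sum)
    show "integrable I01 (\<lambda>t. (\<Sum>n<M. 5 * E t + X n t / 2) + D t / 2)"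
      using intE intX intD by (intro Bochner_Integration.integrable_add Bochner_Integration.integrable_sum
        integrable_mult_right integrable_divide) auto
    fix t
    show "(\<Sum>n<M. ?r n t) \<le> (\<Sum>n<M. 5 * E t + X n t / 2) + D t / 2"
      unfolding X_def
    proof (rule sum_min_dist_le)
      show "0 \<le> E t" unfolding E_def using E10 by (intro sum_nonneg) auto
      show "0 \<le> D t" unfolding D_def using c by (intro add_nonneg_nonneg sum_nonneg) auto
      fix n assume n: "n < M"
      have "max (norm (?P n t - ?Q n t) - c) 0 \<le> (\<Sum>n<M. max (norm (?P n t - ?Q n t) - c) 0)"
        using n by (intro member_le_sum[of n "{..<M}" "\<lambda>n. max (norm (?P n t - ?Q n t) - c) 0"]) auto
      then show "norm (?P n t - ?Q n t) \<le> D t" by (simp add: D_def)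
    next
      fix n m assume nm: "n < M" "m < M" "n \<noteq> m"
      show "min_dist3 (?P n t) (?Q n t) (?P m t) \<le> E t" "min_dist3 (?P n t) (?Q n t) (?Q m t) \<le> E t"
        "min_dist3 (?P m t) (?Q m t) (?Z n t) \<le> E t"
        using E1E[OF nm(1,2), of t] nm(3) md0[of "?P n t" "?Q n t" "?P m t"] md0[of "?P n t" "?Q n t" "?Q m t"]
          md0[of "?P m t" "?Q m t" "?Z n t"] by (auto simp: E1_def)
    qed
  qed
  also have "\<dots> = (\<Sum>n<M. 5 * (\<integral>t. E t \<partial>I01) + (\<integral>t. X n t \<partial>I01) / 2) + (\<integral>t. D t \<partial>I01) / 2"
    using intE intX intD by (simp add: Bochner_Integration.integral_add Bochner_Integration.integral_sum)
  also have "\<dots> \<le> (\<Sum>n<M. 5 * (real M * (real M * (3 * e))) + x / 2) + (c + real M * \<eta>) / 2"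
    using intE_le intX_le intD_le by (intro add_mono sum_mono divide_right_mono mult_left_mono) auto
  finally show ?thesis by (simp add: sum.distrib distrib_left)
qed

section \<open>Jumps along a chain and the final contradiction\<close>

lemma jump_le:
  fixes z :: "nat \<Rightarrow> 'b::real_normed_vector"
  assumes W: "\<And>i. i < N \<Longrightarrow> norm (z (Suc i) - z i) \<le> W" and W0: "0 \<le> W"
  shows "norm (z 0 - z N) \<le> W + (\<Sum>i\<le>N. min (norm (z i - z 0)) (norm (z i - z N)))"
proof -
  define r where "r i = min (norm (z i - z 0)) (norm (z i - z N))" for i
  have r0: "0 \<le> r i" for i by (simp add: r_def)
  define near where "near i \<longleftrightarrow> norm (z i - z 0) \<le> norm (z i - z N)" for i
  have "norm (z 0 - z N) \<le> W + (\<Sum>i\<le>N. r i)"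
  \<comment> \<open>At a step where the chain stops being nearer to \<open>z 0\<close> than to
    \<open>z N\<close>, the distance of the ends is at most this step plus two of the minima.
    Without such a step \<open>z N\<close> is as near to \<open>z 0\<close> as to itself.\<close>
  proof (cases "\<exists>i<N. near i \<and> \<not> near (Suc i)")
    case True
    then obtain i where i: "i < N" "near i" "\<not> near (Suc i)" by blast
    have "norm (z 0 - z N) \<le> norm (z i - z 0) + norm (z (Suc i) - z i) + norm (z (Suc i) - z N)"
      using norm_triangle_ineq[of "z 0 - z i" "z i - z (Suc i)"] norm_triangle_ineq[of "z 0 - z (Suc i)" "z (Suc i) - z N"]
      by (simp add: norm_minus_commute[of "z 0" "z i"] norm_minus_commute[of "z i" "z (Suc i)"])
    also have "\<dots> \<le> r i + W + r (Suc i)" using i W[OF i(1)] by (simp add: r_def near_def)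
    also have "r i + r (Suc i) = (\<Sum>j\<in>{i, Suc i}. r j)" by simp
    then have "r i + W + r (Suc i) = W + (\<Sum>j\<in>{i, Suc i}. r j)" by simp
    also have "\<dots> \<le> W + (\<Sum>j\<le>N. r j)"
      using i r0 by (intro add_left_mono sum_mono2) auto
    finally show ?thesis .
  next
    case False
    have "near i" if "i \<le> N" for i
      using that
    proof (induction i)
      case (Suc i)
      then show ?case using False by auto
    qed (simp add: near_def)
    from this[of N] have "norm (z 0 - z N) = 0" by (simp add: near_def)
    moreover have "0 \<le> (\<Sum>i\<le>N. r i)" using r0 by (intro sum_nonneg) auto
    ultimately show ?thesis using W0 by linarith
  qed
  then show ?thesis by (simp only: r_def)
qed

text \<open>\<open>W t\<close> bounds the largest step at \<open>t\<close>. The norms of the steps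
  may well add up to the diameter, but the largest step has a small integral if the steps are small
  in norm and uniformly integrable after scaling.\<close>

lemma norm_jump_le:
  fixes z :: "nat \<Rightarrow> 'a::euclidean_space L1"
  assumes c: "0 \<le> c"
  shows "norm (z 0 - z N) \<le> c + (\<Sum>i<N. excess c (z (Suc i) - z i)) +
    (\<Sum>i\<le>N. \<integral>t. min (norm (rep_L1 (z i) t - rep_L1 (z 0) t)) (norm (rep_L1 (z i) t - rep_L1 (z N) t)) \<partial>I01)"
proof -
  let ?Z = "\<lambda>i. rep_L1 (z i)"
  define W where "W t = c + (\<Sum>i<N. max (norm (?Z (Suc i) t - ?Z i t) - c) 0)" for t
  let ?r = "\<lambda>i t. min (norm (?Z i t - ?Z 0 t)) (norm (?Z i t - ?Z N t))"
  have intW: "integrable I01 W" unfolding W_def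
    by (intro Bochner_Integration.integrable_add Bochner_Integration.integrable_sum) auto
  have intr: "integrable I01 (?r i)" for i by (intro integrable_min) auto
  have "norm (z 0 - z N) \<le> (\<integral>t. W t + (\<Sum>i\<le>N. ?r i t) \<partial>I01)"
    unfolding norm_diff_eq_integral
  proof (rule Bochner_Integration.integral_mono)
    show "integrable I01 (\<lambda>t. W t + (\<Sum>i\<le>N. ?r i t))"
      using intW intr by (intro Bochner_Integration.integrable_add Bochner_Integration.integrable_sum)
    fix t
    show "norm (?Z 0 t - ?Z N t) \<le> W t + (\<Sum>i\<le>N. ?r i t)"
    proof (rule jump_le)
      show "0 \<le> W t" unfolding W_def using c by (intro add_nonneg_nonneg sum_nonneg) auto
      fix i assume i: "i < N"
      have "max (norm (?Z (Suc i) t - ?Z i t) - c) 0 \<le> (\<Sum>i<N. max (norm (?Z (Suc i) t - ?Z i t) - c) 0)"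
        using i by (intro member_le_sum[of i "{..<N}" "\<lambda>i. max (norm (?Z (Suc i) t - ?Z i t) - c) 0"]) auto
      then show "norm (?Z (Suc i) t - ?Z i t) \<le> W t" by (simp add: W_def)
    qed
  qed auto
  also have "\<dots> = (\<integral>t. W t \<partial>I01) + (\<Sum>i\<le>N. \<integral>t. ?r i t \<partial>I01)"
    using intW intr by (simp add: Bochner_Integration.integral_add Bochner_Integration.integral_sum
      Bochner_Integration.integrable_sum)
  also have "(\<integral>t. W t \<partial>I01) = c + (\<Sum>i<N. excess c (z (Suc i) - z i))"
    unfolding W_def excess_diff_eq_integral
    by (subst Bochner_Integration.integral_add) (auto intro!: Bochner_Integration.integrable_sum)
  finally show ?thesis .
qed

lemma excess_scaled_le:
  assumes Y: "subspace Y" and R: "\<And>f. f \<in> Y \<Longrightarrow> norm f \<le> 1 \<Longrightarrow> excess R f \<le> \<eta>"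
    and f: "f \<in> Y" "norm f \<le> s" and s: "0 < s"
  shows "excess (s * R) f \<le> s * \<eta>"
proof -
  have "excess R ((1/s) *\<^sub>R f) \<le> \<eta>" using f s Y by (intro R) (auto simp: subspace_scale)
  moreover have "excess (\<bar>s\<bar> * R) (s *\<^sub>R (1/s) *\<^sub>R f) = \<bar>s\<bar> * excess R ((1/s) *\<^sub>R f)" by (rule excess_scaleR)
  ultimately show ?thesis using s by simp
qed

text \<open>The parameters are chosen in the order \<open>R\<close>, \<open>N\<close>, \<eta>,
  \<open>R'\<close>, \<open>M\<close>, \<epsilon>. A large \<open>N\<close> makes the largest step
  of a chain small, a large \<open>M\<close> makes the loss from unpartnered pairs small even after
  summing over all \<open>N + 1\<close> chain points, and \<epsilon> absorbs the errors that were
  multiplied by powers of \<open>M\<close>. In the end some pair has distance at most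
  \<open>3/8 * d\<close>, although it should be at least \<open>d - \<epsilon>\<close>.\<close>

lemma (in minimal_invariant) diameter_eq_0:
  assumes Y: "subspace Y" "K \<subseteq> Y" and eq: "equi_int {f\<in>Y. norm f \<le> 1}"
  shows "d = 0"
proof (rule ccontr)
  assume "d \<noteq> 0"
  then have d: "d > 0" using d_nonneg by simp
  have "(1/16::real) > 0" by simp
  then obtain R where R: "R \<ge> 0" "\<And>f. f \<in> Y \<Longrightarrow> norm f \<le> 1 \<Longrightarrow> excess R f \<le> 1/16"
    using eq unfolding equi_int_def by blast
  obtain N where N: "real N > max 1 (16 * R)" using reals_Archimedean2 by blast
  then have N1: "N > 0" "real N > 16 * R" "real N \<ge> 1" by auto
  define \<eta> where "\<eta> = 1 / (16 * (real N + 1))"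
  have "\<eta> > 0" using N1 by (simp add: \<eta>_def)
  then obtain R' where R': "R' \<ge> 0" "\<And>f. f \<in> Y \<Longrightarrow> norm f \<le> 1 \<Longrightarrow> excess R' f \<le> \<eta>"
    using eq unfolding equi_int_def by blast
  obtain M where M: "real M > max 1 (16 * R' * (real N + 1))" using reals_Archimedean2 by blast
  then have M1: "M > 0" "real M > 16 * R' * (real N + 1)" by auto
  \<comment> \<open>The factor 120 is \<open>5 * 3 * 8\<close> from the two integrated lemmas, and 2
    exceeds the 3/2 coming from the slack \<open>3 * \<epsilon>\<close>.\<close>
  define L where "L = 120 * (real M)\<^sup>2 + 2"
  have L: "L \<ge> 2" by (simp add: L_def)
  define \<epsilon> where "\<epsilon> = d / (16 * (real N + 1) * L)"
  have den: "16 * (real N + 1) * L > 0" using L N1 by simp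
  have e: "\<epsilon> > 0" using d den by (simp add: \<epsilon>_def)
  have eL: "(real N + 1) * (L * \<epsilon>) = d / 16" using den by (simp add: \<epsilon>_def field_simps)
  have eN: "\<epsilon> \<le> d / N"
  proof -
    have "real N \<le> 16 * (real N + 1) * L" using mult_mono[of 1 L "real N" "16 * (real N + 1)"] L N1 by (simp add: mult.commute)
    then show ?thesis unfolding \<epsilon>_def using d N1 den by (intro divide_left_mono) auto
  qed
  have e16: "\<epsilon> \<le> d / 16"
  proof -
    have "1 * (1 * \<epsilon>) \<le> (real N + 1) * (L * \<epsilon>)" using e L N1 by (intro mult_mono) auto
    then show ?thesis using eL by simp
  qed
  obtain p q :: "nat \<Rightarrow> 'a L1" and z :: "nat \<Rightarrow> nat \<Rightarrow> 'a L1"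
  where z0: "\<And>n. z n 0 = p n" and zN: "\<And>n. z n N = q n" and zK: "\<And>n i. i \<le> N \<Longrightarrow> z n i \<in> K"
    and zp: "\<And>n i. i \<le> N \<Longrightarrow> norm (z n i - p n) \<le> real i / N * d + \<epsilon>"
    and zq: "\<And>n i. i \<le> N \<Longrightarrow> norm (z n i - q n) \<le> (1 - real i / N) * d + \<epsilon>"
    and zz: "\<And>n i. i < N \<Longrightarrow> norm (z n (Suc i) - z n i) \<le> d / N + \<epsilon>"
    and pq: "\<And>n. d - \<epsilon> \<le> norm (p n - q n)"
    and far: "\<And>n m i. n \<noteq> m \<Longrightarrow> i \<le> N \<Longrightarrow> midpoint_far (d - \<epsilon>) (p n) (q n) (z m i)"
    using exists_independent_chains[OF N1(1) e] by metis
  have pK: "p n \<in> K" and qK: "q n \<in> K" for n using zK[of 0 n] zK[of N n] z0 zN by auto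
  have tri: "(\<integral>t. min_dist3 (rep_L1 (p n) t) (rep_L1 (q n) t) (rep_L1 (z m i) t) \<partial>I01) \<le> 8 * \<epsilon>"
    if "n \<noteq> m" "i \<le> N" for n m i
    by (rule integral_min_dist3_le[OF dist_le_d[OF pK qK] dist_le_d[OF qK zK[OF that(2)]]
      dist_le_d[OF pK zK[OF that(2)]] far[OF that]])
  have tri_p: "(\<integral>t. min_dist3 (rep_L1 (p n) t) (rep_L1 (q n) t) (rep_L1 (p m) t) \<partial>I01) \<le> 8 * \<epsilon>"
    and tri_q: "(\<integral>t. min_dist3 (rep_L1 (p n) t) (rep_L1 (q n) t) (rep_L1 (q m) t) \<partial>I01) \<le> 8 * \<epsilon>"
    if "n \<noteq> m" for n m
    using tri[OF that, of 0] tri[OF that, of N] by (simp_all add: z0 zN)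
  define r where "r n i = (\<integral>t. min (norm (rep_L1 (z n i) t - rep_L1 (p n) t)) (norm (rep_L1 (z n i) t - rep_L1 (q n) t)) \<partial>I01)" for n i
  have sum0: "(\<Sum>n<M. r n i) \<le> real M * (5 * (real M * (real M * (3 * (8 * \<epsilon>))))) + real M * (3 * \<epsilon> / 2) + (d * R' + real M * (d * \<eta>)) / 2"
    if i: "i \<le> N" for i
    unfolding r_def
  proof (rule sum_integral_min_dist_le)
    show "0 \<le> d * R'" using d R' by simp
    show "excess (d * R') (p n - q n) \<le> d * \<eta>" for n
    proof (rule excess_scaled_le[OF Y(1) R'(2)])
      show "p n - q n \<in> Y" using Y pK qK by (intro subspace_diff) auto
      show "norm (p n - q n) \<le> d" using pK qK by (rule dist_le_d)
    qed (use d in auto)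
    fix n
    have "real i / N * d + (1 - real i / N) * d = d" by (simp add: algebra_simps)
    then show "norm (z n i - p n) + norm (z n i - q n) - norm (p n - q n) \<le> 3 * \<epsilon>"
      using zp[OF i, of n] zq[OF i, of n] pq[of n] by linarith
  qed (use tri_p tri_q tri i e in auto)
  have sum_i: "(\<Sum>n<M. r n i) \<le> real M * (L * \<epsilon> + d * R' / (2 * real M) + d * \<eta> / 2)" if "i \<le> N" for i
  proof -
    have "real M * (5 * (real M * (real M * (3 * (8 * \<epsilon>))))) + real M * (3 * \<epsilon> / 2) + (d * R' + real M * (d * \<eta>)) / 2
       = real M * (120 * (real M)\<^sup>2 * \<epsilon> + 3 * \<epsilon> / 2 + d * R' / (2 * real M) + d * \<eta> / 2)"
      using M1 by (simp add: field_simps power2_eq_square)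
    also have "\<dots> \<le> real M * (L * \<epsilon> + d * R' / (2 * real M) + d * \<eta> / 2)"
      using e by (intro mult_left_mono) (auto simp: L_def distrib_right)
    finally show ?thesis using sum0[OF that] by linarith
  qed
  define c where "c = L * \<epsilon> + d * R' / (2 * real M) + d * \<eta> / 2"
  define A where "A = (real N + 1) * c"
  \<comment> \<open>The term with \<open>L * \<epsilon>\<close> contributes \<open>d / 16\<close>,
    each of the other two at most \<open>d / 32\<close>.\<close>
  have A: "A \<le> d / 8"
  proof -
    have "(real N + 1) * (d * \<eta> / 2) = d / 32" using N1 by (simp add: \<eta>_def field_simps)
    moreover have "(real N + 1) * (d * R' / (2 * real M)) \<le> d / 32"
    proof -
      have "(real N + 1) * (d * R' / (2 * real M)) = d / 32 * ((16 * R' * (real N + 1)) / real M)"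
        using M1 by (simp add: field_simps)
      also have "\<dots> \<le> d / 32 * 1" using d M1 by (intro mult_left_mono) (auto simp: divide_le_eq)
      finally show ?thesis by simp
    qed
    ultimately show ?thesis unfolding A_def c_def distrib_left using eL by linarith
  qed
  \<comment> \<open>For each position in the chain the bound is a sum over the copies. Exchanging
    the sums yields one copy that is good for all positions together.\<close>
  have "\<exists>n<M. (\<Sum>i\<le>N. r n i) \<le> A"
  proof (rule ccontr)
    assume "\<not> ?thesis"
    then have "(\<Sum>n<M. A) < (\<Sum>n<M. \<Sum>i\<le>N. r n i)"
      using M1 by (intro sum_strict_mono) (auto simp: not_le)
    also have "\<dots> = (\<Sum>i\<le>N. \<Sum>n<M. r n i)" by (rule sum.swap)
    also have "\<dots> \<le> (\<Sum>i\<le>N. real M * c)"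
      unfolding c_def by (intro sum_mono sum_i) auto
    also have "\<dots> = real M * A" by (simp add: A_def algebra_simps)
    finally show False by simp
  qed
  then obtain n where n: "(\<Sum>i\<le>N. r n i) \<le> A" by blast
  define s where "s = d / N + \<epsilon>"
  have s: "0 < s" "s \<le> 2 * d / N" using d N1 e eN by (auto simp: s_def add_nonneg_pos)
  have sR: "s * R \<le> d / 8"
  proof -
    have "s * R \<le> (2 * d / N) * R" using s R by (intro mult_right_mono) auto
    also have "\<dots> = d / 8 * (16 * R / N)" using N1 by (simp add: field_simps)
    also have "\<dots> \<le> d / 8 * 1" using d N1 by (intro mult_left_mono) (auto simp: divide_le_eq)
    finally show ?thesis by simp
  qed
  have "excess (s * R) (z n (Suc i) - z n i) \<le> s * (1/16)" if "i < N" for i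
  proof (rule excess_scaled_le[OF Y(1) R(2) _ _ s(1)])
    show "z n (Suc i) - z n i \<in> Y" using Y zK[of "Suc i" n] zK[of i n] that by (intro subspace_diff) auto
    show "norm (z n (Suc i) - z n i) \<le> s" using zz[OF that] by (simp add: s_def)
  qed auto
  then have "(\<Sum>i<N. excess (s * R) (z n (Suc i) - z n i)) \<le> (\<Sum>i<N. s * (1/16))" by (intro sum_mono) auto
  also have "\<dots> \<le> d / 8" using s N1 by (simp add: field_simps)
  finally have "norm (p n - q n) \<le> d / 8 + d / 8 + d / 8"
    using norm_jump_le[of "s * R" "z n" N] s R sR n A by (simp add: z0 zN r_def)
  then show False using pq[of n] e16 d by simp
qed

lemma equi_int_imp_fixed_point_property:
  fixes Y :: "'a::euclidean_space L1 set"
  assumes Y: "subspace Y" "closed Y" and eq: "equi_int {f\<in>Y. norm f \<le> 1}"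
  shows "fixed_point_property Y"
  unfolding fixed_point_property_def
proof (intro allI impI, elim conjE)
  fix C T
  assume CY: "C \<subseteq> Y" and "C \<noteq> {}" and cl: "closedin (top_of_set Y) C" and bd: "bounded C" and "convex C"
    and T: "T \<in> C \<rightarrow> C" and ne: "\<forall>x\<in>C. \<forall>y\<in>C. norm (T x - T y) \<le> norm (x - y)"
  obtain B where B: "B > 0" "\<And>x. x \<in> C \<Longrightarrow> norm x \<le> B" using bd by (auto simp: bounded_pos)
  have "C \<subseteq> (*\<^sub>R) B ` {f\<in>Y. norm f \<le> 1}"
  proof
    fix x assume "x \<in> C"
    then show "x \<in> (*\<^sub>R) B ` {f\<in>Y. norm f \<le> 1}"
      using B CY Y(1) by (intro image_eqI[of _ _ "(1/B) *\<^sub>R x"]) (auto simp: subspace_scale)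
  qed
  then have "equi_int C" using equi_int_subset[OF equi_int_scaleR[OF eq]] by blast
  moreover have "closed C" using cl Y(2) by (rule closedin_closed_trans)
  ultimately obtain K where K: "K \<subseteq> C" "minimal_invariant K T"
    using exists_minimal_invariant[of C T] \<open>C \<noteq> {}\<close> \<open>convex C\<close> T ne by blast
  interpret minimal_invariant K T by (rule K(2))
  have "d = 0" using CY K(1) by (intro diameter_eq_0[OF Y(1) _ eq]) auto
  obtain x where x: "x \<in> K" using K_nonempty by blast
  have "norm (T x - x) \<le> d" using T_in[OF x] x by (rule dist_le_d)
  then show "\<exists>x\<in>C. T x = x" using \<open>d = 0\<close> x K(1) by (intro bexI[of _ x]) auto
qed

lemma reflexive_iff_fixed_point_property:
  fixes Y :: "'a::{real_normed_field, euclidean_space} L1 set"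
  assumes "L1.subspace Y" "closed Y"
  shows "reflexive_space scale_L1 norm Y \<longleftrightarrow> fixed_point_property Y"
proof
  note Y = L1_subspace_imp_subspace[OF assms(1)] assms(2)
  show "fixed_point_property Y" if "reflexive_space scale_L1 norm Y"
    using equi_int_imp_fixed_point_property[OF Y reflexive_imp_equi_int[OF assms(1) that]] .
  show "reflexive_space scale_L1 norm Y" if "fixed_point_property Y"
    using equi_int_imp_reflexive[OF assms fixed_point_property_imp_equi_int[OF Y that]] .
qed

theorem theorem5p3:
  "(\<forall>Y :: real L1 set. L1.subspace Y \<and> closed Y \<longrightarrow>
      (reflexive_space scale_L1 norm Y \<longleftrightarrow> fixed_point_property Y)) \<and>
   (\<forall>Y :: complex L1 set. L1.subspace Y \<and> closed Y \<longrightarrow>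
      (reflexive_space scale_L1 norm Y \<longleftrightarrow> fixed_point_property Y))"
  by (intro conjI allI impI; elim conjE; rule reflexive_iff_fixed_point_property)

end
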